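(* Let $q=1$ and let $E\subset\mathbb{R}^d$ be a set with $\chi_E\in\mathcal{M}$. Let $S\subset\mathbb{R}^d$ be a $C^1$ hypersurface contained in the measure theoretic boundary $\partial_*E$, which after a rotation is a graph $S=\{(y,\varphi(y)):y\in V_0\}$ with $V_0\subset\mathbb{R}^{d-1}$ open, $\varphi\in C^1(V_0)$, and whose unit normal $(1+|\nabla\varphi|^2)^{-1/2}(\nabla\varphi,-1)$ is the measure theoretic outer normal of $E$. Then, as a distribution on $V_0$, $$\Big|{\rm div}\Big(\frac{\nabla\varphi}{\sqrt{1+|\nabla\varphi|^2}}\Big)\Big|\le\lambda\|K\|_{L^p},$$ meaning $\big|\int_{V_0}\nabla g\cdot\frac{\nabla\varphi}{\sqrt{1+|\nabla\varphi|^2}}\,dy\big|\le\lambda\|K\|_{L^p}\int_{V_0}|g|\,dy$ for all $g\in C_c^\infty(V_0)$.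
   Context: $BV=BV(\mathbb{R}^d)$ is the space of real $u\in L^1_{\rm loc}(\mathbb{R}^d)$ with $\|u\|_{\dot{BV}}=\sup\{\int u\,{\rm div}\varphi\,dx:\varphi\in C^1_c(\mathbb{R}^d;\mathbb{R}^d),\ \sup|\varphi|\le 1\}<\infty$. For a set $E$ of finite perimeter, $\partial_*E$ is its measure theoretic boundary and the measure theoretic outer normal $\vec n$ is defined $\Lambda_{d-1}$-a.e. on $\partial_*E$ with $D\chi_E$ expressed via $\vec n\,\Lambda_{d-1}|_{\partial_*E}$ (as in Evans–Gariepy). Standing assumptions: $K$ is a positive, even, bounded, real analytic function on $\mathbb{R}^d$ with $\int K\,dx=1$, such that $u\mapsto K*u$ is injective on $L^p$; $\lambda>0$, $1\le p<\infty$. $\mathcal{M}_{p,1,\lambda}(f)$ is the set of minimizers $u\in BV$ of $\|u\|_{\dot{BV}}+\lambda\|K*(f-u)\|_{L^p}$, and $\mathcal{M}=\bigcup_f\mathcal{M}_{p,1,\lambda}(f)$, the union over all real $f$. *)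

theory Defs
  imports "HOL-Analysis.Analysis"
begin

definition loc_integrable :: "('b::euclidean_space \<Rightarrow> real) \<Rightarrow> bool" where
  "loc_integrable u \<longleftrightarrow> u \<in> borel_measurable lebesgue \<and>
     (\<forall>C. compact C \<longrightarrow> set_integrable lebesgue C u)"

definition C1c_field :: "('b::euclidean_space \<Rightarrow> 'b) \<Rightarrow> bool" where
  "C1c_field \<phi> \<longleftrightarrow> (\<forall>x. \<phi> differentiable (at x)) \<and>
     (\<forall>b\<in>Basis. \<forall>c\<in>Basis. continuous_on UNIV (\<lambda>x. frechet_derivative \<phi> (at x) b \<bullet> c)) \<and>
     compact (closure {x. \<phi> x \<noteq> 0})"

definition divergence :: "('b::euclidean_space \<Rightarrow> 'b) \<Rightarrow> 'b \<Rightarrow> real" where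
  "divergence \<phi> x = (\<Sum>b\<in>Basis. frechet_derivative \<phi> (at x) b \<bullet> b)"

definition bv_tests :: "('b::euclidean_space \<Rightarrow> real) \<Rightarrow> real set" where
  "bv_tests u = {LINT x|lebesgue. u x * divergence \<phi> x | \<phi>. C1c_field \<phi> \<and> (\<forall>x. norm (\<phi> x) \<le> 1)}"

definition in_BV :: "('b::euclidean_space \<Rightarrow> real) \<Rightarrow> bool" where
  "in_BV u \<longleftrightarrow> loc_integrable u \<and> bdd_above (bv_tests u)"

definition bv_seminorm :: "('b::euclidean_space \<Rightarrow> real) \<Rightarrow> real" where
  "bv_seminorm u = Sup (bv_tests u)"

definition conv :: "('b::euclidean_space \<Rightarrow> real) \<Rightarrow> ('b \<Rightarrow> real) \<Rightarrow> 'b \<Rightarrow> real" where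
  "conv K g x = (LINT y|lebesgue. K (x - y) * g y)"

definition conv_defined :: "('b::euclidean_space \<Rightarrow> real) \<Rightarrow> ('b \<Rightarrow> real) \<Rightarrow> bool" where
  "conv_defined K g \<longleftrightarrow> (AE x in lebesgue. integrable lebesgue (\<lambda>y. K (x - y) * g y))"

definition in_Lp :: "real \<Rightarrow> ('b::euclidean_space \<Rightarrow> real) \<Rightarrow> bool" where
  "in_Lp p g \<longleftrightarrow> g \<in> borel_measurable lebesgue \<and> integrable lebesgue (\<lambda>x. \<bar>g x\<bar> powr p)"

definition lp_norm :: "real \<Rightarrow> ('b::euclidean_space \<Rightarrow> real) \<Rightarrow> real" where
  "lp_norm p g = (LINT x|lebesgue. \<bar>g x\<bar> powr p) powr (1 / p)"

definition real_analytic :: "('b::euclidean_space \<Rightarrow> real) \<Rightarrow> bool" where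
  "real_analytic f \<longleftrightarrow> (\<forall>x0. \<exists>c :: ('b \<Rightarrow> nat) \<Rightarrow> real. \<exists>r>0. \<forall>x\<in>ball x0 r.
      ((\<lambda>\<alpha>. c \<alpha> * (\<Prod>b\<in>Basis. ((x - x0) \<bullet> b) ^ \<alpha> b)) has_sum f x)
        {\<alpha>. \<forall>v. v \<notin> Basis \<longrightarrow> \<alpha> v = 0})"

definition kernel_assms :: "('b::euclidean_space \<Rightarrow> real) \<Rightarrow> real \<Rightarrow> bool" where
  "kernel_assms K p \<longleftrightarrow> (\<forall>x. K x > 0) \<and> (\<forall>x. K (- x) = K x) \<and> bounded (range K) \<and>
     real_analytic K \<and> integrable lebesgue K \<and> (LINT x|lebesgue. K x) = 1 \<and>
     (\<forall>u v. in_Lp p u \<longrightarrow> in_Lp p v \<longrightarrow> (AE x in lebesgue. conv K u x = conv K v x)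
              \<longrightarrow> (AE x in lebesgue. u x = v x))"

definition tv_functional :: "('b::euclidean_space \<Rightarrow> real) \<Rightarrow> real \<Rightarrow> real \<Rightarrow> ('b \<Rightarrow> real) \<Rightarrow> ('b \<Rightarrow> real) \<Rightarrow> real" where
  "tv_functional K p lam f u = bv_seminorm u + lam * lp_norm p (conv K (\<lambda>x. f x - u x))"

definition admissible :: "('b::euclidean_space \<Rightarrow> real) \<Rightarrow> real \<Rightarrow> ('b \<Rightarrow> real) \<Rightarrow> ('b \<Rightarrow> real) \<Rightarrow> bool" where
  "admissible K p f u \<longleftrightarrow> in_BV u \<and> conv_defined K (\<lambda>x. f x - u x) \<and> in_Lp p (conv K (\<lambda>x. f x - u x))"

definition minimizers :: "('b::euclidean_space \<Rightarrow> real) \<Rightarrow> real \<Rightarrow> real \<Rightarrow> ('b \<Rightarrow> real) \<Rightarrow> ('b \<Rightarrow> real) set" where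
  "minimizers K p lam f = {u. admissible K p f u \<and>
     (\<forall>v. admissible K p f v \<longrightarrow> tv_functional K p lam f u \<le> tv_functional K p lam f v)}"

definition minimizer_class :: "('b::euclidean_space \<Rightarrow> real) \<Rightarrow> real \<Rightarrow> real \<Rightarrow> ('b \<Rightarrow> real) set" where
  "minimizer_class K p lam = (\<Union>f. minimizers K p lam f)"

section \<open>Measure theoretic boundary and outer normal (Evans--Gariepy)\<close>

definition mt_boundary :: "'b::euclidean_space set \<Rightarrow> 'b set" where
  "mt_boundary E = {x.
     Limsup (at_right 0) (\<lambda>r. ereal (measure lebesgue (ball x r \<inter> E) / r ^ DIM('b))) > 0 \<and>
     Limsup (at_right 0) (\<lambda>r. ereal (measure lebesgue (ball x r - E) / r ^ DIM('b))) > 0}"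

definition mt_outer_normal :: "'b::euclidean_space set \<Rightarrow> 'b \<Rightarrow> 'b \<Rightarrow> bool" where
  "mt_outer_normal E x \<nu> \<longleftrightarrow> norm \<nu> = 1 \<and>
     ((\<lambda>r. measure lebesgue (ball x r \<inter> {y. \<nu> \<bullet> (y - x) \<ge> 0} \<inter> E) / r ^ DIM('b)) \<longlongrightarrow> 0) (at_right 0) \<and>
     ((\<lambda>r. measure lebesgue ((ball x r \<inter> {y. \<nu> \<bullet> (y - x) \<le> 0}) - E) / r ^ DIM('b)) \<longlongrightarrow> 0) (at_right 0)"

definition C1_on :: "'a::euclidean_space set \<Rightarrow> ('a \<Rightarrow> real) \<Rightarrow> bool" where
  "C1_on V f \<longleftrightarrow> (\<forall>y\<in>V. f differentiable (at y)) \<and>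
     (\<forall>b\<in>Basis. continuous_on V (\<lambda>y. frechet_derivative f (at y) b))"

definition grad :: "('a::euclidean_space \<Rightarrow> real) \<Rightarrow> 'a \<Rightarrow> 'a" where
  "grad f y = (\<Sum>b\<in>Basis. frechet_derivative f (at y) b *\<^sub>R b)"

coinductive smooth_on :: "'a::euclidean_space set \<Rightarrow> ('a \<Rightarrow> real) \<Rightarrow> bool" for V where
  "(\<forall>y\<in>V. f differentiable (at y)) \<Longrightarrow>
   (\<forall>b\<in>Basis. smooth_on V (\<lambda>y. frechet_derivative f (at y) b)) \<Longrightarrow> smooth_on V f"

definition Cinf_c :: "'a::euclidean_space set \<Rightarrow> ('a \<Rightarrow> real) \<Rightarrow> bool" where
  "Cinf_c V g \<longleftrightarrow> smooth_on V g \<and> compact (closure {y. g y \<noteq> 0}) \<and> closure {y. g y \<noteq> 0} \<subseteq> V"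

end

theory Submission
  imports Defs
begin

text \<open>
  Put \<open>C = \<lambda> \<parallel>K\<parallel>\<^sub>p\<close>. By Minkowski's and Young's inequalities a minimizer satisfies
  \<open>\<parallel>\<chi>\<^sub>E\<parallel> \<le> \<parallel>v\<parallel> + C \<integral> |v - \<chi>\<^sub>E|\<close> whenever \<open>v - \<chi>\<^sub>E\<close> is integrable. Inserting
  \<open>v = \<chi>\<^sub>E (1 - \<psi>)\<close> gives, for all \<open>\<psi> \<ge> 0\<close>, a bound on the perimeter seen by \<open>\<psi>\<close>:
  \<open>\<integral> \<psi> d|D \<chi>\<^sub>E| \<le> \<integral>\<^sub>E |\<nabla> \<psi>| + C \<integral>\<^sub>E \<psi>\<close>.
  Take for \<open>\<psi>\<close> a function that equals \<open>g(y)\<close> on \<open>S\<close>, decreases to \<open>0\<close> like \<open>g(y) (1 - t/\<epsilon>)\<^sup>2\<close> at height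
  \<open>t\<close> above \<open>S\<close>, and is cut off at depth \<open>\<delta>\<close> below \<open>S\<close>. Since the normal is the measure theoretic outer
  normal, \<open>E\<close> has density \<open>0\<close> just below and \<open>1\<close> just above \<open>S\<close>, so that \<open>\<delta> \<rightarrow> 0\<close> leaves
  \<open>\<integral> g \<surd>(1 + |\<nabla>\<phi>|\<^sup>2) \<le> \<integral> g \<surd>(1 + |\<nabla>\<phi>|\<^sup>2) + \<epsilon>/3 (\<integral> \<nabla>g \<bullet> \<nabla>\<phi> / \<surd>(1 + |\<nabla>\<phi>|\<^sup>2) + C \<integral> g) + O(\<epsilon>\<^sup>2)\<close>;
  other parts of \<open>E\<close> near \<open>S\<close> are harmless because above \<open>S\<close> the integral over \<open>E\<close> on the right is simply
  replaced by the integral over the whole layer. The opposite inequality comes from the complement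
  of \<open>E\<close> reflected in the last coordinate.\<close>

section \<open>Lebesgue measure under orthogonal maps and shears\<close>

text \<open>No structure theorem for sets of finite perimeter is used: the perimeter is tested by
  C^1 fields only, and near the graph nothing but densities is known. This makes the order of the
  limits matter. The profiles have derivatives of order 1/\<delta>, so the part of the layer of
  width \<delta> where \<open>E\<close> lies on the wrong side of \<open>S\<close> must have volume
  o(\<delta>). The unit normal is merely continuous and is replaced by C^1 fields with uncontrolled
  derivatives; hence \<delta> tends to 0 before the field is improved, and \<epsilon> tends to 0
  only after the leading terms have cancelled. Expanding the square root divides by g, which forces
  |grad g|^2 \<le> M g. Positive parts of a test function violate this; regularising them and
  multiplying by the square of a cutoff restores it. The quadratic profile is C^1 at its end point,
  and s = 1 - t/\<epsilon> satisfies s^4 \<le> s on the layer, which controls the expansion where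
  the slope of the profile degenerates. The factor \<epsilon>/3 is the integral of s^2.\<close>

lemma nn_integral_lborel_translate:
  fixes c :: "'b::euclidean_space"
  assumes [measurable]: "f \<in> borel_measurable borel"
  shows "(\<integral>\<^sup>+x. f (x + c) \<partial>lborel) = (\<integral>\<^sup>+x. f x \<partial>lborel)"
proof -
  have "(\<integral>\<^sup>+x. f x \<partial>lborel) = (\<integral>\<^sup>+x. f x \<partial>distr lborel borel ((+) c))"
    by (simp add: lborel_distr_plus)
  also have "\<dots> = (\<integral>\<^sup>+x. f (x + c) \<partial>lborel)"
    by (subst nn_integral_distr) (auto simp: add.commute)
  finally show ?thesis by simp
qed

text \<open>Uniqueness of Haar measure, specialised to the image of Lebesgue measure: both sides are
  paired with the unit ball, which \<open>Q\<close> preserves, and compared by Fubini.\<close>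
lemma distr_lborel_orthogonal:
  fixes Q :: "'b::euclidean_space \<Rightarrow> 'b"
  assumes Q: "orthogonal_transformation Q"
  shows "distr lborel borel Q = lborel"
proof (rule measure_eqI)
  have lin: "linear Q" using Q by (rule orthogonal_transformation_linear)
  have [measurable]: "Q \<in> borel_measurable borel"
    using lin by (intro borel_measurable_continuous_onI linear_continuous_on) (simp add: linear_conv_bounded_linear)
  let ?B = "ball (0::'b) 1"
  have [measurable]: "?B \<in> sets borel" by simp
  let ?c = "emeasure lborel ?B"
  have c: "?c \<noteq> 0" "?c \<noteq> \<infinity>"
    using less_imp_neq[OF unit_ball_vol_pos[of "real DIM('b)"]] by (auto simp: emeasure_ball)
  fix A assume "A \<in> sets (distr lborel borel Q)"
  then have A[measurable]: "A \<in> sets borel" by simp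
  have surj: "\<exists>w. y = Q w" for y
    using orthogonal_transformation_surj[OF Q] by (metis surj_def)
  have 1: "(\<integral>\<^sup>+x. indicator A (Q x + y) \<partial>lborel) = (\<integral>\<^sup>+x. indicator A (Q x) \<partial>lborel)" for y
  proof -
    obtain w where w: "y = Q w" using surj by blast
    have "(\<integral>\<^sup>+x. indicator A (Q x + y) \<partial>lborel) = (\<integral>\<^sup>+x. indicator A (Q (x + w)) \<partial>lborel)"
      by (simp add: w linear_add[OF lin])
    also have "\<dots> = (\<integral>\<^sup>+x. indicator A (Q x) \<partial>lborel)"
      by (rule nn_integral_lborel_translate) measurable
    finally show ?thesis .
  qed
  have 2: "(\<integral>\<^sup>+x. indicator ?B (y - Q x) \<partial>lborel) = ?c" for y
  proof -
    obtain w where w: "y = Q w" using surj by blast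
    have "(\<integral>\<^sup>+x. indicator ?B (y - Q x) \<partial>lborel) = (\<integral>\<^sup>+x. indicator (ball w 1) x \<partial>lborel)"
      by (intro nn_integral_cong)
        (simp add: w linear_diff[OF lin, symmetric] orthogonal_transformation_norm[OF Q] indicator_def dist_norm)
    also have "\<dots> = ?c" by (simp add: emeasure_ball)
    finally show ?thesis .
  qed
  have "(\<integral>\<^sup>+x. indicator A (Q x) \<partial>lborel) * ?c
      = (\<integral>\<^sup>+y. (\<integral>\<^sup>+x. indicator A (Q x + y) * indicator ?B y \<partial>lborel) \<partial>lborel)"
    by (simp add: nn_integral_multc 1 nn_integral_cmult_indicator)
  also have "\<dots> = (\<integral>\<^sup>+x. (\<integral>\<^sup>+y. indicator A (Q x + y) * indicator ?B y \<partial>lborel) \<partial>lborel)"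
    by (rule lborel_pair.Fubini') measurable
  also have "\<dots> = (\<integral>\<^sup>+x. (\<integral>\<^sup>+y. indicator A y * indicator ?B (y - Q x) \<partial>lborel) \<partial>lborel)"
  proof (rule nn_integral_cong)
    fix x
    show "(\<integral>\<^sup>+y. indicator A (Q x + y) * indicator ?B y \<partial>lborel)
        = (\<integral>\<^sup>+y. indicator A y * indicator ?B (y - Q x) \<partial>lborel)"
      using nn_integral_lborel_translate[of "\<lambda>y. indicator A y * indicator ?B (y - Q x)" "Q x"]
      by (simp add: add.commute)
  qed
  also have "\<dots> = (\<integral>\<^sup>+y. (\<integral>\<^sup>+x. indicator A y * indicator ?B (y - Q x) \<partial>lborel) \<partial>lborel)"
    by (rule lborel_pair.Fubini') measurable
  also have "\<dots> = emeasure lborel A * ?c"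
    by (simp add: nn_integral_cmult 2 nn_integral_multc)
  finally have "(\<integral>\<^sup>+x. indicator A (Q x) \<partial>lborel) = emeasure lborel A"
    using c by (metis ennreal_mult_cancel_left infinity_ennreal_def mult.commute)
  then have "(\<integral>\<^sup>+x. indicator A x \<partial>distr lborel borel Q) = emeasure lborel A"
    by (subst nn_integral_distr) auto
  then show "emeasure (distr lborel borel Q) A = emeasure lborel A"
    by simp
qed simp

text \<open>On every vertical line the map is a translation, so Fubini suffices and \<open>f\<close>
  may be any Borel function. This is what flattens the graph later on.\<close>

lemma distr_lborel_shear:
  fixes f :: "'a::euclidean_space \<Rightarrow> real"
  assumes [measurable]: "f \<in> borel_measurable borel"
  shows "distr lborel borel (\<lambda>z. (fst z, f (fst z) + snd z)) = lborel"
proof (rule measure_eqI)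
  fix A assume "A \<in> sets (distr lborel borel (\<lambda>z. (fst z, f (fst z) + snd z)))"
  then have A[measurable]: "A \<in> sets borel" by simp
  have [measurable]: "(\<lambda>z::'a\<times>real. (fst z, f (fst z) + snd z)) \<in> borel_measurable borel"
    by (simp add: borel_prod[symmetric])
  have [measurable]: "A \<in> sets (borel \<Otimes>\<^sub>M borel)" unfolding borel_prod by (rule A)
  have "(\<integral>\<^sup>+z. indicator A z \<partial>distr lborel borel (\<lambda>z. (fst z, f (fst z) + snd z)))
      = (\<integral>\<^sup>+z. indicator A (fst z, f (fst z) + snd z) \<partial>(lborel \<Otimes>\<^sub>M lborel))"
    by (subst nn_integral_distr) (auto simp: lborel_prod)
  also have "\<dots> = (\<integral>\<^sup>+y. (\<integral>\<^sup>+t. indicator A (y, f y + t) \<partial>lborel) \<partial>lborel)"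
    by (subst lborel.nn_integral_fst[symmetric]) auto
  also have "\<dots> = (\<integral>\<^sup>+y. (\<integral>\<^sup>+t. indicator A (y, t) \<partial>lborel) \<partial>lborel)"
  proof (rule nn_integral_cong)
    fix y
    show "(\<integral>\<^sup>+t. indicator A (y, f y + t) \<partial>lborel) = (\<integral>\<^sup>+t. indicator A (y, t) \<partial>lborel)"
      using nn_integral_lborel_translate[of "\<lambda>t. indicator A (y,t)" "f y"]
      by (simp add: add.commute)
  qed
  also have "\<dots> = (\<integral>\<^sup>+z. indicator A z \<partial>(lborel \<Otimes>\<^sub>M lborel))"
    by (subst lborel.nn_integral_fst[symmetric]) auto
  finally show "emeasure (distr lborel borel (\<lambda>z. (fst z, f (fst z) + snd z))) A = emeasure lborel A"
    by (simp add: lborel_prod)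
qed simp

section \<open>Integrability of functions with bounded support\<close>

lemma integrable_bounded_support:
  fixes f :: "'b::euclidean_space \<Rightarrow> real"
  assumes [measurable]: "f \<in> borel_measurable borel" and "bounded S"
    and b: "\<And>x. x \<in> S \<Longrightarrow> \<bar>f x\<bar> \<le> M" and z: "\<And>x. x \<notin> S \<Longrightarrow> f x = 0"
  shows "integrable lborel f"
proof -
  obtain r where r: "S \<subseteq> cball 0 r" using bounded_subset_ballD[OF \<open>bounded S\<close>, of 0] ball_subset_cball by blast
  have "emeasure lborel (cball (0::'b) r) < \<infinity>"
    using emeasure_compact_finite[OF compact_cball] by blast
  then have "integrable lborel (\<lambda>x. indicator (cball (0::'b) r) x * \<bar>M\<bar>)"
    by (intro integrable_mult_left integrable_real_indicator) auto
  moreover have "norm (f x) \<le> norm (indicator (cball (0::'b) r) x * \<bar>M\<bar>)" for x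
    using b[of x] z[of x] r by (cases "x \<in> S") (auto simp: indicator_def)
  moreover have "f \<in> borel_measurable lborel" by simp
  ultimately show ?thesis
    by (metis (no_types, lifting) AE_I2 Bochner_Integration.integrable_bound)
qed

lemma integrable_continuous_support:
  fixes f :: "'b::euclidean_space \<Rightarrow> real"
  assumes c: "continuous_on UNIV f" and "bounded S" and z: "\<And>x. x \<notin> S \<Longrightarrow> f x = 0"
  shows "integrable lborel f"
proof -
  have "compact (f ` closure S)"
    using c \<open>bounded S\<close> by (meson compact_closure compact_continuous_image continuous_on_subset subset_UNIV)
  then obtain M where M: "\<And>x. x \<in> closure S \<Longrightarrow> \<bar>f x\<bar> \<le> M"
    using compact_imp_bounded[of "f ` closure S"] by (auto simp: bounded_iff)
  show ?thesis
    by (rule integrable_bounded_support[OF borel_measurable_continuous_onI[OF c] \<open>bounded S\<close>, of M])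
      (use M z closure_subset in auto)
qed

lemma integral_lborel_translate:
  fixes f :: "'b::euclidean_space \<Rightarrow> real"
  assumes [measurable]: "f \<in> borel_measurable borel"
  shows "(LINT x|lborel. f (x + c)) = (LINT x|lborel. f x)"
proof -
  have "(LINT x|lborel. f x) = (LINT x|distr lborel borel ((+) c). f x)"
    by (simp add: lborel_distr_plus)
  also have "\<dots> = (LINT x|lborel. f (x + c))"
    by (subst integral_distr) (auto simp: add.commute)
  finally show ?thesis by simp
qed

section \<open>The inequalities of Minkowski and Young\<close>

text \<open>Both inequalities of this section come from this tangent line: Minkowski by adding two
  tangents, Young by integrating one. The point \<open>x = 0\<close> lies outside the open half-line
  on which convexity is applied; there the claim reduces to 1 \<le> p.\<close>

lemma powr_above_tangent:
  fixes x a p :: real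
  assumes "1 \<le> p" "0 < a" "0 \<le> x"
  shows "a powr p + p * a powr (p - 1) * (x - a) \<le> x powr p"
proof (cases "x = 0")
  case True
  have "a powr (p - 1) * a = a powr p" using assms by (simp add: powr_diff)
  moreover have "p * a powr (p - 1) * (x - a) = - (p * (a powr (p - 1) * a))" using True by simp
  ultimately have "p * a powr (p - 1) * (x - a) = - (p * a powr p)" by simp
  moreover have "1 * a powr p \<le> p * a powr p" using assms by (intro mult_right_mono) auto
  moreover have "x powr p = 0" using True by simp
  ultimately show ?thesis by linarith
next
  case False
  have "((\<lambda>x. x powr p) has_real_derivative p * a powr (p - 1)) (at a within {0<..})"
    using assms by (auto intro!: derivative_eq_intros)
  from convex_on_imp_above_tangent[OF powr_convex[OF \<open>1 \<le> p\<close>] _ _ _ this, of x]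
  show ?thesis using assms False by (auto simp: interior_open)
qed

text \<open>Convexity for the splitting u + v = t (u/t) + (1 - t) (v/(1 - t)). Both tangents are
  taken at u + v, so that their linear terms cancel in the weighted sum; the weights appear because
  s (w/s)^p = s^(1 - p) w^p.\<close>

lemma powr_add_le_weighted:
  fixes u v t p :: real
  assumes "1 \<le> p" "0 \<le> u" "0 \<le> v" "0 < t" "t < 1"
  shows "(u + v) powr p \<le> t powr (1 - p) * u powr p + (1 - t) powr (1 - p) * v powr p"
proof (cases "u + v = 0")
  case False
  then have a: "0 < u + v" using assms by simp
  have tp: "s * (w / s) powr p = s powr (1 - p) * w powr p" if "0 < s" "0 \<le> w" for s w :: real
    using that by (simp add: powr_divide powr_diff)
  have "t * ((u + v) powr p + p * (u + v) powr (p - 1) * (u / t - (u + v))) \<le> t * (u / t) powr p"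
    using assms a by (intro mult_left_mono powr_above_tangent) auto
  moreover have "(1 - t) * ((u + v) powr p + p * (u + v) powr (p - 1) * (v / (1 - t) - (u + v)))
      \<le> (1 - t) * (v / (1 - t)) powr p"
    using assms a by (intro mult_left_mono powr_above_tangent) auto
  moreover have "t * ((u + v) powr p + p * (u + v) powr (p - 1) * (u / t - (u + v)))
     + (1 - t) * ((u + v) powr p + p * (u + v) powr (p - 1) * (v / (1 - t) - (u + v))) = (u + v) powr p"
    using assms by (simp add: field_simps)
  ultimately show ?thesis using assms tp[of t u] tp[of "1 - t" v] by simp
qed (use assms in auto)

text \<open>Integrating the weighted inequality and choosing \<open>t\<close> afterwards avoids
  conjugate exponents. The weight 1/2 already gives integrability. For the norms, \<open>a\<close>
  and \<open>b\<close> are taken strictly above the two norms, so that both weights are positive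
  even if a norm vanishes.\<close>

lemma Minkowski_powr:
  fixes f g :: "'c \<Rightarrow> real" and p :: real
  assumes p: "1 \<le> p" and [measurable]: "f \<in> borel_measurable M" "g \<in> borel_measurable M"
    and f: "integrable M (\<lambda>x. \<bar>f x\<bar> powr p)" and g: "integrable M (\<lambda>x. \<bar>g x\<bar> powr p)"
  shows "integrable M (\<lambda>x. \<bar>f x + g x\<bar> powr p)"
    and "(LINT x|M. \<bar>f x + g x\<bar> powr p) powr (1/p)
       \<le> (LINT x|M. \<bar>f x\<bar> powr p) powr (1/p) + (LINT x|M. \<bar>g x\<bar> powr p) powr (1/p)"
proof -
  let ?I = "\<lambda>f. LINT x|M. \<bar>f x\<bar> powr p"
  let ?N = "\<lambda>f. ?I f powr (1/p)"
  have pw: "\<bar>f x + g x\<bar> powr p \<le> t powr (1 - p) * \<bar>f x\<bar> powr p + (1 - t) powr (1 - p) * \<bar>g x\<bar> powr p"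
    if "0 < t" "t < 1" for t x
  proof -
    have "\<bar>f x + g x\<bar> powr p \<le> (\<bar>f x\<bar> + \<bar>g x\<bar>) powr p"
      using p by (intro powr_mono2) auto
    also have "\<dots> \<le> t powr (1 - p) * \<bar>f x\<bar> powr p + (1 - t) powr (1 - p) * \<bar>g x\<bar> powr p"
      by (rule powr_add_le_weighted) (use p that in auto)
    finally show ?thesis .
  qed
  show int: "integrable M (\<lambda>x. \<bar>f x + g x\<bar> powr p)"
  proof (rule Bochner_Integration.integrable_bound)
    show "integrable M (\<lambda>x. (1/2) powr (1 - p) * \<bar>f x\<bar> powr p + (1 - 1/2) powr (1 - p) * \<bar>g x\<bar> powr p)"
      using f g by simp
    show "AE x in M. norm (\<bar>f x + g x\<bar> powr p)
      \<le> norm ((1/2) powr (1 - p) * \<bar>f x\<bar> powr p + (1 - 1/2) powr (1 - p) * \<bar>g x\<bar> powr p)"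
      using pw[of "1/2"] by (intro AE_I2) (simp add: abs_of_nonneg)
  qed simp
  have pos: "0 \<le> ?I u" for u :: "'c \<Rightarrow> real" by simp
  have key: "?N (\<lambda>x. f x + g x) \<le> a + b" if a: "?N f < a" and b: "?N g < b" for a b
  proof -
    have a0: "0 < a" "0 < b"
      using le_less_trans[OF powr_ge_zero a] le_less_trans[OF powr_ge_zero b] by auto
    have Ia: "?I u \<le> c powr p" if "?N u < c" for u :: "'c \<Rightarrow> real" and c
    proof -
      have "?I u = ?N u powr p" using p pos[of u] by (simp add: powr_powr)
      also have "\<dots> \<le> c powr p" using that p by (intro powr_mono2) auto
      finally show ?thesis .
    qed
    \<comment> \<open>With this weight the two terms are at most a (a + b)^(p - 1) and b (a + b)^(p
      - 1), which add up to (a + b)^p.\<close>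
    define t where "t = a / (a + b)"
    have t: "0 < t" "t < 1" and t1: "1 - t = b / (a + b)" using a0 by (auto simp: t_def field_simps)
    have sc: "(c / (a + b)) powr (1 - p) * c powr p = c * (a + b) powr (p - 1)" if "0 < c" for c
    proof -
      have "c powr (1 - p) * c powr p = c" using that by (simp flip: powr_add)
      moreover have "1 / (a + b) powr (1 - p) = (a + b) powr (p - 1)"
        using powr_minus_divide[of "a + b" "1 - p"] by simp
      moreover have "(c / (a + b)) powr (1 - p) * c powr p
          = (c powr (1 - p) * c powr p) * (1 / (a + b) powr (1 - p))"
        using that a0 by (simp add: powr_divide)
      ultimately show ?thesis by simp
    qed
    have "?I (\<lambda>x. f x + g x)
        \<le> (LINT x|M. t powr (1 - p) * \<bar>f x\<bar> powr p + (1 - t) powr (1 - p) * \<bar>g x\<bar> powr p)"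
      by (rule integral_mono) (use int f g pw[OF t] in auto)
    also have "\<dots> = t powr (1 - p) * ?I f + (1 - t) powr (1 - p) * ?I g"
      using f g by simp
    also have "\<dots> \<le> t powr (1 - p) * a powr p + (1 - t) powr (1 - p) * b powr p"
      using Ia[OF a] Ia[OF b] by (intro add_mono mult_left_mono) auto
    also have "\<dots> = (a + b) * (a + b) powr (p - 1)"
      unfolding t1 unfolding t_def by (simp only: sc[OF a0(1)] sc[OF a0(2)] distrib_right)
    also have "\<dots> = (a + b) powr p" using a0 by (simp add: powr_diff)
    finally have "?N (\<lambda>x. f x + g x) \<le> ((a + b) powr p) powr (1/p)"
      using p by (intro powr_mono2) auto
    then show ?thesis using p a0 by (simp add: powr_powr)
  qed
  show "?N (\<lambda>x. f x + g x) \<le> ?N f + ?N g"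
  proof (rule field_le_epsilon)
    fix e :: real assume "0 < e"
    then show "?N (\<lambda>x. f x + g x) \<le> ?N f + ?N g + e"
      using key[of "?N f + e/2" "?N g + e/2"] by simp
  qed
qed

lemma distr_lborel_reflect: "distr lborel borel (\<lambda>y::'b::euclidean_space. x - y) = lborel"
proof -
  have "distr lborel borel (\<lambda>y::'b. x - y) = distr (distr lborel borel (\<lambda>y. - y)) borel ((+) x)"
    by (subst distr_distr) (auto simp: comp_def)
  also have "\<dots> = lborel"
    using distr_lborel_orthogonal[of "\<lambda>y::'b. - y"]
    by (simp add: orthogonal_transformation_neg lborel_distr_plus)
  finally show ?thesis .
qed

lemma AE_lborel_distr:
  fixes T :: "'b::euclidean_space \<Rightarrow> 'b"
  assumes d: "distr lborel borel T = (lborel :: 'b::euclidean_space measure)"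
    and [measurable]: "T \<in> borel_measurable borel"
    and P: "AE y in lborel. P y"
  shows "AE y in lborel. P (T y)"
proof -
  obtain N where N: "{y. \<not> P y} \<subseteq> N" "N \<in> null_sets lborel"
    using P by (auto elim!: AE_E simp: null_sets_def)
  then have [measurable]: "N \<in> sets borel" by (auto simp: null_sets_def)
  have "emeasure lborel (T -` N) = emeasure (distr lborel borel T) N"
    by (subst emeasure_distr) auto
  then have "T -` N \<in> null_sets lborel"
    using N measurable_sets[OF assms(2), of N] unfolding d by (auto simp: null_sets_def)
  then show ?thesis
    by (rule AE_I') (use N in auto)
qed

text \<open>The definitions integrate over the completion, whereas Fubini and image measures are
  applied over \<open>lborel\<close>. A Borel representative carries statements from one to the
  other.\<close>

lemma lebesgue_eq_lborel:
  fixes f g :: "'b::euclidean_space \<Rightarrow> real"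
  assumes g[measurable]: "g \<in> borel_measurable borel" and ae: "AE x in lborel. f x = g x"
  shows "f \<in> borel_measurable lebesgue"
    and "integrable lebesgue f \<longleftrightarrow> integrable lborel g"
    and "(LINT x|lebesgue. f x) = (LINT x|lborel. g x)"
proof -
  have ae': "AE x in lebesgue. f x = g x" using ae by (rule AE_completion)
  have gl: "g \<in> borel_measurable lebesgue" by (rule measurable_completion) simp
  have "AE x in lebesgue. g x = f x" using ae' by eventually_elim simp
  then show f: "f \<in> borel_measurable lebesgue" by (rule borel_measurable_AE[OF gl])
  show "integrable lebesgue f \<longleftrightarrow> integrable lborel g"
    using integrable_cong_AE[OF f gl ae'] integrable_completion[of g lborel] by simp
  show "(LINT x|lebesgue. f x) = (LINT x|lborel. g x)"
    using integral_cong_AE[OF f gl ae'] integral_completion[of g lborel] by simp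
qed

text \<open>Jensen's inequality for the measure |h| dy bounds |K * h|^p at each point by H^(p - 1)
  times the convolution of K^p with |h|; Tonelli and translation invariance then integrate that
  convolution. Boundedness of \<open>K\<close> makes the convolution integral exist at every point,
  and gives integrability of K^p through K^p \<le> M^(p - 1) K.\<close>

lemma conv_Young_L1:
  fixes K h :: "'b::euclidean_space \<Rightarrow> real"
  assumes p: "1 \<le> p" and K0: "\<And>x. 0 \<le> K x" and KM: "\<And>x. K x \<le> M" and K: "integrable lebesgue K"
    and h: "integrable lebesgue h"
  shows "integrable lebesgue (\<lambda>y. K (x - y) * h y)"
    and "in_Lp p (conv K h)"
    and "lp_norm p (conv K h) \<le> lp_norm p K * (LINT x|lebesgue. \<bar>h x\<bar>)"
proof -
  have "K \<in> borel_measurable lebesgue" "h \<in> borel_measurable lebesgue" using K h by auto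
  then obtain K1 h1 where m: "K1 \<in> borel_measurable lborel" "h1 \<in> borel_measurable lborel"
    and K1: "AE x in lborel. K x = K1 x" and h1: "AE x in lborel. h x = h1 x"
    using completion_ex_borel_measurable_real[of K lborel] completion_ex_borel_measurable_real[of h lborel] by blast
  \<comment> \<open>Clamping the Borel representative to [0, M] makes the bounds of \<open>K\<close>
    hold everywhere and not just almost everywhere.\<close>
  define k where "k x = max 0 (min M (K1 x))" for x
  have [measurable]: "k \<in> borel_measurable borel" "h1 \<in> borel_measurable borel"
    using m unfolding k_def by auto
  have kK: "AE x in lborel. K x = k x"
    using K1 by eventually_elim (metis K0 KM k_def max.absorb2 min.absorb2)
  have k0: "0 \<le> k x" for x by (simp add: k_def)
  have M0: "0 \<le> M" using order_trans[OF K0 KM] .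
  have kM: "k x \<le> M" for x using M0 by (simp add: k_def)
  have hi: "integrable lborel h1"
    using h lebesgue_eq_lborel(2)[OF _ h1] by simp
  have ki: "integrable lborel k"
    using K lebesgue_eq_lborel(2)[OF _ kK] by simp
  have prod_int: "integrable lborel (\<lambda>y. k (x - y) * h1 y)" for x
  proof (rule Bochner_Integration.integrable_bound)
    show "integrable lborel (\<lambda>y. M * h1 y)" using hi by simp
    show "AE y in lborel. norm (k (x - y) * h1 y) \<le> norm (M * h1 y)"
      using k0 kM M0 by (intro AE_I2) (auto simp: abs_mult intro!: mult_right_mono)
  qed measurable
  have eq: "AE y in lborel. K (x - y) * h y = k (x - y) * h1 y" for x
  proof -
    have "AE y in lborel. K (x - y) = k (x - y)"
      by (rule AE_lborel_distr[OF distr_lborel_reflect[of x] _ kK]) measurable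
    with h1 show ?thesis by eventually_elim simp
  qed
  have cv: "conv K h x = (LINT y|lborel. k (x - y) * h1 y)" for x
    unfolding conv_def by (rule lebesgue_eq_lborel(3)[OF _ eq]) measurable
  show "integrable lebesgue (\<lambda>y. K (x - y) * h y)" for x
    using prod_int[of x] by (subst lebesgue_eq_lborel(2)[OF _ eq]) measurable
  have cm[measurable]: "conv K h \<in> borel_measurable borel"
    unfolding cv by measurable
  have [measurable]: "(\<lambda>x. k x powr p) \<in> borel_measurable borel" by measurable
  have kp: "integrable lborel (\<lambda>x. k x powr p)"
  proof (rule Bochner_Integration.integrable_bound)
    show "integrable lborel (\<lambda>x. M powr (p - 1) * k x)" using ki by simp
    have "k x powr p \<le> M powr (p - 1) * k x" for x
    proof (cases "k x = 0")
      case False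
      then have "k x powr p = k x powr (p - 1) * k x" using k0[of x] by (simp add: powr_diff)
      also have "\<dots> \<le> M powr (p - 1) * k x"
        using k0 kM p by (intro mult_right_mono powr_mono2) auto
      finally show ?thesis .
    qed (use p in auto)
    then show "AE x in lborel. norm (k x powr p) \<le> norm (M powr (p - 1) * k x)"
      using k0 by (intro AE_I2) (simp add: abs_mult)
  qed measurable
  define H where "H = (LINT x|lborel. \<bar>h1 x\<bar>)"
  have H0: "0 \<le> H" by (simp add: H_def)
  have HL: "(LINT x|lebesgue. \<bar>h x\<bar>) = H"
    unfolding H_def by (rule lebesgue_eq_lborel(3)) (simp, use h1 in \<open>eventually_elim, simp\<close>)
  have "(LINT x|lebesgue. \<bar>K x\<bar> powr p) = (LINT x|lborel. k x powr p)"
    by (rule lebesgue_eq_lborel(3)) (simp, use kK in \<open>eventually_elim, simp add: k0\<close>)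
  then have KL: "lp_norm p K = (LINT x|lborel. k x powr p) powr (1/p)"
    by (simp add: lp_norm_def)
  have pint: "integrable lborel (\<lambda>y. k (x - y) powr p * \<bar>h1 y\<bar>)" for x
  proof (rule Bochner_Integration.integrable_bound)
    show "integrable lborel (\<lambda>y. M powr p * \<bar>h1 y\<bar>)" using hi by simp
    show "AE y in lborel. norm (k (x - y) powr p * \<bar>h1 y\<bar>) \<le> norm (M powr p * \<bar>h1 y\<bar>)"
      using k0 kM M0 p by (intro AE_I2) (auto simp: abs_mult intro!: mult_right_mono powr_mono2)
  qed measurable
  have jensen: "\<bar>conv K h x\<bar> powr p \<le> H powr (p - 1) * (LINT y|lborel. k (x - y) powr p * \<bar>h1 y\<bar>)" for x
  proof -
    let ?a = "LINT y|lborel. k (x - y) * \<bar>h1 y\<bar>"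
    have ai: "integrable lborel (\<lambda>y. k (x - y) * \<bar>h1 y\<bar>)"
      using integrable_abs[OF prod_int[of x]] k0 by (simp add: abs_mult)
    have a0: "0 \<le> ?a" using k0 by (intro integral_nonneg_AE) auto
    have aM: "?a \<le> M * H" unfolding H_def using hi ai kM
      by (subst integral_mult_right_zero[symmetric], intro integral_mono) (auto intro: mult_right_mono)
    have "\<bar>conv K h x\<bar> \<le> ?a" unfolding cv
      using integral_abs_bound[of lborel "\<lambda>y. k (x - y) * h1 y"] k0 by (simp add: abs_mult)
    then have c: "\<bar>conv K h x\<bar> powr p \<le> ?a powr p" using p by (intro powr_mono2) auto
    show ?thesis
    proof (cases "?a = 0")
      case True
      then show ?thesis using c p by (simp add: order_trans[OF c] integral_nonneg_AE)
    next
      case False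
      then have a: "0 < ?a" using a0 by simp
      then have H: "0 < H" using aM M0 H0 by (cases "H = 0") auto
      \<comment> \<open>The mean of k(x - y) with respect to |h| dy / H. The tangent of the power at
        the mean has a linear term that integrates to 0, which is Jensen's inequality.\<close>
      let ?b = "?a / H"
      have b: "0 < ?b" using a H by simp
      have "?b powr p * H = (LINT y|lborel. (?b powr p + p * ?b powr (p - 1) * (k (x - y) - ?b)) * \<bar>h1 y\<bar>)"
      proof -
        have "(LINT y|lborel. (?b powr p + p * ?b powr (p - 1) * (k (x - y) - ?b)) * \<bar>h1 y\<bar>)
          = (LINT y|lborel. (?b powr p - p * ?b powr (p - 1) * ?b) * \<bar>h1 y\<bar> + p * ?b powr (p - 1) * (k (x - y) * \<bar>h1 y\<bar>))"
          by (intro Bochner_Integration.integral_cong) (auto simp: algebra_simps)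
        also have "\<dots> = (?b powr p - p * ?b powr (p - 1) * ?b) * H + p * ?b powr (p - 1) * ?a"
          using hi ai by (simp add: H_def)
        also have "\<dots> = ?b powr p * H" using H by (simp add: field_simps)
        finally show ?thesis by simp
      qed
      also have "\<dots> \<le> (LINT y|lborel. k (x - y) powr p * \<bar>h1 y\<bar>)"
      proof (rule integral_mono)
        show "integrable lborel (\<lambda>y. (?b powr p + p * ?b powr (p - 1) * (k (x - y) - ?b)) * \<bar>h1 y\<bar>)"
        proof -
          have "integrable lborel (\<lambda>y. (?b powr p - p * ?b powr (p - 1) * ?b) * \<bar>h1 y\<bar> + p * ?b powr (p - 1) * (k (x - y) * \<bar>h1 y\<bar>))"
            using hi ai by simp
          then show ?thesis by (simp add: algebra_simps)
        qed
        show "(?b powr p + p * ?b powr (p - 1) * (k (x - y) - ?b)) * \<bar>h1 y\<bar> \<le> k (x - y) powr p * \<bar>h1 y\<bar>" for y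
          using powr_above_tangent[OF p b k0] by (intro mult_right_mono) auto
      qed (rule pint)
      finally have "H powr (p - 1) * (?b powr p * H) \<le> H powr (p - 1) * (LINT y|lborel. k (x - y) powr p * \<bar>h1 y\<bar>)"
        by (intro mult_left_mono) auto
      moreover have "H powr (p - 1) * (?b powr p * H) = ?a powr p"
        using H a0 by (simp add: powr_divide powr_diff)
      ultimately show ?thesis using c by linarith
    qed
  qed
  have nn: "(\<integral>\<^sup>+x. ennreal (LINT y|lborel. k (x - y) powr p * \<bar>h1 y\<bar>) \<partial>lborel)
      = ennreal ((LINT x|lborel. k x powr p) * H)"
  proof -
    have "(\<integral>\<^sup>+x. ennreal (LINT y|lborel. k (x - y) powr p * \<bar>h1 y\<bar>) \<partial>lborel)
        = (\<integral>\<^sup>+x. (\<integral>\<^sup>+y. ennreal (k (x - y) powr p * \<bar>h1 y\<bar>) \<partial>lborel) \<partial>lborel)"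
      using pint by (intro nn_integral_cong nn_integral_eq_integral[symmetric]) auto
    also have "\<dots> = (\<integral>\<^sup>+y. (\<integral>\<^sup>+x. ennreal (k (x - y) powr p * \<bar>h1 y\<bar>) \<partial>lborel) \<partial>lborel)"
      by (rule lborel_pair.Fubini') measurable
    also have "\<dots> = (\<integral>\<^sup>+y. (\<integral>\<^sup>+x. ennreal (k x powr p) \<partial>lborel) * ennreal \<bar>h1 y\<bar> \<partial>lborel)"
    proof (rule nn_integral_cong)
      fix y
      have "(\<integral>\<^sup>+x. ennreal (k (x - y) powr p * \<bar>h1 y\<bar>) \<partial>lborel)
          = (\<integral>\<^sup>+x. ennreal (k (x - y) powr p) \<partial>lborel) * ennreal \<bar>h1 y\<bar>"
        by (simp add: ennreal_mult nn_integral_multc)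
      also have "(\<integral>\<^sup>+x. ennreal (k (x - y) powr p) \<partial>lborel) = (\<integral>\<^sup>+x. ennreal (k x powr p) \<partial>lborel)"
        using nn_integral_lborel_translate[of "\<lambda>x. ennreal (k x powr p)" "- y"] by simp
      finally show "(\<integral>\<^sup>+x. ennreal (k (x - y) powr p * \<bar>h1 y\<bar>) \<partial>lborel)
          = (\<integral>\<^sup>+x. ennreal (k x powr p) \<partial>lborel) * ennreal \<bar>h1 y\<bar>" .
    qed
    also have "\<dots> = (\<integral>\<^sup>+x. ennreal (k x powr p) \<partial>lborel) * (\<integral>\<^sup>+y. ennreal \<bar>h1 y\<bar> \<partial>lborel)"
      by (simp add: nn_integral_cmult)
    also have "\<dots> = ennreal (LINT x|lborel. k x powr p) * ennreal H"
      using kp hi by (simp add: nn_integral_eq_integral H_def)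
    also have "\<dots> = ennreal ((LINT x|lborel. k x powr p) * H)"
      using H0 by (simp add: ennreal_mult)
    finally show ?thesis .
  qed
  let ?G = "\<lambda>x. LINT y|lborel. k (x - y) powr p * \<bar>h1 y\<bar>"
  have G0: "0 \<le> ?G x" for x by (intro integral_nonneg_AE) auto
  have Gi: "integrable lborel ?G"
    by (rule integrableI_nonneg) (use nn G0 in auto)
  have GI: "(LINT x|lborel. ?G x) = (LINT x|lborel. k x powr p) * H"
    using nn G0 H0 by (subst integral_eq_nn_integral) auto
  have ci: "integrable lborel (\<lambda>x. \<bar>conv K h x\<bar> powr p)"
  proof (rule Bochner_Integration.integrable_bound)
    show "integrable lborel (\<lambda>x. H powr (p - 1) * ?G x)" using Gi by simp
    show "AE x in lborel. norm (\<bar>conv K h x\<bar> powr p) \<le> norm (H powr (p - 1) * ?G x)"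
      using jensen G0 by (intro AE_I2) (simp add: abs_mult)
  qed measurable
  show "in_Lp p (conv K h)"
    unfolding in_Lp_def using ci by (auto simp: integrable_completion intro!: measurable_completion)
  have "(LINT x|lborel. \<bar>conv K h x\<bar> powr p) \<le> (LINT x|lborel. H powr (p - 1) * ?G x)"
    by (rule integral_mono) (use ci Gi jensen in auto)
  also have "\<dots> = H powr (p - 1) * H * (LINT x|lborel. k x powr p)"
    by (simp add: GI)
  also have "\<dots> = H powr p * (LINT x|lborel. k x powr p)"
    using H0 p by (cases "H = 0") (auto simp: powr_diff)
  finally have "(LINT x|lborel. \<bar>conv K h x\<bar> powr p) powr (1/p) \<le> (H powr p * (LINT x|lborel. k x powr p)) powr (1/p)"
    using p by (intro powr_mono2) auto
  also have "\<dots> = H * (LINT x|lborel. k x powr p) powr (1/p)"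
    using H0 p by (simp add: powr_mult powr_powr)
  finally show "lp_norm p (conv K h) \<le> lp_norm p K * (LINT x|lebesgue. \<bar>h x\<bar>)"
    unfolding HL KL by (simp add: lp_norm_def integral_completion mult.commute)
qed

section \<open>Continuously differentiable functions and fields\<close>

text \<open>The gradient is carried along as an explicit vector field, so that the product and chain
  rules yield closed formulas that can be put into integrals.\<close>

definition has_cont_grad :: "('b::euclidean_space \<Rightarrow> real) \<Rightarrow> ('b \<Rightarrow> 'b) \<Rightarrow> bool" where
  "has_cont_grad f G \<longleftrightarrow> (\<forall>x. (f has_derivative (\<lambda>v. G x \<bullet> v)) (at x)) \<and> continuous_on UNIV G"

text \<open>Continuity is asked for each fixed direction; since \<open>D x\<close> is linear on a
  finite-dimensional space, this is the usual C^1 condition.\<close>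

definition has_cont_deriv :: "('b::euclidean_space \<Rightarrow> 'c::euclidean_space) \<Rightarrow> ('b \<Rightarrow> 'b \<Rightarrow> 'c) \<Rightarrow> bool" where
  "has_cont_deriv X D \<longleftrightarrow> (\<forall>x. (X has_derivative D x) (at x)) \<and> (\<forall>v. continuous_on UNIV (\<lambda>x. D x v))"

abbreviation supp :: "('b::euclidean_space \<Rightarrow> 'c::real_vector) \<Rightarrow> 'b set" where
  "supp f \<equiv> closure {x. f x \<noteq> 0}"

lemma not_in_supp: "x \<notin> supp f \<Longrightarrow> f x = 0"
  using closure_subset[of "{x. f x \<noteq> 0}"] by blast

lemma compact_supp_subset:
  assumes "compact (supp f)" "{x. g x \<noteq> 0} \<subseteq> {x. f x \<noteq> 0}"
  shows "compact (supp g)"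
  using assms closure_mono by (metis bounded_subset closed_closure compact_eq_bounded_closed)

lemma has_cont_grad_continuous: "has_cont_grad f G \<Longrightarrow> continuous_on UNIV f"
  unfolding has_cont_grad_def using has_derivative_continuous_on[of UNIV f] by (meson UNIV_I has_derivative_at_withinI)

lemma has_cont_deriv_continuous: "has_cont_deriv X D \<Longrightarrow> continuous_on UNIV X"
  unfolding has_cont_deriv_def using has_derivative_continuous_on[of UNIV X] by (meson UNIV_I has_derivative_at_withinI)

lemma derivative_zero_off_supp:
  assumes "(f has_derivative D) (at x)" "x \<notin> supp f"
  shows "D = (\<lambda>_. 0)"
proof -
  have "((\<lambda>_. 0) has_derivative (\<lambda>_. 0)) (at x)" by simp
  moreover have "open (- supp f)" by (rule open_Compl[OF closed_closure])
  ultimately have "(f has_derivative (\<lambda>_. 0)) (at x)"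
    by (rule has_derivative_transform_within_open) (use assms(2) in \<open>auto dest: not_in_supp[of _ f]\<close>)
  with assms(1) show ?thesis by (rule has_derivative_unique)
qed

lemma has_cont_grad_off_supp:
  assumes "has_cont_grad f G" "x \<notin> supp f" shows "G x = 0"
proof -
  have "(\<lambda>v. G x \<bullet> v) = (\<lambda>_. 0)"
    using assms derivative_zero_off_supp unfolding has_cont_grad_def by blast
  then have "G x \<bullet> G x = 0" by meson
  then show ?thesis by simp
qed

lemma C1c_field_iff:
  "C1c_field X \<longleftrightarrow> (\<exists>D. has_cont_deriv X D) \<and> compact (supp X)"
proof
  assume X: "C1c_field X"
  let ?D = "\<lambda>x. frechet_derivative X (at x)"
  have D: "(X has_derivative ?D x) (at x)" for x
    using X by (simp add: C1c_field_def frechet_derivative_works)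
  have "continuous_on UNIV (\<lambda>x. ?D x v)" for v
  proof -
    have "?D x v = (\<Sum>c\<in>Basis. (\<Sum>b\<in>Basis. (v \<bullet> b) * (?D x b \<bullet> c)) *\<^sub>R c)" for x
    proof -
      have "?D x v = ?D x (\<Sum>b\<in>Basis. (v \<bullet> b) *\<^sub>R b)" by (simp add: euclidean_representation)
      also have "\<dots> = (\<Sum>b\<in>Basis. (v \<bullet> b) *\<^sub>R ?D x b)"
        using has_derivative_linear[OF D] by (simp add: linear_sum linear_scale)
      finally have e: "?D x v = (\<Sum>b\<in>Basis. (v \<bullet> b) *\<^sub>R ?D x b)" .
      have "?D x v = (\<Sum>c\<in>Basis. (?D x v \<bullet> c) *\<^sub>R c)" by (simp add: euclidean_representation)
      then show ?thesis by (simp add: e inner_sum_left)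
    qed
    moreover have "continuous_on UNIV (\<lambda>x. \<Sum>c\<in>Basis. (\<Sum>b\<in>Basis. (v \<bullet> b) * (?D x b \<bullet> c)) *\<^sub>R c)"
      using X unfolding C1c_field_def
      by (intro continuous_on_sum continuous_on_scaleR continuous_on_mult continuous_on_const) auto
    ultimately show ?thesis by simp
  qed
  then show "(\<exists>D. has_cont_deriv X D) \<and> compact (supp X)"
    using D X unfolding has_cont_deriv_def C1c_field_def by (intro conjI exI[of _ ?D]) blast+
next
  assume "(\<exists>D. has_cont_deriv X D) \<and> compact (supp X)"
  then obtain D where D: "\<And>x. (X has_derivative D x) (at x)" "\<And>v. continuous_on UNIV (\<lambda>x. D x v)"
    and "compact (supp X)" by (auto simp: has_cont_deriv_def)
  moreover have "frechet_derivative X (at x) = D x" for x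
    using frechet_derivative_at[OF D(1)] by simp
  ultimately show "C1c_field X"
    using D(1) unfolding C1c_field_def differentiable_def by (auto simp: continuous_on_inner)
qed

lemma divergence_eq:
  "has_cont_deriv X D \<Longrightarrow> divergence X x = (\<Sum>b\<in>Basis. D x b \<bullet> b)"
  unfolding has_cont_deriv_def divergence_def using frechet_derivative_at by (metis (no_types, lifting))

lemma divergence_continuous:
  assumes "has_cont_deriv X D" shows "continuous_on UNIV (divergence X)"
proof -
  have "divergence X = (\<lambda>x. \<Sum>b\<in>Basis. D x b \<bullet> b)" using divergence_eq[OF assms] by blast
  then show ?thesis using assms unfolding has_cont_deriv_def by (auto intro!: continuous_intros)
qed

lemma divergence_off_supp:
  assumes "has_cont_deriv X D" "x \<notin> supp X" shows "divergence X x = 0"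
  using derivative_zero_off_supp[of X "D x" x] assms by (simp add: divergence_eq[OF assms(1)] has_cont_deriv_def)

lemma has_cont_deriv_add:
  "has_cont_deriv X D \<Longrightarrow> has_cont_deriv Y D' \<Longrightarrow> has_cont_deriv (\<lambda>x. X x + Y x) (\<lambda>x v. D x v + D' x v)"
  unfolding has_cont_deriv_def by (auto intro!: continuous_intros has_derivative_add)

lemma has_cont_deriv_scaleR:
  assumes u: "has_cont_grad u G" and X: "has_cont_deriv X D"
  shows "has_cont_deriv (\<lambda>x. u x *\<^sub>R X x) (\<lambda>x v. u x *\<^sub>R D x v + (G x \<bullet> v) *\<^sub>R X x)"
  using assms has_cont_deriv_continuous[OF X] has_cont_grad_continuous[OF u]
  unfolding has_cont_deriv_def has_cont_grad_def
  by (auto intro!: continuous_intros has_derivative_scaleR)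

lemma divergence_add:
  "has_cont_deriv X D \<Longrightarrow> has_cont_deriv Y D' \<Longrightarrow> divergence (\<lambda>x. X x + Y x) x = divergence X x + divergence Y x"
  by (simp add: divergence_eq[OF has_cont_deriv_add] divergence_eq inner_add_left sum.distrib)

lemma divergence_scaleR:
  assumes u: "has_cont_grad u G" and X: "has_cont_deriv X D"
  shows "divergence (\<lambda>x. u x *\<^sub>R X x) x = u x * divergence X x + G x \<bullet> X x"
proof -
  have "(\<Sum>b\<in>Basis. (G x \<bullet> b) * (X x \<bullet> b)) = G x \<bullet> X x"
    by (simp add: euclidean_inner[of "G x" "X x"])
  then show ?thesis
    by (simp add: divergence_eq[OF has_cont_deriv_scaleR[OF u X]] divergence_eq[OF X] inner_add_left sum.distrib sum_distrib_left)
qed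

lemma has_cont_grad_affine: "has_cont_grad u G \<Longrightarrow> has_cont_grad (\<lambda>x. a + c * u x) (\<lambda>x. c *\<^sub>R G x)"
  unfolding has_cont_grad_def by (auto intro!: continuous_intros derivative_eq_intros)

lemma has_cont_grad_const: "has_cont_grad (\<lambda>x::'a::euclidean_space. c) (\<lambda>x. 0)"
proof -
  have "(\<lambda>v. 0 \<bullet> v) = (\<lambda>v::'a. 0::real)" by simp
  then show ?thesis unfolding has_cont_grad_def by (metis continuous_on_const has_derivative_const)
qed

lemma has_cont_grad_mult:
  assumes "has_cont_grad u G" "has_cont_grad w H"
  shows "has_cont_grad (\<lambda>x. u x * w x) (\<lambda>x. u x *\<^sub>R H x + w x *\<^sub>R G x)"
  using assms has_cont_grad_continuous[OF assms(1)] has_cont_grad_continuous[OF assms(2)]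
  unfolding has_cont_grad_def
  by (auto intro!: continuous_intros derivative_eq_intros simp: algebra_simps)

lemma has_cont_grad_add:
  assumes "has_cont_grad u G" "has_cont_grad w H"
  shows "has_cont_grad (\<lambda>x. u x + w x) (\<lambda>x. G x + H x)"
  using assms unfolding has_cont_grad_def
  by (auto intro!: continuous_intros derivative_eq_intros simp: algebra_simps)

lemma has_cont_grad_compose:
  assumes u: "has_cont_grad u G" and f: "\<And>s. (f has_real_derivative f' s) (at s)" and c: "continuous_on UNIV f'"
  shows "has_cont_grad (\<lambda>x. f (u x)) (\<lambda>x. f' (u x) *\<^sub>R G x)"
proof -
  have "((\<lambda>x. f (u x)) has_derivative (\<lambda>v. (f' (u x) *\<^sub>R G x) \<bullet> v)) (at x)" for x
    using has_derivative_compose[of u "\<lambda>v. G x \<bullet> v" x UNIV f "\<lambda>h. f' (u x) * h"] u f[of "u x"]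
    by (simp add: has_cont_grad_def has_field_derivative_def)
  moreover have "continuous_on UNIV (\<lambda>x. f' (u x))"
    using continuous_on_compose2[OF c has_cont_grad_continuous[OF u]] by auto
  ultimately show ?thesis using u by (auto simp: has_cont_grad_def intro!: continuous_intros)
qed

lemma has_cont_grad_inner:
  assumes "has_cont_deriv X D"
  shows "has_cont_grad (\<lambda>x. X x \<bullet> c) (\<lambda>x. \<Sum>b\<in>Basis. (D x b \<bullet> c) *\<^sub>R b)"
proof -
  have "((\<lambda>x. X x \<bullet> c) has_derivative (\<lambda>v. (\<Sum>b\<in>Basis. (D x b \<bullet> c) *\<^sub>R b) \<bullet> v)) (at x)" for x
  proof -
    have d: "(X has_derivative D x) (at x)" using assms by (simp add: has_cont_deriv_def)
    have "(\<Sum>b\<in>Basis. (D x b \<bullet> c) *\<^sub>R b) \<bullet> v = D x v \<bullet> c" for v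
    proof -
      have "D x v = D x (\<Sum>b\<in>Basis. (v \<bullet> b) *\<^sub>R b)" by (simp add: euclidean_representation)
      also have "\<dots> = (\<Sum>b\<in>Basis. (v \<bullet> b) *\<^sub>R D x b)"
        using has_derivative_linear[OF d] by (simp add: linear_sum linear_scale)
      finally show ?thesis
        by (simp only: inner_sum_left inner_scaleR_left) (rule sum.cong, simp_all add: inner_commute mult.commute)
    qed
    then show ?thesis using has_derivative_inner_left[OF d, of c] by simp
  qed
  then show ?thesis using assms by (auto simp: has_cont_grad_def has_cont_deriv_def intro!: continuous_intros)
qed

lemma has_cont_grad_lipschitz:
  assumes "has_cont_grad f G" "\<And>x. norm (G x) \<le> L"
  shows "\<bar>f x - f y\<bar> \<le> L * norm (x - y)"
proof -
  have "onorm (\<lambda>v. G z \<bullet> v) \<le> L" for z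
  proof (rule onorm_bound)
    show "0 \<le> L" using assms(2)[of z] norm_ge_zero[of "G z"] by linarith
    show "norm (G z \<bullet> v) \<le> L * norm v" for v
      using Cauchy_Schwarz_ineq2[of "G z" v] mult_right_mono[OF assms(2)[of z] norm_ge_zero[of v]] by simp
  qed
  then have "norm (f x - f y) \<le> L * norm (x - y)"
    using assms(1) by (intro differentiable_bound[of UNIV f "\<lambda>z v. G z \<bullet> v"]) (auto simp: has_cont_grad_def)
  then show ?thesis by simp
qed

lemma bounded_off_compact:
  fixes G :: "'b::euclidean_space \<Rightarrow> 'c::real_normed_vector"
  assumes "continuous_on UNIV G" "compact S" "\<And>x. x \<notin> S \<Longrightarrow> G x = 0"
  obtains L where "0 < L" "\<And>x. norm (G x) \<le> L"
proof -
  have "compact (G ` S)" using assms by (meson compact_continuous_image continuous_on_subset subset_UNIV)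
  then obtain B where "0 < B" "\<And>x. x \<in> S \<Longrightarrow> norm (G x) \<le> B"
    using compact_imp_bounded[of "G ` S"] by (auto simp: bounded_pos)
  then show ?thesis using assms(3) by (intro that[of B]) (metis less_imp_le norm_zero)+
qed

text \<open>Difference quotients in direction \<open>b\<close> have integral 0 by translation
  invariance. They converge pointwise to the integrand and are dominated, since \<open>f\<close> is
  Lipschitz and steps of length at most \<open>norm b\<close> keep everything inside a fixed
  ball.\<close>

lemma integral_grad_zero:
  assumes f: "has_cont_grad f G" and s: "compact (supp f)"
  shows "(LINT x|lborel. G x \<bullet> b) = 0"
proof -
  obtain L where L: "0 < L" "\<And>x. norm (G x) \<le> L"
    using bounded_off_compact[of G "supp f"] f s has_cont_grad_off_supp[OF f] by (auto simp: has_cont_grad_def)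
  have fc: "continuous_on UNIV f" by (rule has_cont_grad_continuous[OF f])
  have [measurable]: "f \<in> borel_measurable borel" using fc by (rule borel_measurable_continuous_onI)
  have Gc: "continuous_on UNIV (\<lambda>x. G x \<bullet> b)" using f by (auto simp: has_cont_grad_def intro!: continuous_intros)
  have [measurable]: "(\<lambda>x. G x \<bullet> b) \<in> borel_measurable borel" using Gc by (rule borel_measurable_continuous_onI)
  obtain R where R: "supp f \<subseteq> ball 0 R" using bounded_subset_ballD[of "supp f" 0] s by (auto simp: compact_imp_bounded)
  have fR: "f y = 0" if "R < norm y" for y
  proof (rule not_in_supp[of y f])
    show "y \<notin> supp f" using subsetD[OF R, of y] that by auto
  qed
  let ?q = "\<lambda>n x. real (Suc n) * (f (x + (1 / real (Suc n)) *\<^sub>R b) - f x)"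
  let ?R = "R + norm b"
  have fi: "integrable lborel f"
    by (rule integrable_continuous_support[OF fc, of "supp f"]) (simp only: compact_imp_bounded[OF s], rule not_in_supp)
  have fi': "integrable lborel (\<lambda>x. f (x + c))" for c
  proof -
    have "integrable (distr lborel borel ((+) c)) f" using fi by (simp add: lborel_distr_plus)
    then show ?thesis by (subst (asm) integrable_distr_eq) (auto simp: add.commute)
  qed
  have "(\<lambda>n. LINT x|lborel. ?q n x) \<longlonglongrightarrow> (LINT x|lborel. G x \<bullet> b)"
  proof (rule integral_dominated_convergence[where w = "\<lambda>x. indicator (cball 0 ?R) x * (L * norm b)"])
    show "integrable lborel (\<lambda>x::'a. indicator (cball 0 ?R) x * (L * norm b))"
      by (rule integrable_bounded_support[of _ "cball 0 ?R" "L * norm b"]) (use L in \<open>auto simp: indicator_def\<close>)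
    show "AE x in lborel. (\<lambda>n. ?q n x) \<longlonglongrightarrow> G x \<bullet> b"
    proof (rule AE_I2)
      fix x
      have "(f has_derivative (\<lambda>v. G x \<bullet> v)) (at x)" using f by (simp add: has_cont_grad_def)
      then have "((\<lambda>t. f (x + t *\<^sub>R b)) has_derivative (\<lambda>t. G x \<bullet> (t *\<^sub>R b))) (at 0)"
        by (intro has_derivative_compose[where g = f and f = "\<lambda>t. x + t *\<^sub>R b"]) (auto intro!: derivative_eq_intros)
      then have "((\<lambda>t. f (x + t *\<^sub>R b)) has_real_derivative G x \<bullet> b) (at 0)"
        by (simp add: has_field_derivative_def mult_commute_abs)
      then have "((\<lambda>h. (f (x + h *\<^sub>R b) - f x) / h) \<longlongrightarrow> G x \<bullet> b) (at 0)"
        by (simp add: DERIV_def)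
      moreover have "filterlim (\<lambda>n. 1 / real (Suc n)) (at 0) sequentially"
        unfolding filterlim_at using LIMSEQ_inverse_real_of_nat by (auto simp: inverse_eq_divide)
      ultimately have "(\<lambda>n. (f (x + (1 / real (Suc n)) *\<^sub>R b) - f x) / (1 / real (Suc n))) \<longlonglongrightarrow> G x \<bullet> b"
        by (rule filterlim_compose)
      then show "(\<lambda>n. ?q n x) \<longlonglongrightarrow> G x \<bullet> b" by (simp add: mult.commute)
    qed
    show "AE x in lborel. norm (?q n x) \<le> indicator (cball 0 ?R) x * (L * norm b)" for n
    proof (rule AE_I2)
      fix x
      let ?h = "1 / real (Suc n)"
      show "norm (?q n x) \<le> indicator (cball 0 ?R) x * (L * norm b)"
      proof (cases "x \<in> cball 0 ?R")
        case True
        have "\<bar>f (x + ?h *\<^sub>R b) - f x\<bar> \<le> L * norm ((x + ?h *\<^sub>R b) - x)"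
          by (rule has_cont_grad_lipschitz[OF f L(2)])
        also have "\<dots> = ?h * (L * norm b)" by simp
        finally have "real (Suc n) * \<bar>f (x + ?h *\<^sub>R b) - f x\<bar> \<le> real (Suc n) * (?h * (L * norm b))"
          by (rule mult_left_mono) simp
        then show ?thesis using True by (simp add: abs_mult)
      next
        case False
        then have x: "norm x > R + norm b" by simp
        have "?h * norm b \<le> 1 * norm b" by (intro mult_right_mono) auto
        then have "norm (x + ?h *\<^sub>R b) > R"
          using x norm_triangle_ineq4[of "x + ?h *\<^sub>R b" "?h *\<^sub>R b"] by simp
        moreover have "R < norm x" using x norm_ge_zero[of b] by linarith
        ultimately have "f (x + ?h *\<^sub>R b) = 0" "f x = 0"
          by (simp_all only: fR)
        then show ?thesis using False by simp
      qed
    qed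
  qed auto
  moreover have "(LINT x|lborel. ?q n x) = 0" for n
    using fi fi' integral_lborel_translate[of f] by simp
  ultimately show ?thesis by (simp add: LIMSEQ_const_iff)
qed

text \<open>Constants are therefore invisible to the tests in \<open>bv_tests\<close>; this is how a
  test of a complement becomes a test of the set with the opposite field.\<close>

lemma integral_divergence_zero:
  assumes "C1c_field X"
  shows "(LINT x|lebesgue. divergence X x) = 0"
proof -
  obtain D where D: "has_cont_deriv X D" and s: "compact (supp X)" using assms by (auto simp: C1c_field_iff)
  have di: "integrable lborel (\<lambda>x. D x b \<bullet> b)" for b
  proof (rule integrable_continuous_support[of _ "supp X"])
    show "continuous_on UNIV (\<lambda>x. D x b \<bullet> b)"
      using D by (simp add: has_cont_deriv_def continuous_on_inner)
    show "D x b \<bullet> b = 0" if "x \<notin> supp X" for x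
      using derivative_zero_off_supp[of X "D x" x] D that by (simp add: has_cont_deriv_def)
  qed (use s in \<open>simp only: compact_imp_bounded\<close>)
  have "(LINT x|lborel. D x b \<bullet> b) = 0" if b: "b \<in> Basis" for b
  proof -
    have "compact (supp (\<lambda>x. X x \<bullet> b))" by (rule compact_supp_subset[OF s]) auto
    from integral_grad_zero[OF has_cont_grad_inner[OF D] this, of b]
    show ?thesis using b by (simp add: inner_sum_left inner_Basis if_distrib cong: if_cong)
  qed
  then have "(LINT x|lborel. (\<Sum>b\<in>Basis. D x b \<bullet> b)) = 0" using di by simp
  then have "(LINT x|lborel. divergence X x) = 0" by (simp only: divergence_eq[OF D])
  moreover have "divergence X \<in> borel_measurable borel"
    by (rule borel_measurable_continuous_onI[OF divergence_continuous[OF D]])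
  ultimately show ?thesis by (simp add: integral_completion)
qed

section \<open>The perimeter bound for minimizers\<close>

lemma C1c_fieldI: "has_cont_deriv X D \<Longrightarrow> compact (supp X) \<Longrightarrow> C1c_field X"
  unfolding C1c_field_iff by blast

lemma integrable_indicator_continuous:
  fixes f :: "'b::euclidean_space \<Rightarrow> real"
  assumes F: "F \<in> sets lebesgue" and c: "continuous_on UNIV f" and s: "compact S" and z: "\<And>x. x \<notin> S \<Longrightarrow> f x = 0"
  shows "integrable lebesgue (\<lambda>x. indicator F x * f x)"
proof -
  have "integrable lborel f"
    by (rule integrable_continuous_support[OF c compact_imp_bounded[OF s]]) (rule z)
  then have "integrable lebesgue f"
    using borel_measurable_continuous_onI[OF c] by (simp add: integrable_completion)
  from integrable_mult_indicator[OF F this] show ?thesis by simp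
qed

lemma integrable_indicator_supp:
  fixes f :: "'b::euclidean_space \<Rightarrow> real"
  assumes "F \<in> sets lebesgue" "continuous_on UNIV f" "compact (supp f)"
  shows "integrable lebesgue (\<lambda>x. indicator F x * f x)"
  by (rule integrable_indicator_continuous[OF assms]) (rule not_in_supp)

text \<open>A dual form of \<open>\<integral> \<psi> d|D \<chi>\<^sub>F| \<le> \<integral>\<^sub>F |\<nabla> \<psi>| + C \<integral>\<^sub>F \<psi>\<close>, with no reference to the measure \<open>|D \<chi>\<^sub>F|\<close>.\<close>
definition perimeter_bound :: "'b::euclidean_space set \<Rightarrow> real \<Rightarrow> bool" where
  "perimeter_bound F C \<longleftrightarrow> (\<forall>Y \<psi> G. C1c_field Y \<longrightarrow> has_cont_grad \<psi> G \<longrightarrow> compact (supp \<psi>) \<longrightarrow>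
     (\<forall>x. norm (Y x) \<le> \<psi> x) \<longrightarrow>
     (LINT x|lebesgue. indicator F x * divergence Y x)
       \<le> (LINT x|lebesgue. indicator F x * norm (G x)) + C * (LINT x|lebesgue. indicator F x * \<psi> x))"

text \<open>The competitor is \<open>\<chi>\<^sub>F (1 - \<psi>)\<close>; since \<open>|(1 - \<psi>) X + Y| \<le> 1\<close>, the field \<open>(1 - \<psi>) X + Y\<close> may be
  tested against \<open>\<chi>\<^sub>F\<close>.\<close>
lemma perimeter_bound_of_almost_minimal:
  fixes F :: "'b::euclidean_space set"
  assumes F: "F \<in> sets lebesgue"
    and P: "\<And>X. C1c_field X \<Longrightarrow> (\<forall>x. norm (X x) \<le> 1) \<Longrightarrow> (LINT x|lebesgue. indicator F x * divergence X x) \<le> P"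
    and min: "\<And>\<psi> G B. has_cont_grad \<psi> G \<Longrightarrow> compact (supp \<psi>) \<Longrightarrow> (\<And>x. 0 \<le> \<psi> x) \<Longrightarrow> (\<And>x. \<psi> x \<le> 1) \<Longrightarrow>
        (\<And>X. C1c_field X \<Longrightarrow> (\<forall>x. norm (X x) \<le> 1) \<Longrightarrow>
          (LINT x|lebesgue. indicator F x * (1 - \<psi> x) * divergence X x) \<le> B) \<Longrightarrow>
        P \<le> B + C * (LINT x|lebesgue. indicator F x * \<psi> x)"
  shows "perimeter_bound F C"
proof -
  have small: "(LINT x|lebesgue. indicator F x * divergence Y x)
       \<le> (LINT x|lebesgue. indicator F x * norm (G x)) + C * (LINT x|lebesgue. indicator F x * \<psi> x)"
    if Y: "C1c_field Y" and \<psi>: "has_cont_grad \<psi> G" and s: "compact (supp \<psi>)"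
      and le: "\<And>x. norm (Y x) \<le> \<psi> x" and le1: "\<And>x. \<psi> x \<le> 1" for Y \<psi> G
  proof -
    obtain DY where DY: "has_cont_deriv Y DY" and sY: "compact (supp Y)"
      using Y by (auto simp: C1c_field_iff)
    have \<psi>0: "0 \<le> \<psi> x" for x using le[of x] norm_ge_zero order_trans by blast
    have Gc: "continuous_on UNIV G" using \<psi> by (simp add: has_cont_grad_def)
    have iG: "integrable lebesgue (\<lambda>x. indicator F x * norm (G x))"
      by (rule integrable_indicator_continuous[OF F _ s])
        (use Gc has_cont_grad_off_supp[OF \<psi>] in \<open>auto intro!: continuous_intros\<close>)
    have iY: "integrable lebesgue (\<lambda>x. indicator F x * divergence Y x)"
      by (rule integrable_indicator_continuous[OF F divergence_continuous[OF DY] sY divergence_off_supp[OF DY]])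
    \<comment> \<open>For the field \<open>?Z\<close> below, the test of the competitor against
      \<open>X\<close> equals the test of \<open>F\<close> against \<open>?Z\<close>, plus the
      integral of \<open>G x \<bullet> X x\<close> over \<open>F\<close>, minus the test of
      \<open>F\<close> against \<open>Y\<close>. The first is at most \<open>P\<close>, the second
      at most the integral of \<open>norm (G x)\<close>; this sum is \<open>?B\<close>.\<close>
    let ?B = "P - (LINT x|lebesgue. indicator F x * divergence Y x) + (LINT x|lebesgue. indicator F x * norm (G x))"
    have "P \<le> ?B + C * (LINT x|lebesgue. indicator F x * \<psi> x)"
    proof (rule min[OF \<psi> s \<psi>0 le1])
      fix X :: "'b \<Rightarrow> 'b" assume X: "C1c_field X" and X1: "\<forall>x. norm (X x) \<le> 1"
      obtain DX where DX: "has_cont_deriv X DX" and sX: "compact (supp X)"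
        using X by (auto simp: C1c_field_iff)
      have g: "has_cont_grad (\<lambda>x. 1 - \<psi> x) (\<lambda>x. - G x)"
        using has_cont_grad_affine[OF \<psi>, of 1 "-1"] by simp
      note sc = has_cont_deriv_scaleR[OF g DX]
      let ?Z = "\<lambda>x. (1 - \<psi> x) *\<^sub>R X x + Y x"
      have Zd: "divergence ?Z x = (1 - \<psi> x) * divergence X x - G x \<bullet> X x + divergence Y x" for x
        using divergence_add[OF sc DY, of x] divergence_scaleR[OF g DX, of x] by simp
      have sZ: "compact (supp ?Z)"
      proof -
        have "{x. ?Z x \<noteq> 0} \<subseteq> {x. X x \<noteq> 0} \<union> {x. Y x \<noteq> 0}" by auto
        then have "supp ?Z \<subseteq> supp X \<union> supp Y"
          using closure_mono[of "{x. ?Z x \<noteq> 0}" "{x. X x \<noteq> 0} \<union> {x. Y x \<noteq> 0}"] by (simp only: closure_Un)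
        from compact_Int_closed[OF compact_Un[OF sX sY] closed_closure, of "{x. ?Z x \<noteq> 0}"] this
        show ?thesis by (simp only: inf_absorb2)
      qed
      have Z: "C1c_field ?Z" by (rule C1c_fieldI[OF has_cont_deriv_add[OF sc DY] sZ])
      have Z1: "\<forall>x. norm (?Z x) \<le> 1"
      proof
        fix x
        have "norm (?Z x) \<le> (1 - \<psi> x) * norm (X x) + norm (Y x)"
          using norm_triangle_ineq[of "(1 - \<psi> x) *\<^sub>R X x" "Y x"] le1[of x] by simp
        also have "\<dots> \<le> (1 - \<psi> x) * 1 + \<psi> x"
          using X1 le le1[of x] by (intro add_mono mult_left_mono) auto
        finally show "norm (?Z x) \<le> 1" by simp
      qed
      have iX: "integrable lebesgue (\<lambda>x. indicator F x * ((1 - \<psi> x) * divergence X x))"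
        by (rule integrable_indicator_continuous[OF F _ sX])
          (use divergence_continuous[OF DX] has_cont_grad_continuous[OF \<psi>] divergence_off_supp[OF DX] in \<open>auto intro!: continuous_intros\<close>)
      have iGX: "integrable lebesgue (\<lambda>x. indicator F x * (G x \<bullet> X x))"
        by (rule integrable_indicator_continuous[OF F _ s])
          (use Gc has_cont_deriv_continuous[OF DX] has_cont_grad_off_supp[OF \<psi>] in \<open>auto intro!: continuous_intros\<close>)
      have "(LINT x|lebesgue. indicator F x * (G x \<bullet> X x)) \<le> (LINT x|lebesgue. indicator F x * norm (G x))"
      proof (rule integral_mono[OF iGX iG])
        fix x
        have "G x \<bullet> X x \<le> norm (G x) * norm (X x)" by (rule norm_cauchy_schwarz)
        also have "\<dots> \<le> norm (G x) * 1" using X1 by (intro mult_left_mono) auto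
        finally show "indicator F x * (G x \<bullet> X x) \<le> indicator F x * norm (G x)"
          by (simp add: indicator_def)
      qed
      moreover have "(LINT x|lebesgue. indicator F x * divergence ?Z x) \<le> P" by (rule P[OF Z Z1])
      moreover have "(LINT x|lebesgue. indicator F x * divergence ?Z x)
          = (LINT x|lebesgue. indicator F x * ((1 - \<psi> x) * divergence X x)) - (LINT x|lebesgue. indicator F x * (G x \<bullet> X x))
            + (LINT x|lebesgue. indicator F x * divergence Y x)"
      proof -
        have "(LINT x|lebesgue. indicator F x * divergence ?Z x)
          = (LINT x|lebesgue. indicator F x * ((1 - \<psi> x) * divergence X x) - indicator F x * (G x \<bullet> X x) + indicator F x * divergence Y x)"
          by (simp only: Zd distrib_left right_diff_distrib)
        then show ?thesis using iX iGX iY by simp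
      qed
      ultimately show "(LINT x|lebesgue. indicator F x * (1 - \<psi> x) * divergence X x) \<le> ?B"
        by (simp add: mult.assoc)
    qed
    then show ?thesis by simp
  qed
  show ?thesis
    unfolding perimeter_bound_def
  proof (intro allI impI)
    fix Y \<psi> and G :: "'b \<Rightarrow> 'b"
    assume Y: "C1c_field Y" and \<psi>: "has_cont_grad \<psi> G" and s: "compact (supp \<psi>)"
      and le: "\<forall>x. norm (Y x) \<le> \<psi> x"
    obtain M where M: "0 < M" "\<And>x. norm (\<psi> x) \<le> M"
      by (rule bounded_off_compact[OF has_cont_grad_continuous[OF \<psi>] s]) (erule not_in_supp[of _ \<psi>], blast)
    obtain DY where DY: "has_cont_deriv Y DY" and sY: "compact (supp Y)"
      using Y by (auto simp: C1c_field_iff)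
    \<comment> \<open>The inequality is homogeneous of degree one in \<open>Y\<close> and
      \<open>\<psi>\<close> jointly, so dividing by a bound of \<open>\<psi>\<close> reduces it to
      the case \<psi> \<le> 1.\<close>
    define c where "c = 1 / M"
    have c: "0 < c" using M by (simp add: c_def)
    have Y': "has_cont_deriv (\<lambda>x. c *\<^sub>R Y x) (\<lambda>x v. c *\<^sub>R DY x v)"
      using has_cont_deriv_scaleR[OF has_cont_grad_const[of c] DY] by simp
    have "C1c_field (\<lambda>x. c *\<^sub>R Y x)"
      unfolding C1c_field_iff
    proof
      show "compact (supp (\<lambda>x. c *\<^sub>R Y x))" by (rule compact_supp_subset[OF sY]) auto
    qed (use Y' in blast)
    moreover have "has_cont_grad (\<lambda>x. c * \<psi> x) (\<lambda>x. c *\<^sub>R G x)"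
      using has_cont_grad_affine[OF \<psi>, of 0 c] by simp
    moreover have "compact (supp (\<lambda>x. c * \<psi> x))"
      by (rule compact_supp_subset[OF s]) auto
    moreover have "norm (c *\<^sub>R Y x) \<le> c * \<psi> x" for x
      using le c by simp
    moreover have "c * \<psi> x \<le> 1" for x
      using M(2)[of x] M(1) by (simp add: c_def field_simps)
    ultimately have "(LINT x|lebesgue. indicator F x * divergence (\<lambda>x. c *\<^sub>R Y x) x)
       \<le> (LINT x|lebesgue. indicator F x * norm (c *\<^sub>R G x)) + C * (LINT x|lebesgue. indicator F x * (c * \<psi> x))"
      by (rule small)
    moreover have "divergence (\<lambda>x. c *\<^sub>R Y x) x = c * divergence Y x" for x
      using divergence_scaleR[OF has_cont_grad_const[of c] DY, of x] by simp
    ultimately have "c * (LINT x|lebesgue. indicator F x * divergence Y x)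
       \<le> c * ((LINT x|lebesgue. indicator F x * norm (G x)) + C * (LINT x|lebesgue. indicator F x * \<psi> x))"
      using c by (simp add: mult.left_commute[of _ c] distrib_left)
    then show "(LINT x|lebesgue. indicator F x * divergence Y x)
       \<le> (LINT x|lebesgue. indicator F x * norm (G x)) + C * (LINT x|lebesgue. indicator F x * \<psi> x)"
      using c by simp
  qed
qed

text \<open>The datum \<open>f\<close> is known only through the convolution of \<open>K\<close>
  with f - u. Writing f - v = (f - u) + (u - v) makes \<open>v\<close> admissible by Young, and
  Minkowski bounds the change of the fidelity term, so that \<open>f\<close> disappears. The
  splitting of the convolution holds almost everywhere, because \<open>conv_defined\<close> is an
  almost everywhere statement.\<close>

lemma minimizer_almost_minimal:
  fixes K :: "'b::euclidean_space \<Rightarrow> real"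
  assumes p: "1 \<le> p" and lam: "0 < lam" and K: "kernel_assms K p"
    and u: "u \<in> minimizer_class K p lam"
    and v: "in_BV v" and h: "integrable lebesgue (\<lambda>x. u x - v x)"
  shows "bv_seminorm u \<le> bv_seminorm v + lam * lp_norm p K * (LINT x|lebesgue. \<bar>u x - v x\<bar>)"
proof -
  obtain f where f: "u \<in> minimizers K p lam f" using u by (auto simp: minimizer_class_def)
  then have adm: "conv_defined K (\<lambda>x. f x - u x)" "in_Lp p (conv K (\<lambda>x. f x - u x))"
    and min: "\<And>v. admissible K p f v \<Longrightarrow> tv_functional K p lam f u \<le> tv_functional K p lam f v"
    by (auto simp: minimizers_def admissible_def)
  obtain M where M: "\<And>x. K x \<le> M"
    using K unfolding kernel_assms_def bounded_iff by (metis abs_le_D1 rangeI real_norm_def)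
  have K0: "\<And>x. 0 \<le> K x" and Ki: "integrable lebesgue K"
    using K by (auto simp: kernel_assms_def less_imp_le)
  let ?h = "\<lambda>x. u x - v x"
  note Y = conv_Young_L1[OF p K0 M Ki h]
  have split: "(\<lambda>y. K (x - y) * (f y - v y)) = (\<lambda>y. K (x - y) * (f y - u y) + K (x - y) * ?h y)" for x
    by (auto simp: algebra_simps)
  have d: "conv_defined K (\<lambda>x. f x - v x)"
    using adm(1) unfolding conv_defined_def split by eventually_elim (simp add: Y(1))
  have e: "AE x in lebesgue. conv K (\<lambda>x. f x - u x) x + conv K ?h x = conv K (\<lambda>x. f x - v x) x"
    using adm(1) unfolding conv_defined_def
    by eventually_elim (simp add: conv_def split Y(1))
  let ?a = "conv K (\<lambda>x. f x - u x)" and ?b = "conv K ?h" and ?c = "conv K (\<lambda>x. f x - v x)"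
  have ab: "?a \<in> borel_measurable lebesgue" "?b \<in> borel_measurable lebesgue"
     "integrable lebesgue (\<lambda>x. \<bar>?a x\<bar> powr p)" "integrable lebesgue (\<lambda>x. \<bar>?b x\<bar> powr p)"
    using adm(2) Y(2) by (auto simp: in_Lp_def)
  note mk = Minkowski_powr[OF p ab]
  have cm: "?c \<in> borel_measurable lebesgue"
    by (rule borel_measurable_AE[OF borel_measurable_add[OF ab(1,2)] e])
  have e2: "AE x in lebesgue. \<bar>?a x + ?b x\<bar> powr p = \<bar>?c x\<bar> powr p"
    using e by eventually_elim simp
  have ci: "integrable lebesgue (\<lambda>x. \<bar>?c x\<bar> powr p)"
    using integrable_cong_AE[OF _ _ e2] mk(1) ab(1,2) cm by simp
  have ceq: "(LINT x|lebesgue. \<bar>?a x + ?b x\<bar> powr p) = (LINT x|lebesgue. \<bar>?c x\<bar> powr p)"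
    by (rule integral_cong_AE[OF _ _ e2]) (use ab(1,2) cm in simp_all)
  have "admissible K p f v"
    using v d cm ci by (simp add: admissible_def in_Lp_def)
  from min[OF this] have "bv_seminorm u + lam * lp_norm p ?a \<le> bv_seminorm v + lam * lp_norm p ?c"
    by (simp add: tv_functional_def)
  moreover have "lp_norm p ?c \<le> lp_norm p ?a + lp_norm p K * (LINT x|lebesgue. \<bar>?h x\<bar>)"
    using mk(2) Y(3) unfolding ceq lp_norm_def by linarith
  then have "lam * lp_norm p ?c \<le> lam * (lp_norm p ?a + lp_norm p K * (LINT x|lebesgue. \<bar>?h x\<bar>))"
    using lam by (intro mult_left_mono) auto
  ultimately show ?thesis by (simp add: distrib_left mult.assoc)
qed

lemma bv_tests_zero: "0 \<in> bv_tests u"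
proof -
  have "C1c_field (\<lambda>x::'a. 0)" unfolding C1c_field_iff has_cont_deriv_def
    by (auto intro!: exI[of _ "\<lambda>x v. 0"])
  moreover have "divergence (\<lambda>x::'a. 0) x = 0" for x by (simp add: divergence_def)
  ultimately show ?thesis unfolding bv_tests_def by (auto intro!: exI[of _ "\<lambda>x. 0"])
qed

lemma loc_integrable_bounded:
  fixes v :: "'b::euclidean_space \<Rightarrow> real"
  assumes m[measurable]: "v \<in> borel_measurable lebesgue" and b: "\<And>x. \<bar>v x\<bar> \<le> M"
  shows "loc_integrable v"
  unfolding loc_integrable_def
proof (intro conjI allI impI)
  fix S :: "'b set" assume S: "compact S"
  have "S \<in> sets lebesgue" using S by (simp add: borel_compact)
  moreover have "emeasure lebesgue S < \<infinity>" using emeasure_compact_finite[OF S] S by (simp add: borel_compact)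
  ultimately have "integrable lebesgue (\<lambda>x. indicator S x * M)" by simp
  then show "set_integrable lebesgue S v"
    unfolding set_integrable_def
    by (rule Bochner_Integration.integrable_bound)
      (use \<open>S \<in> sets lebesgue\<close> b in \<open>auto intro!: AE_I2 simp: indicator_def intro: order_trans[OF b]\<close>)
qed (rule m)

text \<open>Neither \<open>E\<close> nor its complement has to be of finite measure: each competitor
  differs from the indicator of \<open>E\<close> by an integrable function of compact support. The
  complement has the same admissible bound for its tests, since its test against \<open>X\<close> is
  the test of \<open>E\<close> against \<open>- X\<close>.\<close>

lemma minimizer_perimeter_bound:
  fixes K :: "'b::euclidean_space \<Rightarrow> real"
  assumes p: "1 \<le> p" and lam: "0 < lam" and K: "kernel_assms K p"
    and u: "(indicator E :: 'b \<Rightarrow> real) \<in> minimizer_class K p lam"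
  shows "E \<in> sets lebesgue" "perimeter_bound E (lam * lp_norm p K)" "perimeter_bound (- E) (lam * lp_norm p K)"
proof -
  let ?C = "lam * lp_norm p K" and ?P = "bv_seminorm (indicator E :: 'b \<Rightarrow> real)"
  have bv: "in_BV (indicator E :: 'b \<Rightarrow> real)"
    using u by (auto simp: minimizer_class_def minimizers_def admissible_def)
  then have "(indicator E :: 'b \<Rightarrow> real) \<in> borel_measurable lebesgue"
    by (simp add: in_BV_def loc_integrable_def)
  then show E: "E \<in> sets lebesgue" by (simp add: borel_measurable_indicator_iff)
  have PE: "(LINT x|lebesgue. indicator E x * divergence X x) \<le> ?P"
    if "C1c_field X" "\<forall>x. norm (X x) \<le> 1" for X :: "'b \<Rightarrow> 'b"
    unfolding bv_seminorm_def by (rule cSup_upper) (use bv that in \<open>auto simp: in_BV_def bv_tests_def\<close>)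
  \<comment> \<open>A common bound \<open>B\<close> of all tests of \<open>v\<close> gives at once
    membership in BV and a bound of the seminorm, so that no competitor's seminorm has to be
    computed.\<close>
  have comp: "?P \<le> B + ?C * (LINT x|lebesgue. \<bar>indicator E x - v x\<bar>)"
    if v: "v \<in> borel_measurable lebesgue" "\<And>x. \<bar>v x\<bar> \<le> 1"
      and i: "integrable lebesgue (\<lambda>x. indicator E x - v x)"
      and B: "\<And>X. C1c_field X \<Longrightarrow> (\<forall>x. norm (X x) \<le> 1) \<Longrightarrow> (LINT x|lebesgue. v x * divergence X x) \<le> B"
    for v :: "'b \<Rightarrow> real" and B
  proof -
    have *: "\<And>b. b \<in> bv_tests v \<Longrightarrow> b \<le> B" using B by (auto simp: bv_tests_def)
    have "in_BV v" unfolding in_BV_def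
      using loc_integrable_bounded[OF v] * by (auto simp: bdd_above_def)
    from minimizer_almost_minimal[OF p lam K u this i]
    have "?P \<le> bv_seminorm v + ?C * (LINT x|lebesgue. \<bar>indicator E x - v x\<bar>)" .
    moreover have "bv_seminorm v \<le> B"
      unfolding bv_seminorm_def by (rule cSup_least) (use bv_tests_zero[of v] * in auto)
    ultimately show ?thesis by simp
  qed
  show "perimeter_bound E ?C"
  proof (rule perimeter_bound_of_almost_minimal[OF E PE])
    fix \<psi> :: "'b \<Rightarrow> real" and G B
    assume \<psi>: "has_cont_grad \<psi> G" "compact (supp \<psi>)" "\<And>x. 0 \<le> \<psi> x" "\<And>x. \<psi> x \<le> 1"
      and B: "\<And>X. C1c_field X \<Longrightarrow> (\<forall>x. norm (X x) \<le> 1) \<Longrightarrow>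
          (LINT x|lebesgue. indicator E x * (1 - \<psi> x) * divergence X x) \<le> B"
    have "\<psi> \<in> borel_measurable borel" using has_cont_grad_continuous[OF \<psi>(1)] by (rule borel_measurable_continuous_onI)
    then have m: "\<psi> \<in> borel_measurable lebesgue" by (simp add: measurable_completion)
    have "?P \<le> B + ?C * (LINT x|lebesgue. \<bar>indicator E x - indicator E x * (1 - \<psi> x)\<bar>)"
    proof (rule comp[OF _ _ _ B])
      show "integrable lebesgue (\<lambda>x. indicator E x - indicator E x * (1 - \<psi> x))"
      proof -
        have "(\<lambda>x. indicator E x - indicator E x * (1 - \<psi> x)) = (\<lambda>x. indicator E x * \<psi> x)"
          by (auto simp: algebra_simps)
        then show ?thesis
          using integrable_indicator_supp[OF E has_cont_grad_continuous[OF \<psi>(1)] \<psi>(2)]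
          by (simp only:)
      qed
    qed (use \<psi> m E in \<open>auto simp: indicator_def abs_le_iff intro: order_trans[of _ 0]\<close>)
    moreover have "\<bar>indicator E x - indicator E x * (1 - \<psi> x)\<bar> = indicator E x * \<psi> x" for x
      using \<psi>(3)[of x] by (simp add: indicator_def)
    ultimately show "?P \<le> B + ?C * (LINT x|lebesgue. indicator E x * \<psi> x)" by simp
  qed
  have nE: "- E \<in> sets lebesgue" using E by (metis Compl_in_sets_lebesgue)
  have ind: "indicator (- E) x = 1 - (indicator E x :: real)" for x by (simp add: indicator_def)
  have neg: "C1c_field (\<lambda>x. - X x)" "divergence (\<lambda>x. - X x) = (\<lambda>x. - divergence X x)"
      "integrable lebesgue (divergence X)"
      "integrable lebesgue (\<lambda>x. indicator E x * divergence X x)"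
    if X: "C1c_field X" for X :: "'b \<Rightarrow> 'b"
  proof -
    obtain D where D: "has_cont_deriv X D" and s: "compact (supp X)" using X by (auto simp: C1c_field_iff)
    have "has_cont_deriv (\<lambda>x. - X x) (\<lambda>x v. - D x v)"
      using has_cont_deriv_scaleR[OF has_cont_grad_const[of "-1"] D] by simp
    then show "C1c_field (\<lambda>x. - X x)" using s by (auto simp: C1c_field_iff)
    show "divergence (\<lambda>x. - X x) = (\<lambda>x. - divergence X x)"
      using divergence_scaleR[OF has_cont_grad_const[of "-1"] D] by (simp add: fun_eq_iff)
    show "integrable lebesgue (\<lambda>x. indicator E x * divergence X x)"
      by (rule integrable_indicator_continuous[OF E divergence_continuous[OF D] s divergence_off_supp[OF D]])
    have "integrable lebesgue (\<lambda>x. indicator UNIV x * divergence X x)"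
      by (rule integrable_indicator_continuous[OF _ divergence_continuous[OF D] s divergence_off_supp[OF D]]) simp
    then show "integrable lebesgue (divergence X)" by simp
  qed
  show "perimeter_bound (- E) ?C"
  proof (rule perimeter_bound_of_almost_minimal[OF nE])
    fix X :: "'b \<Rightarrow> 'b" assume X: "C1c_field X" "\<forall>x. norm (X x) \<le> 1"
    have "(LINT x|lebesgue. indicator (- E) x * divergence X x)
        = (LINT x|lebesgue. divergence X x - indicator E x * divergence X x)"
      by (simp only: ind left_diff_distrib mult_1)
    also have "\<dots> = - (LINT x|lebesgue. indicator E x * divergence X x)"
      using neg(3,4)[OF X(1)] integral_divergence_zero[OF X(1)] by simp
    also have "\<dots> = (LINT x|lebesgue. indicator E x * divergence (\<lambda>x. - X x) x)"
      by (simp add: neg(2)[OF X(1)])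
    also have "\<dots> \<le> ?P" using neg(1)[OF X(1)] X(2) by (intro PE) auto
    finally show "(LINT x|lebesgue. indicator (- E) x * divergence X x) \<le> ?P" .
  next
    fix \<psi> :: "'b \<Rightarrow> real" and G B
    assume \<psi>: "has_cont_grad \<psi> G" "compact (supp \<psi>)" "\<And>x. 0 \<le> \<psi> x" "\<And>x. \<psi> x \<le> 1"
      and B: "\<And>X. C1c_field X \<Longrightarrow> (\<forall>x. norm (X x) \<le> 1) \<Longrightarrow>
          (LINT x|lebesgue. indicator (- E) x * (1 - \<psi> x) * divergence X x) \<le> B"
    have \<psi>c: "continuous_on UNIV \<psi>" by (rule has_cont_grad_continuous[OF \<psi>(1)])
    then have "\<psi> \<in> borel_measurable borel" by (rule borel_measurable_continuous_onI)
    then have m: "\<psi> \<in> borel_measurable lebesgue" by (simp add: measurable_completion)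
    \<comment> \<open>This is the indicator of \<open>E\<close> plus
      \<open>indicator (- E) x * \<psi> x\<close>. Dropping the constant 1 turns its test against
      \<open>X\<close> into the test of \<open>indicator (- E) x * (1 - \<psi> x)\<close> against
      \<open>- X\<close>, which \<open>B\<close> controls.\<close>
    let ?v = "\<lambda>x. 1 - indicator (- E) x * (1 - \<psi> x)"
    have "?P \<le> B + ?C * (LINT x|lebesgue. \<bar>indicator E x - ?v x\<bar>)"
    proof (rule comp)
      have "(\<lambda>x. indicator E x - ?v x) = (\<lambda>x. - (indicator (- E) x * \<psi> x))"
        by (auto simp: ind algebra_simps)
      then show "integrable lebesgue (\<lambda>x. indicator E x - ?v x)"
        using integrable_indicator_supp[OF nE \<psi>c \<psi>(2)] by simp
      fix X :: "'b \<Rightarrow> 'b" assume X: "C1c_field X" "\<forall>x. norm (X x) \<le> 1"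
      obtain D where D: "has_cont_deriv X D" and s: "compact (supp X)" using X by (auto simp: C1c_field_iff)
      have i: "integrable lebesgue (\<lambda>x. indicator (- E) x * ((1 - \<psi> x) * divergence X x))"
        by (rule integrable_indicator_continuous[OF nE _ s])
          (use divergence_continuous[OF D] \<psi>c divergence_off_supp[OF D] in \<open>auto intro!: continuous_intros\<close>)
      have "(LINT x|lebesgue. ?v x * divergence X x)
          = (LINT x|lebesgue. divergence X x - indicator (- E) x * ((1 - \<psi> x) * divergence X x))"
        by (simp only: left_diff_distrib mult_1 mult.assoc)
      also have "\<dots> = - (LINT x|lebesgue. indicator (- E) x * ((1 - \<psi> x) * divergence X x))"
        using neg(3)[OF X(1)] integral_divergence_zero[OF X(1)] i by simp
      also have "\<dots> = (LINT x|lebesgue. indicator (- E) x * (1 - \<psi> x) * divergence (\<lambda>x. - X x) x)"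
        by (simp add: neg(2)[OF X(1)] mult.assoc)
      also have "\<dots> \<le> B" using neg(1)[OF X(1)] X(2) by (intro B) auto
      finally show "(LINT x|lebesgue. ?v x * divergence X x) \<le> B" .
    next
      show "\<bar>?v x\<bar> \<le> 1" for x
        using \<psi>(3)[of x] \<psi>(4)[of x] by (simp add: indicator_def)
    qed (use m nE in simp)
    moreover have "\<bar>indicator E x - ?v x\<bar> = indicator (- E) x * \<psi> x" for x
      using \<psi>(3)[of x] by (simp add: indicator_def)
    ultimately show "?P \<le> B + ?C * (LINT x|lebesgue. indicator (- E) x * \<psi> x)" by simp
  qed
qed

section \<open>Borel representatives and invariance under rotations\<close>

definition perimeter_bound_borel :: "'b::euclidean_space set \<Rightarrow> real \<Rightarrow> bool" where
  "perimeter_bound_borel F C \<longleftrightarrow> (\<forall>Y D \<psi> G. has_cont_deriv Y D \<longrightarrow> compact (supp Y) \<longrightarrow> has_cont_grad \<psi> G \<longrightarrow>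
     compact (supp \<psi>) \<longrightarrow> (\<forall>x. norm (Y x) \<le> \<psi> x) \<longrightarrow>
     (LINT x|lborel. indicator F x * divergence Y x)
       \<le> (LINT x|lborel. indicator F x * norm (G x)) + C * (LINT x|lborel. indicator F x * \<psi> x))"

lemma orthogonal_borel_measurable:
  fixes Q :: "'b::euclidean_space \<Rightarrow> 'b"
  shows "orthogonal_transformation Q \<Longrightarrow> Q \<in> borel_measurable borel"
  by (intro borel_measurable_continuous_onI linear_continuous_on)
    (blast intro: orthogonal_transformation_linear linear_conv_bounded_linear[THEN iffD1])

text \<open>Invariance of the trace: expand \<open>R b\<close> in the standard basis, exchange the
  sums, and use that \<open>inv R\<close> is the adjoint of \<open>R\<close>. It makes the
  divergence of a rotated field agree with that of the original one.\<close>

lemma trace_orthogonal: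
  fixes A R :: "'b::euclidean_space \<Rightarrow> 'b"
  assumes A: "linear A" and R: "orthogonal_transformation R"
  shows "(\<Sum>b\<in>Basis. A (R b) \<bullet> R b) = (\<Sum>b\<in>Basis. A b \<bullet> b)"
proof -
  have R': "orthogonal_transformation (inv R)" using R orthogonal_transformation_inv by blast
  have adj: "R a \<bullet> c = a \<bullet> inv R c" for a c
  proof -
    have "R a \<bullet> R (inv R c) = a \<bullet> inv R c" using R by (simp add: orthogonal_transformation_def)
    then show ?thesis using orthogonal_transformation_surj[OF R] by (simp add: surj_f_inv_f)
  qed
  have "A (R b) = (\<Sum>c\<in>Basis. (R b \<bullet> c) *\<^sub>R A c)" for b
  proof -
    have "A (R b) = A (\<Sum>c\<in>Basis. (R b \<bullet> c) *\<^sub>R c)" by (simp add: euclidean_representation)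
    then show ?thesis using A by (simp add: linear_sum linear_scale)
  qed
  then have "(\<Sum>b\<in>Basis. A (R b) \<bullet> R b) = (\<Sum>b\<in>Basis. \<Sum>c\<in>Basis. (b \<bullet> inv R c) * (inv R (A c) \<bullet> b))"
    by (simp only: inner_sum_left inner_scaleR_left adj inner_commute[of "A _"]) (simp only: inner_commute)
  also have "\<dots> = (\<Sum>c\<in>Basis. \<Sum>b\<in>Basis. (inv R c \<bullet> b) * (inv R (A c) \<bullet> b))"
    by (subst sum.swap) (simp only: inner_commute)
  also have "\<dots> = (\<Sum>c\<in>Basis. inv R c \<bullet> inv R (A c))"
    by (simp only: euclidean_inner[symmetric])
  also have "\<dots> = (\<Sum>c\<in>Basis. A c \<bullet> c)"
    using R' by (simp add: orthogonal_transformation_def inner_commute)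
  finally show ?thesis .
qed

lemma perimeter_bound_imp_borel:
  fixes E F :: "'b::euclidean_space set"
  assumes E: "perimeter_bound E C" and F[measurable]: "F \<in> sets borel"
    and eq: "AE x in lborel. (x \<in> E) = (x \<in> F)"
  shows "perimeter_bound_borel F C"
  unfolding perimeter_bound_borel_def
proof (intro allI impI)
  fix Y :: "'b \<Rightarrow> 'b" and D \<psi> G
  assume Y: "has_cont_deriv Y D" "compact (supp Y)" and \<psi>: "has_cont_grad \<psi> G" "compact (supp \<psi>)"
    and le: "\<forall>x. norm (Y x) \<le> \<psi> x"
  have tr: "(LINT x|lebesgue. indicator E x * f x) = (LINT x|lborel. indicator F x * f x)"
    if f: "continuous_on UNIV f" for f :: "'b \<Rightarrow> real"
  proof (rule lebesgue_eq_lborel(3))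
    have [measurable]: "f \<in> borel_measurable borel" using f by (rule borel_measurable_continuous_onI)
    show "(\<lambda>x. indicator F x * f x) \<in> borel_measurable borel" by measurable
    show "AE x in lborel. indicator E x * f x = indicator F x * f x"
      using eq by eventually_elim (auto simp: indicator_def)
  qed
  have "continuous_on UNIV (\<lambda>x. norm (G x))"
    using \<psi>(1) by (auto simp: has_cont_grad_def intro: continuous_on_norm)
  note trs = tr[OF this] tr[OF divergence_continuous[OF Y(1)]] tr[OF has_cont_grad_continuous[OF \<psi>(1)]]
  have "(LINT x|lebesgue. indicator E x * divergence Y x)
       \<le> (LINT x|lebesgue. indicator E x * norm (G x)) + C * (LINT x|lebesgue. indicator E x * \<psi> x)"
    using E C1c_fieldI[OF Y] \<psi> le unfolding perimeter_bound_def by blast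
  then show "(LINT x|lborel. indicator F x * divergence Y x)
       \<le> (LINT x|lborel. indicator F x * norm (G x)) + C * (LINT x|lborel. indicator F x * \<psi> x)"
    by (simp only: trs)
qed

text \<open>The test pair is transported by \<open>Q\<close>, vectors included. Divergence, length
  of the gradient and Lebesgue measure are all preserved, so the constant stays the same.\<close>

lemma perimeter_bound_borel_rotate:
  fixes F :: "'b::euclidean_space set" and Q :: "'b \<Rightarrow> 'b"
  assumes c: "perimeter_bound_borel F C" and Q: "orthogonal_transformation Q" and F[measurable]: "F \<in> sets borel"
  shows "perimeter_bound_borel (Q -` F) C"
  unfolding perimeter_bound_borel_def
proof (intro allI impI)
  fix Y :: "'b \<Rightarrow> 'b" and D \<psi> G
  assume Y: "has_cont_deriv Y D" "compact (supp Y)" and \<psi>: "has_cont_grad \<psi> G" "compact (supp \<psi>)"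
    and le: "\<forall>x. norm (Y x) \<le> \<psi> x"
  let ?R = "inv Q"
  have R: "orthogonal_transformation ?R" using Q orthogonal_transformation_inv by blast
  have QR: "Q (?R x) = x" and RQ: "?R (Q x) = x" for x
    using orthogonal_transformation_bij[OF Q] by (simp_all add: bij_is_surj bij_is_inj surj_f_inv_f inv_f_f)
  have lQ: "bounded_linear Q" and lR: "bounded_linear ?R"
    using Q R by (blast intro: orthogonal_transformation_linear linear_conv_bounded_linear[THEN iffD1])+
  have [measurable]: "Q \<in> borel_measurable borel" by (rule orthogonal_borel_measurable[OF Q])
  have cR: "continuous_on UNIV ?R" and cQ: "continuous_on UNIV Q"
    using linear_continuous_on lR lQ by blast+
  have adj: "Q a \<bullet> v = a \<bullet> ?R v" for a v
  proof -
    have "Q a \<bullet> Q (?R v) = a \<bullet> ?R v" using Q by (simp add: orthogonal_transformation_def)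
    then show ?thesis by (simp only: QR)
  qed
  let ?Y = "\<lambda>x. Q (Y (?R x))" and ?D = "\<lambda>x v. Q (D (?R x) (?R v))"
  let ?p = "\<lambda>x. \<psi> (?R x)" and ?G = "\<lambda>x. Q (G (?R x))"
  have Y': "has_cont_deriv ?Y ?D"
    unfolding has_cont_deriv_def
  proof (intro conjI allI)
    fix x
    have "((\<lambda>x. Y (?R x)) has_derivative (\<lambda>v. D (?R x) (?R v))) (at x)"
      using has_derivative_compose[OF bounded_linear_imp_has_derivative[OF lR], of Y "D (?R x)" x UNIV] Y(1)
      by (simp add: has_cont_deriv_def)
    then show "(?Y has_derivative ?D x) (at x)"
      by (rule bounded_linear.has_derivative[OF lQ])
    fix v
    have "continuous_on UNIV (\<lambda>x. D x (?R v))" using Y(1) by (simp add: has_cont_deriv_def)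
    from continuous_on_compose2[OF this cR subset_UNIV] have "continuous_on UNIV (\<lambda>x. D (?R x) (?R v))" .
    from continuous_on_compose2[OF cQ this subset_UNIV] show "continuous_on UNIV (\<lambda>x. ?D x v)" .
  qed
  have \<psi>': "has_cont_grad ?p ?G"
    unfolding has_cont_grad_def
  proof (intro conjI allI)
    fix x
    show "(?p has_derivative (\<lambda>v. ?G x \<bullet> v)) (at x)"
      using has_derivative_compose[OF bounded_linear_imp_has_derivative[OF lR], of \<psi> "\<lambda>v. G (?R x) \<bullet> v" x UNIV] \<psi>(1)
      by (simp add: has_cont_grad_def adj)
    have "continuous_on UNIV G" using \<psi>(1) by (simp add: has_cont_grad_def)
    from continuous_on_compose2[OF this cR subset_UNIV] have "continuous_on UNIV (\<lambda>x. G (?R x))" .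
    from continuous_on_compose2[OF cQ this subset_UNIV] show "continuous_on UNIV ?G" .
  qed
  have cs: "compact (supp (\<lambda>x. f (?R x)))" if "compact (supp f)" for f :: "'b \<Rightarrow> 'c::real_vector"
  proof -
    have k: "compact (Q ` supp f)" using compact_continuous_image[OF continuous_on_subset[OF cQ] that] by simp
    have "{x. f (?R x) \<noteq> 0} \<subseteq> Q ` supp f"
    proof
      fix x assume "x \<in> {x. f (?R x) \<noteq> 0}"
      then have "?R x \<in> {x. f x \<noteq> 0}" by simp
      then have "?R x \<in> supp f" by (rule subsetD[OF closure_subset])
      then have "Q (?R x) \<in> Q ` supp f" by (rule imageI)
      then show "x \<in> Q ` supp f" by (simp only: QR)
    qed
    then have "supp (\<lambda>x. f (?R x)) \<subseteq> Q ` supp f" by (rule closure_minimal[OF _ compact_imp_closed[OF k]])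
    from compact_Int_closed[OF k closed_closure, of "{x. f (?R x) \<noteq> 0}"] this
    show ?thesis by (simp only: inf_absorb2)
  qed
  have sY: "compact (supp ?Y)"
  proof (rule compact_supp_subset[OF cs[OF Y(2)]])
    have "Q 0 = 0" by (rule linear_0[OF orthogonal_transformation_linear[OF Q]])
    then have "Y (?R x) \<noteq> 0" if "?Y x \<noteq> 0" for x using that by metis
    then show "{x. ?Y x \<noteq> 0} \<subseteq> {x. Y (?R x) \<noteq> 0}" by (rule Collect_mono[rule_format])
  qed
  have tr: "(LINT x|lborel. indicator F x * f x) = (LINT x|lborel. indicator (Q -` F) x * f (Q x))"
    if f: "continuous_on UNIV f" for f :: "'b \<Rightarrow> real"
  proof -
    have [measurable]: "f \<in> borel_measurable borel" using f by (rule borel_measurable_continuous_onI)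
    have "(LINT x|lborel. indicator F x * f x) = (LINT x|distr lborel borel Q. indicator F x * f x)"
      by (simp add: distr_lborel_orthogonal[OF Q])
    also have "\<dots> = (LINT x|lborel. indicator F (Q x) * f (Q x))"
      by (rule integral_distr) measurable
    finally show ?thesis by (simp add: indicator_def)
  qed
  have div: "divergence ?Y (Q x) = divergence Y x" for x
  proof -
    have "linear (D x)" using Y(1) by (auto simp: has_cont_deriv_def intro: has_derivative_linear)
    from trace_orthogonal[OF this R] show ?thesis
      by (simp only: divergence_eq[OF Y'] divergence_eq[OF Y(1)] RQ adj)
  qed
  have nG: "norm (Q v) = norm v" for v
    by (rule orthogonal_transformation_norm[OF Q])
  have "continuous_on UNIV ?G" using \<psi>' by (simp add: has_cont_grad_def)
  then have cG: "continuous_on UNIV (\<lambda>x. norm (?G x))" by (rule continuous_on_norm)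
  have le': "\<forall>x. norm (?Y x) \<le> ?p x" using le by (simp add: orthogonal_transformation_norm[OF Q])
  have "(LINT x|lborel. indicator F x * divergence ?Y x)
       \<le> (LINT x|lborel. indicator F x * norm (?G x)) + C * (LINT x|lborel. indicator F x * ?p x)"
    by (rule c[unfolded perimeter_bound_borel_def, rule_format, OF Y' sY \<psi>' cs[OF \<psi>(2)] spec[OF le']])
  then show "(LINT x|lborel. indicator (Q -` F) x * divergence Y x)
       \<le> (LINT x|lborel. indicator (Q -` F) x * norm (G x)) + C * (LINT x|lborel. indicator (Q -` F) x * \<psi> x)"
    unfolding tr[OF divergence_continuous[OF Y']] tr[OF has_cont_grad_continuous[OF \<psi>']] tr[OF cG]
    unfolding div nG RQ .
qed

text \<open>Balls and half-spaces at \<open>Q x\<close> are the images of those at \<open>x\<close>,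
  and \<open>Q\<close> preserves volume; passing from \<open>E\<close> to the Borel set
  \<open>F\<close> changes each volume by 0.\<close>

lemma mt_outer_normal_rotate:
  fixes E F :: "'b::euclidean_space set" and Q :: "'b \<Rightarrow> 'b"
  assumes n: "mt_outer_normal E (Q x) (Q \<nu>)" and Q: "orthogonal_transformation Q"
    and E: "E \<in> sets lebesgue" and F[measurable]: "F \<in> sets borel"
    and eq: "AE x in lborel. (x \<in> E) = (x \<in> F)"
  shows "((\<lambda>r. measure lborel (ball x r \<inter> {y. \<nu> \<bullet> (y - x) \<ge> 0} \<inter> Q -` F) / r ^ DIM('b)) \<longlongrightarrow> 0) (at_right 0)"
    and "((\<lambda>r. measure lborel ((ball x r \<inter> {y. \<nu> \<bullet> (y - x) \<le> 0}) - Q -` F) / r ^ DIM('b)) \<longlongrightarrow> 0) (at_right 0)"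
proof -
  have [measurable]: "Q \<in> borel_measurable borel" by (rule orthogonal_borel_measurable[OF Q])
  have lin: "linear Q" using Q by (rule orthogonal_transformation_linear)
  have Qball: "Q y \<in> ball (Q x) r \<longleftrightarrow> y \<in> ball x r" for y r
    by (simp add: dist_norm linear_diff[OF lin, symmetric] orthogonal_transformation_norm[OF Q])
  have Qin: "Q \<nu> \<bullet> (Q y - Q x) = \<nu> \<bullet> (y - x)" for y
    using Q by (simp add: linear_diff[OF lin, symmetric] orthogonal_transformation_def)
  have tr: "measure lebesgue X = measure lborel (Q -` Y)"
    if X: "X \<in> sets lebesgue" and Y[measurable]: "Y \<in> sets borel"
      and XY: "AE y in lborel. (y \<in> X) = (y \<in> Y)" for X Y
  proof -
    have "measure lebesgue X = measure lebesgue Y"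
      using X Y AE_completion[OF XY] by (intro measure_eq_AE) auto
    also have "\<dots> = measure lborel Y" by (simp add: measure_completion)
    also have "\<dots> = measure (distr lborel borel Q) Y" by (simp add: distr_lborel_orthogonal[OF Q])
    also have "\<dots> = measure lborel (Q -` Y)" by (subst measure_distr) auto
    finally show ?thesis .
  qed
  have [measurable]: "{y. Q \<nu> \<bullet> (y - Q x) \<ge> 0} \<in> sets borel" "{y. Q \<nu> \<bullet> (y - Q x) \<le> 0} \<in> sets borel" by measurable
  have "measure lebesgue (ball (Q x) r \<inter> {y. Q \<nu> \<bullet> (y - Q x) \<ge> 0} \<inter> E)
      = measure lborel (Q -` (ball (Q x) r \<inter> {y. Q \<nu> \<bullet> (y - Q x) \<ge> 0} \<inter> F))" for r
    by (rule tr) (use E eq in \<open>auto elim!: eventually_mono intro!: sets.Int[of _ lebesgue]\<close>)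
  moreover have "Q -` (ball (Q x) r \<inter> {y. Q \<nu> \<bullet> (y - Q x) \<ge> 0} \<inter> F) = ball x r \<inter> {y. \<nu> \<bullet> (y - x) \<ge> 0} \<inter> Q -` F" for r
    using Qball Qin by auto
  ultimately show "((\<lambda>r. measure lborel (ball x r \<inter> {y. \<nu> \<bullet> (y - x) \<ge> 0} \<inter> Q -` F) / r ^ DIM('b)) \<longlongrightarrow> 0) (at_right 0)"
    using n by (simp add: mt_outer_normal_def)
  have "measure lebesgue ((ball (Q x) r \<inter> {y. Q \<nu> \<bullet> (y - Q x) \<le> 0}) - E)
      = measure lborel (Q -` ((ball (Q x) r \<inter> {y. Q \<nu> \<bullet> (y - Q x) \<le> 0}) - F))" for r
    by (rule tr) (use E eq in \<open>auto elim!: eventually_mono intro!: sets.Diff[of _ lebesgue]\<close>)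
  moreover have "Q -` ((ball (Q x) r \<inter> {y. Q \<nu> \<bullet> (y - Q x) \<le> 0}) - F) = (ball x r \<inter> {y. \<nu> \<bullet> (y - x) \<le> 0}) - Q -` F" for r
    using Qball Qin by auto
  ultimately show "((\<lambda>r. measure lborel ((ball x r \<inter> {y. \<nu> \<bullet> (y - x) \<le> 0}) - Q -` F) / r ^ DIM('b)) \<longlongrightarrow> 0) (at_right 0)"
    using n by (simp add: mt_outer_normal_def)
qed

text \<open>Complementation together with a change of sign exchanges the two half-ball
  conditions.\<close>

lemma mt_outer_normal_Compl: "mt_outer_normal E x \<nu> \<Longrightarrow> mt_outer_normal (- E) x (- \<nu>)"
  by (simp add: mt_outer_normal_def Diff_eq)

section \<open>Densities at the graph\<close>

lemma emeasure_shear: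
  fixes f :: "'a::euclidean_space \<Rightarrow> real"
  assumes [measurable]: "f \<in> borel_measurable borel" and A[measurable]: "A \<in> sets borel"
  shows "emeasure lborel A = emeasure lborel {z. (fst z, f (fst z) + snd z) \<in> A}"
proof -
  have [measurable]: "(\<lambda>z::'a\<times>real. (fst z, f (fst z) + snd z)) \<in> borel_measurable borel"
    by (simp add: borel_prod[symmetric])
  have "emeasure lborel A = emeasure (distr lborel borel (\<lambda>z. (fst z, f (fst z) + snd z))) A"
    by (simp add: distr_lborel_shear)
  also have "\<dots> = emeasure lborel {z. (fst z, f (fst z) + snd z) \<in> A}"
    by (subst emeasure_distr) (auto simp: vimage_def)
  finally show ?thesis .
qed

lemma borel_Times [measurable (raw)]:
  fixes A :: "'a::second_countable_topology set" and B :: "'b::second_countable_topology set"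
  assumes "A \<in> sets borel" "B \<in> sets borel"
  shows "A \<times> B \<in> sets borel"
  using assms by (metis borel_prod pair_measureI)

lemma emeasure_lborel_Times:
  fixes A :: "'a::euclidean_space set" and B :: "real set"
  assumes "A \<in> sets borel" "B \<in> sets borel"
  shows "emeasure lborel (A \<times> B) = emeasure lborel A * emeasure lborel B"
proof -
  have "emeasure (lborel \<Otimes>\<^sub>M lborel) (A \<times> B) = emeasure lborel A * emeasure lborel B"
    by (rule lborel.emeasure_pair_measure_Times) (use assms in auto)
  then show ?thesis by (simp add: lborel_prod)
qed

lemma graph_strip_measurable:
  fixes l :: "'a::euclidean_space \<Rightarrow> real"
  assumes "continuous_on UNIV l" and [measurable]: "A \<in> sets borel"
  shows "{z. fst z \<in> A \<and> \<bar>snd z - l (fst z)\<bar> \<le> c} \<in> sets borel"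
proof -
  have [measurable]: "l \<in> borel_measurable borel" using assms(1) by (rule borel_measurable_continuous_onI)
  have "{z. fst z \<in> A \<and> \<bar>snd z - l (fst z)\<bar> \<le> c}
      = {z \<in> space (borel \<Otimes>\<^sub>M borel). fst z \<in> A \<and> \<bar>snd z - l (fst z)\<bar> \<le> c}"
    by (simp add: space_pair_measure)
  also have "\<dots> \<in> sets (borel \<Otimes>\<^sub>M borel)" by measurable
  finally show ?thesis by (simp only: borel_prod)
qed

lemma emeasure_graph_strip:
  fixes l :: "'a::euclidean_space \<Rightarrow> real"
  assumes l: "continuous_on UNIV l" and A[measurable]: "A \<in> sets borel" and c: "0 \<le> c"
  shows "emeasure lborel {z. fst z \<in> A \<and> \<bar>snd z - l (fst z)\<bar> \<le> c} = emeasure lborel A * ennreal (2 * c)"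
proof -
  have [measurable]: "l \<in> borel_measurable borel" using l by (rule borel_measurable_continuous_onI)
  let ?T = "{z. fst z \<in> A \<and> \<bar>snd z - l (fst z)\<bar> \<le> c}"
  have T: "?T \<in> sets borel" by (rule graph_strip_measurable[OF l A])
  have "emeasure lborel ?T = emeasure lborel {z. (fst z, l (fst z) + snd z) \<in> ?T}"
    by (rule emeasure_shear) (use T in simp_all)
  also have "{z. (fst z, l (fst z) + snd z) \<in> ?T} = A \<times> {-c..c}" by auto
  also have "emeasure lborel \<dots> = emeasure lborel A * ennreal (2 * c)"
    using c by (subst emeasure_lborel_Times) auto
  finally show ?thesis .
qed

text \<open>Averaging over the centres \<open>(y, \<phi> y)\<close> of balls whose radius is comparable to the width of the
  layer turns densities at single points into the volume of \<open>H\<close> in the layer.\<close>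
lemma layer_measure_tendsto_0:
  fixes \<phi> :: "'a::euclidean_space \<Rightarrow> real" and H :: "('a \<times> real) set"
  assumes lip: "\<And>x y. \<bar>\<phi> x - \<phi> y\<bar> \<le> L * norm (x - y)" and H[measurable]: "H \<in> sets borel"
    and W: "open W" and S: "compact S" "S \<subseteq> W"
    and dens: "AE y in lborel. y \<in> W \<longrightarrow>
       ((\<lambda>r. measure lborel (ball (y, \<phi> y) r \<inter> H) / r ^ DIM('a \<times> real)) \<longlongrightarrow> 0) (at_right 0)"
  shows "(\<lambda>n. real (Suc n) * measure lborel {z \<in> H. fst z \<in> S \<and> \<bar>snd z - \<phi> (fst z)\<bar> < 1 / real (Suc n)}) \<longlonglongrightarrow> 0"
proof -
  have L0: "0 \<le> L"
  proof -
    obtain b :: 'a where b: "b \<in> Basis" using nonempty_Basis by blast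
    have "0 \<le> L * norm (b - 0)" using lip[of b 0] abs_ge_zero order_trans by blast
    then show ?thesis using b by simp
  qed
  have \<phi>c: "continuous_on UNIV \<phi>"
  proof (rule continuous_on_iff[THEN iffD2], intro ballI allI impI)
    fix x e assume "0 < (e::real)"
    then have "\<bar>\<phi> y - \<phi> x\<bar> < e" if "norm (y - x) < e / (L + 1)" for y
    proof -
      have "(L + 1) * norm (y - x) < e" using that L0 by (simp add: pos_less_divide_eq mult.commute)
      then have "L * norm (y - x) + norm (y - x) < e" by (simp add: distrib_right)
      then show ?thesis using lip[of y x] norm_ge_zero[of "y - x"] by linarith
    qed
    then show "\<exists>d>0. \<forall>y\<in>UNIV. dist y x < d \<longrightarrow> dist (\<phi> y) (\<phi> x) < e"
      using L0 \<open>0 < e\<close> by (intro exI[of _ "e / (L + 1)"]) (auto simp: dist_norm)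
  qed
  have [measurable]: "\<phi> \<in> borel_measurable borel" using \<phi>c by (rule borel_measurable_continuous_onI)
  obtain d where d: "0 < d" and dW: "(\<Union>x\<in>S. cball x d) \<subseteq> W"
    using compact_subset_open_imp_cball_epsilon_subset[OF S(1) W S(2)] by auto
  \<comment> \<open>Balls are centred over points near \<open>S\<close>, not only over
    \<open>S\<close>; the closed neighbourhood \<open>K\<close> keeps these centres in
    \<open>W\<close>, where the density hypothesis holds.\<close>
  define K where "K = (\<Union>x\<in>S. cball x d)"
  have cK: "compact K" unfolding K_def by (rule compact_minkowski_sum_cball[OF S(1)])
  then have [measurable]: "K \<in> sets borel" by (simp add: borel_compact)
  have [measurable]: "S \<in> sets borel" using S(1) by (simp add: borel_compact)
  let ?D = "DIM('a \<times> real)"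
  let ?w = "unit_ball_vol (real ?D)" and ?v = "unit_ball_vol (real DIM('a))"
  define h where "h n = 1 / real (Suc n)" for n
  \<comment> \<open>If z has height within \<open>h n\<close> of the graph and y is within
    \<open>h n\<close> of \<open>fst z\<close>, the distance from (y, \<phi> y) to z is below (1 + L
    + 1) \<open>h n\<close>. So this radius lets every such ball contain z.\<close>
  define r where "r n = (L + 3) * h n" for n
  have h0: "0 < h n" and r0: "0 < r n" for n using L0 by (simp_all add: h_def r_def)
  define m where "m n y = measure lborel (ball (y, \<phi> y) (r n) \<inter> H)" for n y
  define layer where "layer n = {z \<in> H. fst z \<in> S \<and> \<bar>snd z - \<phi> (fst z)\<bar> < h n}" for n
  have fin: "emeasure lborel (ball (y, \<phi> y) (r n) \<inter> H) < \<infinity>" for n y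
  proof -
    have "emeasure lborel (ball (y, \<phi> y) (r n) \<inter> H) \<le> emeasure lborel (ball (y, \<phi> y) (r n))"
      by (rule emeasure_mono) auto
    also have "\<dots> < \<infinity>" using r0[of n] by (simp add: emeasure_ball)
    finally show ?thesis .
  qed
  have emm: "emeasure lborel (ball (y, \<phi> y) (r n) \<inter> H) = ennreal (m n y)" for n y
    unfolding m_def using fin[of y n] by (simp add: emeasure_eq_ennreal_measure less_top[symmetric])
  have dist_m[measurable]: "(\<lambda>w::'a \<times> ('a \<times> real). dist (fst w, \<phi> (fst w)) (snd w)) \<in> borel_measurable (borel \<Otimes>\<^sub>M borel)"
    unfolding borel_prod
    by (intro borel_measurable_continuous_onI continuous_intros continuous_on_compose2[OF \<phi>c]) auto
  \<comment> \<open>Writing \<open>m n y\<close> as an integral with parameter yields its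
    measurability in y.\<close>
  have nnm: "(\<integral>\<^sup>+z. indicator H z * indicator {..<r n} (dist (y, \<phi> y) z) \<partial>lborel) = ennreal (m n y)" for n y
  proof -
    have "(\<integral>\<^sup>+z. indicator H z * indicator {..<r n} (dist (y, \<phi> y) z) \<partial>lborel)
        = (\<integral>\<^sup>+z. indicator (ball (y, \<phi> y) (r n) \<inter> H) z \<partial>lborel)"
      by (intro nn_integral_cong) (auto simp: indicator_def)
    then show ?thesis by (simp add: emm)
  qed
  have ker[measurable]: "(\<lambda>(y, z). indicator H z * indicator {..<r n} (dist (y, \<phi> y) z) :: ennreal)
      \<in> borel_measurable (borel \<Otimes>\<^sub>M borel)" for n
  proof -
    have "(\<lambda>w. indicator H (snd w) * indicator {..<r n} (dist (fst w, \<phi> (fst w)) (snd w)) :: ennreal)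
      \<in> borel_measurable (borel \<Otimes>\<^sub>M borel)" by measurable
    then show ?thesis by (simp add: split_def)
  qed
  have mm[measurable]: "m n \<in> borel_measurable borel" for n
  proof -
    have "(\<lambda>y. \<integral>\<^sup>+z. indicator H z * indicator {..<r n} (dist (y, \<phi> y) z) \<partial>lborel) \<in> borel_measurable borel"
      by measurable
    then have "(\<lambda>y. enn2real (ennreal (m n y))) \<in> borel_measurable borel"
      unfolding nnm by measurable
    moreover have "(\<lambda>y. enn2real (ennreal (m n y))) = m n" by (rule ext) (simp add: m_def)
    ultimately show ?thesis by simp
  qed
  have m_le: "m n y \<le> ?w * r n ^ ?D" for n y
  proof -
    have "m n y \<le> measure lborel (ball (y, \<phi> y) (r n))"
      unfolding m_def by (intro measure_mono_fmeasurable) (use r0[of n] in \<open>auto simp: fmeasurable_def emeasure_ball\<close>)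
    also have "\<dots> = ?w * r n ^ ?D" using r0[of n] by (simp add: content_ball)
    finally show ?thesis .
  qed
  define I where "I n = (LINT y|lborel. indicator K y * (m n y / r n ^ ?D))" for n
  have Ki: "integrable lborel (\<lambda>y. indicator K y * c)" for c :: real
    using emeasure_compact_finite[OF cK] by (intro integrable_mult_left integrable_real_indicator) auto
  have rlim: "filterlim r (at_right 0) sequentially"
  proof -
    have "(\<lambda>n. (L + 3) * (1 / real (Suc n))) \<longlonglongrightarrow> (L + 3) * 0"
      by (intro tendsto_mult tendsto_const LIMSEQ_Suc lim_1_over_n)
    then have "r \<longlonglongrightarrow> 0" unfolding r_def h_def by simp
    then show ?thesis by (simp add: filterlim_at r0 order_less_imp_not_eq2[OF r0])
  qed
  have "I \<longlonglongrightarrow> (LINT y::'a|lborel. (0::real))" unfolding I_def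
  proof (rule integral_dominated_convergence[where w = "\<lambda>y::'a. indicator K y * ?w"])
    show "AE y in lborel. (\<lambda>n. indicator K y * (m n y / r n ^ ?D)) \<longlonglongrightarrow> 0"
      using dens
    proof eventually_elim
      case (elim y)
      show ?case
      proof (cases "y \<in> K")
        case True
        then have "y \<in> W" using dW unfolding K_def by blast
        with elim have "(\<lambda>n. m n y / r n ^ ?D) \<longlonglongrightarrow> 0"
          unfolding m_def using filterlim_compose[OF _ rlim] by blast
        then show ?thesis using True by simp
      qed simp
    qed
    show "AE y in lborel. norm (indicator K y * (m n y / r n ^ ?D)) \<le> indicator K y * ?w" for n
    proof (rule AE_I2)
      fix y
      have "0 \<le> m n y" by (simp add: m_def)
      moreover have "m n y / r n ^ ?D \<le> ?w"
        using m_le[of n y] r0[of n] by (simp add: pos_divide_le_eq)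
      ultimately show "norm (indicator K y * (m n y / r n ^ ?D)) \<le> indicator K y * ?w"
        using r0[of n] by (simp add: indicator_def)
    qed
  qed (use Ki in simp_all)
  then have I0: "I \<longlonglongrightarrow> 0" by simp
  have [measurable]: "layer n \<in> sets borel" for n
  proof -
    have "{z. fst z \<in> S \<and> \<bar>snd z - \<phi> (fst z)\<bar> < h n}
        = {z \<in> space (borel \<Otimes>\<^sub>M borel). fst z \<in> S \<and> \<bar>snd z - \<phi> (fst z)\<bar> < h n}"
      by (simp add: space_pair_measure)
    also have "\<dots> \<in> sets (borel \<Otimes>\<^sub>M borel)" by measurable
    finally have "H \<inter> {z. fst z \<in> S \<and> \<bar>snd z - \<phi> (fst z)\<bar> < h n} \<in> sets borel"
      by (intro sets.Int H) (simp only: borel_prod)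
    then show ?thesis by (simp add: layer_def Collect_conj_eq Int_assoc Collect_mem_eq)
  qed
  \<comment> \<open>Double counting: every z of the layer is seen by the balls of all centres y in
    \<open>ball (fst z) (h n)\<close>, a set of measure \<open>?v * h n ^ DIM('a)\<close>.
    Exchanging the integrals bounds that measure times the volume of the layer by the integral of
    \<open>m n\<close> over \<open>K\<close>.\<close>
  have key: "real (Suc n) * measure lborel (layer n) \<le> (L + 3) ^ ?D / ?v * I n" if n: "h n \<le> d" for n
  proof -
    have "ennreal (?v * h n ^ DIM('a)) * emeasure lborel (layer n)
        = (\<integral>\<^sup>+z. indicator (layer n) z * emeasure lborel (ball (fst z) (h n)) \<partial>lborel)"
      using h0[of n] by (simp add: emeasure_ball nn_integral_multc less_imp_le mult.commute)
    also have "\<dots> \<le> (\<integral>\<^sup>+z. (\<integral>\<^sup>+y. indicator K y * (indicator H z * indicator {..<r n} (dist (y, \<phi> y) z)) \<partial>lborel) \<partial>lborel)"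
    proof (rule nn_integral_mono)
      fix z :: "'a \<times> real"
      show "indicator (layer n) z * emeasure lborel (ball (fst z) (h n))
        \<le> (\<integral>\<^sup>+y. indicator K y * (indicator H z * indicator {..<r n} (dist (y, \<phi> y) z)) \<partial>lborel)"
      proof (cases "z \<in> layer n")
        case True
        then have z: "z \<in> H" "fst z \<in> S" "\<bar>snd z - \<phi> (fst z)\<bar> < h n" by (auto simp: layer_def)
        have "emeasure lborel (ball (fst z) (h n)) = (\<integral>\<^sup>+y. indicator (ball (fst z) (h n)) y \<partial>lborel)" by simp
        also have "\<dots> \<le> (\<integral>\<^sup>+y. indicator K y * (indicator H z * indicator {..<r n} (dist (y, \<phi> y) z)) \<partial>lborel)"
        proof (rule nn_integral_mono)
          fix y
          show "indicator (ball (fst z) (h n)) y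
              \<le> (indicator K y * (indicator H z * indicator {..<r n} (dist (y, \<phi> y) z)) :: ennreal)"
          proof (cases "y \<in> ball (fst z) (h n)")
            case y: True
            then have yz: "norm (y - fst z) < h n" by (simp add: dist_norm norm_minus_commute)
            have "y \<in> K" unfolding K_def using z(2) y n by (auto intro!: bexI[of _ "fst z"])
            moreover have "dist (y, \<phi> y) z < r n"
            proof -
              have "dist (y, \<phi> y) z \<le> norm (y - fst z) + \<bar>\<phi> y - snd z\<bar>"
                by (cases z) (simp add: dist_norm norm_Pair sqrt_sum_squares_le_sum_abs[THEN order_trans] sqrt_sum_squares_le_sum)
              also have "\<bar>\<phi> y - snd z\<bar> \<le> L * norm (y - fst z) + h n"
                using lip[of y "fst z"] z(3) by linarith
              also have "L * norm (y - fst z) \<le> L * h n" using yz L0 by (intro mult_left_mono) auto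
              also have "norm (y - fst z) + (L * h n + h n) < r n"
                using yz h0[of n] by (simp add: r_def algebra_simps)
              finally show ?thesis by simp
            qed
            ultimately show ?thesis using z(1) by (simp add: indicator_def)
          qed simp
        qed
        finally show ?thesis using True by simp
      qed simp
    qed
    also have "\<dots> = (\<integral>\<^sup>+y. (\<integral>\<^sup>+z. indicator K y * (indicator H z * indicator {..<r n} (dist (y, \<phi> y) z)) \<partial>lborel) \<partial>lborel)"
      by (rule lborel_pair.Fubini'[symmetric]) measurable
    also have "\<dots> = (\<integral>\<^sup>+y. indicator K y * ennreal (m n y) \<partial>lborel)"
    proof (rule nn_integral_cong)
      fix y
      have "(\<lambda>z. indicator H z * indicator {..<r n} (dist (y, \<phi> y) z) :: ennreal) \<in> borel_measurable lborel"
        by measurable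
      then show "(\<integral>\<^sup>+z. indicator K y * (indicator H z * indicator {..<r n} (dist (y, \<phi> y) z)) \<partial>lborel)
          = indicator K y * ennreal (m n y)"
        by (simp only: nn_integral_cmult nnm)
    qed
    also have "\<dots> = (\<integral>\<^sup>+y. ennreal (r n ^ ?D) * ennreal (indicator K y * (m n y / r n ^ ?D)) \<partial>lborel)"
      using r0[of n] by (intro nn_integral_cong) (auto simp: indicator_def ennreal_mult[symmetric] m_def)
    also have "\<dots> = ennreal (r n ^ ?D) * ennreal (I n)"
    proof -
      have "integrable lborel (\<lambda>y. indicator K y * (m n y / r n ^ ?D))"
      proof (rule Bochner_Integration.integrable_bound[OF Ki[of ?w]])
        show "AE y in lborel. norm (indicator K y * (m n y / r n ^ ?D)) \<le> norm (indicator K y * ?w)"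
          using m_le[of n] r0[of n] by (intro AE_I2) (auto simp: indicator_def m_def pos_divide_le_eq)
      qed measurable
      moreover have "0 \<le> indicator K y * (m n y / r n ^ ?D)" for y
        using r0[of n] by (simp add: m_def)
      ultimately show ?thesis unfolding I_def
        by (subst nn_integral_cmult) (auto simp: nn_integral_eq_integral)
    qed
    finally have le: "ennreal (?v * h n ^ DIM('a)) * emeasure lborel (layer n) \<le> ennreal (r n ^ ?D * I n)"
      using r0[of n] by (simp add: ennreal_mult')
    have In: "0 \<le> I n" unfolding I_def using r0[of n] by (intro integral_nonneg_AE AE_I2) (simp add: m_def)
    have "emeasure lborel (layer n) < \<infinity>"
    proof -
      have "layer n \<subseteq> {z. fst z \<in> S \<and> \<bar>snd z - \<phi> (fst z)\<bar> \<le> h n}" by (auto simp: layer_def)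
      moreover have "emeasure lborel {z. fst z \<in> S \<and> \<bar>snd z - \<phi> (fst z)\<bar> \<le> h n} < \<infinity>"
        using emeasure_graph_strip[OF \<phi>c, of S "h n"] h0[of n] emeasure_compact_finite[OF S(1)]
        by (simp add: ennreal_mult_less_top)
      moreover have "{z. fst z \<in> S \<and> \<bar>snd z - \<phi> (fst z)\<bar> \<le> h n} \<in> sets lborel"
        using graph_strip_measurable[OF \<phi>c, of S "h n"] by simp
      ultimately show ?thesis by (meson emeasure_mono le_less_trans)
    qed
    then have "emeasure lborel (layer n) = ennreal (measure lborel (layer n))"
      by (simp add: emeasure_eq_ennreal_measure less_top[symmetric])
    with le have "ennreal (?v * h n ^ DIM('a) * measure lborel (layer n)) \<le> ennreal (r n ^ ?D * I n)"
      using h0[of n] by (simp add: ennreal_mult)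
    then have "?v * h n ^ DIM('a) * measure lborel (layer n) \<le> r n ^ ?D * I n"
      using In r0[of n] by (subst (asm) ennreal_le_iff) auto
    \<comment> \<open>The dimension of the product is one more than that of the base. After the base
      powers cancel, one factor \<open>h n\<close> is left, and this is what makes the layer volume
      o(h n).\<close>
    also have "r n ^ ?D = (L + 3) ^ ?D * h n ^ DIM('a) * h n"
      by (simp add: r_def power_mult_distrib)
    finally have "h n ^ DIM('a) * (?v * measure lborel (layer n)) \<le> h n ^ DIM('a) * ((L + 3) ^ ?D * h n * I n)"
      by (simp add: mult_ac)
    then have "?v * measure lborel (layer n) \<le> (L + 3) ^ ?D * h n * I n"
      using h0[of n] by simp
    then have "real (Suc n) * (?v * measure lborel (layer n)) \<le> real (Suc n) * ((L + 3) ^ ?D * h n * I n)"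
      by (rule mult_left_mono) simp
    also have "\<dots> = (L + 3) ^ ?D * I n" by (simp add: h_def)
    finally show ?thesis using unit_ball_vol_pos[of "real DIM('a)"] by (simp add: pos_le_divide_eq mult_ac)
  qed
  have "(\<lambda>n. (L + 3) ^ ?D / ?v * I n) \<longlonglongrightarrow> (L + 3) ^ ?D / ?v * 0"
    by (intro tendsto_mult tendsto_const I0)
  then have lim: "(\<lambda>n. (L + 3) ^ ?D / ?v * I n) \<longlonglongrightarrow> 0" by simp
  have "h \<longlonglongrightarrow> 0" unfolding h_def by (rule LIMSEQ_Suc[OF lim_1_over_n])
  then have "eventually (\<lambda>n. h n < d) sequentially" using d by (rule order_tendstoD)
  then have "eventually (\<lambda>n. real (Suc n) * measure lborel (layer n) \<le> (L + 3) ^ ?D / ?v * I n) sequentially"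
    by eventually_elim (rule key, simp)
  then have "(\<lambda>n. real (Suc n) * measure lborel (layer n)) \<longlonglongrightarrow> 0"
    by (intro tendsto_sandwich[OF _ _ tendsto_const lim]) auto
  then show ?thesis by (simp add: layer_def h_def)
qed

text \<open>The two density limits of \<open>mt_outer_normal\<close>, stated over
  \<open>lborel\<close> in the coordinates in which the surface is a graph.\<close>

definition normal_limits :: "('a::euclidean_space \<times> real) set \<Rightarrow> 'a \<times> real \<Rightarrow> 'a \<times> real \<Rightarrow> bool" where
  "normal_limits F x \<nu> \<longleftrightarrow>
    ((\<lambda>r. measure lborel (ball x r \<inter> {y. \<nu> \<bullet> (y - x) \<ge> 0} \<inter> F) / r ^ DIM('a \<times> real)) \<longlongrightarrow> 0) (at_right 0) \<and>
    ((\<lambda>r. measure lborel ((ball x r \<inter> {y. \<nu> \<bullet> (y - x) \<le> 0}) - F) / r ^ DIM('a \<times> real)) \<longlongrightarrow> 0) (at_right 0)"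

lemma wrong_side_measurable:
  fixes \<phi> :: "'a::euclidean_space \<Rightarrow> real"
  assumes "continuous_on UNIV \<phi>" and F[measurable]: "F \<in> sets borel"
  shows "{z. z \<in> F \<and> snd z < \<phi> (fst z) \<or> z \<notin> F \<and> \<phi> (fst z) < snd z} \<in> sets borel"
proof -
  have [measurable]: "\<phi> \<in> borel_measurable borel" using assms(1) by (rule borel_measurable_continuous_onI)
  have [measurable]: "F \<in> sets (borel \<Otimes>\<^sub>M borel)" using F by (simp only: borel_prod)
  have "{z. z \<in> F \<and> snd z < \<phi> (fst z) \<or> z \<notin> F \<and> \<phi> (fst z) < snd z}
     = {z \<in> space (borel \<Otimes>\<^sub>M borel). z \<in> F \<and> snd z < \<phi> (fst z) \<or> z \<notin> F \<and> \<phi> (fst z) < snd z}"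
    by (simp add: space_pair_measure)
  also have "\<dots> \<in> sets (borel \<Otimes>\<^sub>M borel)" by measurable
  finally show ?thesis by (simp only: borel_prod)
qed

text \<open>The normal (P y, -1) points downwards, so \<open>F\<close> should lie above the graph. A
  point on the wrong side of the graph is either on the wrong side of the tangent plane, where the
  half-ball limits apply, or between plane and graph. By differentiability the latter region lies in
  a strip of height o(r) around the plane.\<close>

lemma density_wrong_side:
  fixes \<phi> :: "'a::euclidean_space \<Rightarrow> real"
  assumes \<phi>: "has_cont_grad \<phi> P" and F[measurable]: "F \<in> sets borel"
    and n: "normal_limits F (y, \<phi> y) (c *\<^sub>R (P y, -1))" and c: "0 < c"
  shows "((\<lambda>r. measure lborel (ball (y, \<phi> y) r \<inter>
        {z. z \<in> F \<and> snd z < \<phi> (fst z) \<or> z \<notin> F \<and> \<phi> (fst z) < snd z}) / r ^ DIM('a \<times> real)) \<longlongrightarrow> 0) (at_right 0)"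
    (is "((\<lambda>r. measure lborel (ball ?x r \<inter> ?H) / r ^ ?D) \<longlongrightarrow> 0) _")
proof -
  let ?nu = "c *\<^sub>R (P y, -1)"
  let ?A = "\<lambda>r. ball ?x r \<inter> {z. ?nu \<bullet> (z - ?x) \<ge> 0} \<inter> F"
  let ?B = "\<lambda>r. (ball ?x r \<inter> {z. ?nu \<bullet> (z - ?x) \<le> 0}) - F"
  let ?l = "\<lambda>z. \<phi> y + P y \<bullet> (z - y)"
  have lc: "continuous_on UNIV ?l" by (intro continuous_intros)
  let ?T = "\<lambda>e r. {z. fst z \<in> ball y r \<and> \<bar>snd z - ?l (fst z)\<bar> \<le> e * r}"
  let ?v = "unit_ball_vol (real DIM('a))"
  have v: "0 < ?v" by simp
  have a: "((\<lambda>r. measure lborel (?A r) / r ^ ?D) \<longlongrightarrow> 0) (at_right 0)"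
    and b: "((\<lambda>r. measure lborel (?B r) / r ^ ?D) \<longlongrightarrow> 0) (at_right 0)"
    using n by (simp_all only: normal_limits_def)
  have \<phi>c: "continuous_on UNIV \<phi>" by (rule has_cont_grad_continuous[OF \<phi>])
  have side: "?nu \<bullet> (z - ?x) = c * (?l (fst z) - snd z)" for z
    by (cases z) (simp add: algebra_simps)
  show ?thesis
  proof (rule tendstoI)
    fix e :: real assume e: "0 < e"
    \<comment> \<open>The strip of half-height s r over a ball of radius r has volume 2 s
      \<open>?v\<close> times the full power of r; this s makes it e/4 of that power, and the two
      half-balls add less than e/4 each.\<close>
    define s where "s = e / (8 * ?v)"
    have s: "0 < s" using e v by (simp add: s_def)
    obtain d where d: "0 < d" and der: "\<And>z. norm (z - y) < d \<Longrightarrow> \<bar>\<phi> z - ?l z\<bar> \<le> s * norm (z - y)"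
    proof -
      have "(\<phi> has_derivative (\<lambda>v. P y \<bullet> v)) (at y)" using \<phi> by (simp add: has_cont_grad_def)
      then obtain d where "0 < d" "\<And>z. norm (z - y) < d \<Longrightarrow> norm (\<phi> z - \<phi> y - P y \<bullet> (z - y)) \<le> s * norm (z - y)"
        using s unfolding has_derivative_at_alt by blast
      then show ?thesis by (intro that[of d]) (simp_all add: algebra_simps)
    qed
    have "eventually (\<lambda>r. measure lborel (?A r) / r ^ ?D < e / 4) (at_right 0)"
      using a e by (intro order_tendstoD) auto
    moreover have "eventually (\<lambda>r. measure lborel (?B r) / r ^ ?D < e / 4) (at_right 0)"
      using b e by (intro order_tendstoD) auto
    moreover have "eventually (\<lambda>r. r \<in> {0<..<d}) (at_right 0)"
      using d eventually_at_right_real by blast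
    ultimately show "eventually (\<lambda>r. dist (measure lborel (ball ?x r \<inter> ?H) / r ^ ?D) 0 < e) (at_right 0)"
    proof eventually_elim
      case (elim r)
      then have r: "0 < r" "r < d" by auto
      have sub: "ball ?x r \<inter> ?H \<subseteq> ?A r \<union> ?B r \<union> ?T s r"
      proof
        fix z assume z: "z \<in> ball ?x r \<inter> ?H"
        have "norm (fst z - y) \<le> dist ?x z"
          by (cases z) (simp add: dist_norm norm_Pair norm_minus_commute)
        then have nz: "norm (fst z - y) < r" using z by simp
        then have "\<bar>\<phi> (fst z) - ?l (fst z)\<bar> \<le> s * norm (fst z - y)" using r by (intro der) simp
        also have "\<dots> \<le> s * r" using nz s by (intro mult_left_mono) auto
        finally have app: "\<bar>\<phi> (fst z) - ?l (fst z)\<bar> \<le> s * r" .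
        have nb: "fst z \<in> ball y r" using nz by (simp add: dist_norm norm_minus_commute)
        show "z \<in> ?A r \<union> ?B r \<union> ?T s r"
        proof (cases "z \<in> F")
          case True
          then have lt: "snd z < \<phi> (fst z)" using z by auto
          show ?thesis
          proof (cases "snd z \<le> ?l (fst z)")
            case True
            then have "?nu \<bullet> (z - ?x) \<ge> 0" unfolding side using c by simp
            then show ?thesis using z \<open>z \<in> F\<close> by blast
          next
            case False
            then have "\<bar>snd z - ?l (fst z)\<bar> \<le> s * r" using app lt by linarith
            then show ?thesis using nb by blast
          qed
        next
          case False
          then have lt: "\<phi> (fst z) < snd z" using z by auto
          show ?thesis
          proof (cases "?l (fst z) \<le> snd z")
            case True
            then have "?nu \<bullet> (z - ?x) \<le> 0" unfolding side using c by (simp add: mult_nonneg_nonpos)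
            then show ?thesis using z \<open>z \<notin> F\<close> by blast
          next
            case False
            then have "\<bar>snd z - ?l (fst z)\<bar> \<le> s * r" using app lt by linarith
            then show ?thesis using nb by blast
          qed
        qed
      qed
      have Tm: "?T s r \<in> sets borel"
        by (rule graph_strip_measurable[OF lc]) simp
      have eT: "emeasure lborel (?T s r) = ennreal (?v * r ^ DIM('a) * (2 * (s * r)))"
        using emeasure_graph_strip[OF lc, of "ball y r" "s * r"] s r by (simp add: emeasure_ball ennreal_mult)
      have [measurable]: "{z. ?nu \<bullet> (z - ?x) \<ge> 0} \<in> sets borel" "{z. ?nu \<bullet> (z - ?x) \<le> 0} \<in> sets borel" by measurable
      have eb: "emeasure lborel (ball ?x r) < \<infinity>" using r by (simp add: emeasure_ball)
      have fA: "?A r \<in> fmeasurable lborel" and fB: "?B r \<in> fmeasurable lborel"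
        by (rule fmeasurableI2[of "ball ?x r"]; use eb in \<open>auto simp: fmeasurable_def\<close>)+
      have fT: "?T s r \<in> fmeasurable lborel" using Tm eT by (simp add: fmeasurable_def)
      have "measure lborel (ball ?x r \<inter> ?H) \<le> measure lborel (?A r \<union> ?B r \<union> ?T s r)"
        by (rule measure_mono_fmeasurable[OF sub _ fmeasurable.Un[OF fmeasurable.Un[OF fA fB] fT]])
          (use wrong_side_measurable[OF \<phi>c F] in simp)
      also have "\<dots> \<le> measure lborel (?A r \<union> ?B r) + measure lborel (?T s r)"
        by (rule measure_Un_le) (use fA fB fT in auto)
      also have "measure lborel (?A r \<union> ?B r) \<le> measure lborel (?A r) + measure lborel (?B r)"
        by (rule measure_Un_le) (use fA fB in auto)
      also have "measure lborel (?T s r) = ?v * r ^ DIM('a) * (2 * (s * r))"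
        using eT s r v by (simp add: measure_def)
      also have "\<dots> = e / 4 * r ^ ?D" using less_imp_neq[OF v] by (simp add: s_def)
      finally have "measure lborel (ball ?x r \<inter> ?H) / r ^ ?D
          \<le> (measure lborel (?A r) + measure lborel (?B r) + e / 4 * r ^ ?D) / r ^ ?D"
        using r by (intro divide_right_mono) auto
      also have "\<dots> = measure lborel (?A r) / r ^ ?D + measure lborel (?B r) / r ^ ?D + e / 4"
        using r by (simp add: add_divide_distrib)
      also have "\<dots> < e" using elim(1,2) e by linarith
      finally show ?case using r by simp
    qed
  qed
qed

text \<open>In sheared coordinates, with the graph at height 0, these are the points near the graph
  where \<open>F\<close> differs from the region above it. Height 0 is a null set and is left
  out.\<close>

definition bad_layer :: "('a::euclidean_space \<Rightarrow> real) \<Rightarrow> ('a \<times> real) set \<Rightarrow> 'a set \<Rightarrow> real \<Rightarrow> ('a \<times> real) set" where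
  "bad_layer \<phi> F S h = {z. fst z \<in> S \<and> \<bar>snd z\<bar> < h \<and>
     (snd z < 0 \<and> (fst z, \<phi> (fst z) + snd z) \<in> F \<or> 0 < snd z \<and> (fst z, \<phi> (fst z) + snd z) \<notin> F)}"

text \<open>The factor \<open>real (Suc n)\<close> is the reciprocal of the width and matches the
  size of the derivatives of the profiles, so that errors living on the bad layer vanish in the
  limit.\<close>

lemma bad_layer_tendsto_0:
  fixes \<phi> P :: "'a::euclidean_space \<Rightarrow> _"
  assumes \<phi>: "has_cont_grad \<phi> P" and L: "\<And>x. norm (P x) \<le> L" and F[measurable]: "F \<in> sets borel"
    and W: "open W" and S: "compact S" "S \<subseteq> W"
    and n: "AE y in lborel. y \<in> W \<longrightarrow> normal_limits F (y, \<phi> y) ((1 / sqrt (1 + (norm (P y))\<^sup>2)) *\<^sub>R (P y, -1))"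
  shows "(\<lambda>n. real (Suc n) * measure lborel (bad_layer \<phi> F S (1 / real (Suc n)))) \<longlonglongrightarrow> 0"
    and "bad_layer \<phi> F S h \<in> fmeasurable lborel"
proof -
  let ?H = "{z. z \<in> F \<and> snd z < \<phi> (fst z) \<or> z \<notin> F \<and> \<phi> (fst z) < snd z}"
  have \<phi>c: "continuous_on UNIV \<phi>" by (rule has_cont_grad_continuous[OF \<phi>])
  have \<phi>m[measurable]: "\<phi> \<in> borel_measurable borel" using \<phi>c by (rule borel_measurable_continuous_onI)
  have Hm: "?H \<in> sets borel" by (rule wrong_side_measurable[OF \<phi>c F])
  have [measurable]: "S \<in> sets borel" using S(1) by (simp add: borel_compact)
  have strip: "{z. fst z \<in> S \<and> \<bar>snd z - \<phi> (fst z)\<bar> < h} \<in> sets borel" for h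
  proof -
    have "{z. fst z \<in> S \<and> \<bar>snd z - \<phi> (fst z)\<bar> < h} = {z \<in> space (borel \<Otimes>\<^sub>M borel). fst z \<in> S \<and> \<bar>snd z - \<phi> (fst z)\<bar> < h}"
      by (simp add: space_pair_measure)
    also have "\<dots> \<in> sets (borel \<Otimes>\<^sub>M borel)" by measurable
    finally show ?thesis by (simp only: borel_prod)
  qed
  have lay: "{z \<in> ?H. fst z \<in> S \<and> \<bar>snd z - \<phi> (fst z)\<bar> < h} \<in> sets borel" for h
    using sets.Int[OF Hm strip[of h]] by (simp add: Int_def)
  have sh: "{z. (fst z, \<phi> (fst z) + snd z) \<in> {z \<in> ?H. fst z \<in> S \<and> \<bar>snd z - \<phi> (fst z)\<bar> < h}} = bad_layer \<phi> F S h" for h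
    by (auto simp: bad_layer_def)
  have "emeasure lborel {z \<in> ?H. fst z \<in> S \<and> \<bar>snd z - \<phi> (fst z)\<bar> < h} = emeasure lborel (bad_layer \<phi> F S h)" for h
    using emeasure_shear[OF \<phi>m lay] by (simp only: sh)
  then have me: "measure lborel {z \<in> ?H. fst z \<in> S \<and> \<bar>snd z - \<phi> (fst z)\<bar> < h} = measure lborel (bad_layer \<phi> F S h)" for h
    by (simp only: measure_def)
  have "AE y in lborel. y \<in> W \<longrightarrow>
       ((\<lambda>r. measure lborel (ball (y, \<phi> y) r \<inter> ?H) / r ^ DIM('a \<times> real)) \<longlongrightarrow> 0) (at_right 0)"
    using n
  proof eventually_elim
    case (elim y)
    have "0 < 1 / sqrt (1 + (norm (P y))\<^sup>2)" by (simp add: add_pos_nonneg)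
    then show ?case using elim density_wrong_side[OF \<phi> F] by blast
  qed
  from layer_measure_tendsto_0[OF has_cont_grad_lipschitz[OF \<phi> L] Hm W S this]
  show "(\<lambda>n. real (Suc n) * measure lborel (bad_layer \<phi> F S (1 / real (Suc n)))) \<longlonglongrightarrow> 0"
    by (simp only: me)
  have "bad_layer \<phi> F S h \<in> sets borel"
  proof -
    have "(\<lambda>z::'a\<times>real. (fst z, \<phi> (fst z) + snd z)) \<in> borel_measurable borel"
      by (simp add: borel_prod[symmetric])
    from measurable_sets[OF this lay[of h]] show ?thesis using sh[of h] by (simp add: vimage_def)
  qed
  moreover have "emeasure lborel (bad_layer \<phi> F S h) < \<infinity>"
  proof -
    have "emeasure lborel (bad_layer \<phi> F S h) \<le> emeasure lborel (S \<times> {-h..h})"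
      by (intro emeasure_mono) (auto simp: bad_layer_def)
    also have "\<dots> < \<infinity>"
      using emeasure_compact_finite[OF compact_Times[OF S(1) compact_Icc]] .
    finally show ?thesis .
  qed
  ultimately show "bad_layer \<phi> F S h \<in> fmeasurable lborel" by (simp add: fmeasurable_def)
qed

section \<open>First variation of the graph\<close>

lemma integral_Times_lborel:
  fixes a :: "'a::euclidean_space \<Rightarrow> real" and c :: "real \<Rightarrow> real"
  assumes a: "integrable lborel a" and c: "integrable lborel c"
  shows "integrable lborel (\<lambda>z. a (fst z) * c (snd z))"
    and "(LINT z|lborel. a (fst z) * c (snd z)) = (LINT y|lborel. a y) * (LINT t|lborel. c t)"
proof -
  have [measurable]: "a \<in> borel_measurable borel" "c \<in> borel_measurable borel" using a c by auto
  have i: "integrable (lborel \<Otimes>\<^sub>M lborel) (\<lambda>z. a (fst z) * c (snd z))"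
  proof (rule lborel_pair.Fubini_integrable)
    show "integrable lborel (\<lambda>x. LINT y|lborel. norm (a (fst (x, y)) * c (snd (x, y))))"
      using a by (simp add: abs_mult)
    show "AE x in lborel. integrable lborel (\<lambda>y. a (fst (x, y)) * c (snd (x, y)))"
      using c by simp
  qed simp
  then show "integrable lborel (\<lambda>z. a (fst z) * c (snd z))" by (simp add: lborel_prod)
  have "(LINT z|(lborel \<Otimes>\<^sub>M lborel). a (fst z) * c (snd z)) = (LINT x|lborel. (LINT y|lborel. a x * c y))"
    using lborel_pair.integral_fst'[OF i] by simp
  then show "(LINT z|lborel. a (fst z) * c (snd z)) = (LINT y|lborel. a y) * (LINT t|lborel. c t)"
    by (simp add: lborel_prod)
qed

lemma integral_shear_lborel:
  fixes f :: "'a::euclidean_space \<Rightarrow> real" and h :: "'a \<times> real \<Rightarrow> real"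
  assumes [measurable]: "f \<in> borel_measurable borel" "h \<in> borel_measurable borel"
  shows "(LINT z|lborel. h z) = (LINT z|lborel. h (fst z, f (fst z) + snd z))"
    and "integrable lborel h \<Longrightarrow> integrable lborel (\<lambda>z. h (fst z, f (fst z) + snd z))"
proof -
  have [measurable]: "(\<lambda>z::'a\<times>real. (fst z, f (fst z) + snd z)) \<in> borel_measurable borel"
    by (simp add: borel_prod[symmetric])
  have "(LINT z|lborel. h z) = (LINT z|distr lborel borel (\<lambda>z. (fst z, f (fst z) + snd z)). h z)"
    by (simp add: distr_lborel_shear)
  also have "\<dots> = (LINT z|lborel. h (fst z, f (fst z) + snd z))"
    by (rule integral_distr) measurable
  finally show "(LINT z|lborel. h z) = (LINT z|lborel. h (fst z, f (fst z) + snd z))" .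
  assume "integrable lborel h"
  then have "integrable (distr lborel borel (\<lambda>z. (fst z, f (fst z) + snd z))) h"
    by (simp add: distr_lborel_shear)
  then show "integrable lborel (\<lambda>z. h (fst z, f (fst z) + snd z))"
    by (subst (asm) integrable_distr_eq) auto
qed

text \<open>The squared positive part is C^1. All truncations below are built from it: the profiles,
  the bumps and the cutoffs.\<close>

lemma has_real_derivative_pos_sq:
  "((\<lambda>x. (max 0 x)\<^sup>2) has_real_derivative 2 * max 0 x) (at (x::real))"
proof (cases "x = 0")
  case True
  have "((\<lambda>h. (max 0 h)\<^sup>2 / h) \<longlongrightarrow> 0) (at (0::real))"
  proof (rule Lim_null_comparison)
    show "eventually (\<lambda>h. norm ((max 0 h)\<^sup>2 / h) \<le> \<bar>h\<bar>) (at (0::real))"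
      by (intro always_eventually allI) (auto simp: max_def power2_eq_square)
    show "((\<lambda>h. \<bar>h\<bar>) \<longlongrightarrow> 0) (at (0::real))" using tendsto_rabs[of "\<lambda>h. h" 0 "at (0::real)"] by simp
  qed
  then show ?thesis using True by (simp add: DERIV_def)
next
  case False
  show ?thesis
  proof (cases "x > 0")
    case True
    have "((\<lambda>x. x\<^sup>2) has_real_derivative 2 * x) (at x)" by (auto intro!: derivative_eq_intros)
    moreover have "eventually (\<lambda>y. y\<^sup>2 = (max 0 y)\<^sup>2) (nhds x)"
      using eventually_nhds_in_open[of "{0<..}" x] True by (auto elim!: eventually_mono)
    ultimately show ?thesis using True by (subst DERIV_cong_ev[OF refl _ refl, symmetric]) (auto simp: max_def)
  next
    case False
    then have x: "x < 0" using \<open>x \<noteq> 0\<close> by simp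
    have "((\<lambda>x. 0) has_real_derivative 0) (at x)" by simp
    moreover have "eventually (\<lambda>y. 0 = (max 0 y)\<^sup>2) (nhds x)"
      using eventually_nhds_in_open[of "{..<0}" x] x by (auto elim!: eventually_mono)
    ultimately have "((\<lambda>x. (max 0 x)\<^sup>2) has_real_derivative 0) (at x)"
      by (subst (asm) DERIV_cong_ev[OF refl _ refl])
    then show ?thesis using x by simp
  qed
qed

lemma DERIV_pos_sq_compose:
  assumes "(u has_real_derivative u') (at t)"
  shows "((\<lambda>t. (max 0 (u t))\<^sup>2) has_real_derivative 2 * max 0 (u t) * u') (at t)"
  using DERIV_chain2[OF has_real_derivative_pos_sq assms] .

lemma integral_indicator_FTC:
  fixes h h' :: "real \<Rightarrow> real"
  assumes "0 < e" and d: "\<And>t. (h has_real_derivative h' t) (at t)" and c: "continuous_on UNIV h'"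
    and z: "\<And>t. e \<le> t \<Longrightarrow> h t = 0" "\<And>t. e \<le> t \<Longrightarrow> h' t = 0"
  shows "integrable lborel (\<lambda>t. indicator {0<..} t * h' t)"
    and "(LINT t|lborel. indicator {0<..} t * h' t) = - h 0"
proof -
  have [measurable]: "h' \<in> borel_measurable borel" using c by (rule borel_measurable_continuous_onI)
  have "isCont h' t" for t using c by (simp add: continuous_on_eq_continuous_at)
  then have *: "has_bochner_integral lborel (\<lambda>t. h' t * indicator {0..e} t) (h e - h 0)"
    using has_bochner_integral_FTC_Icc_real[of 0 e h h'] d \<open>0 < e\<close> by simp
  have ae: "AE t in lborel. h' t * indicator {0..e} t = indicator {0<..} t * h' t"
    using AE_lborel_singleton[of 0] by eventually_elim (use z(2) in \<open>auto simp: indicator_def\<close>)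
  have "has_bochner_integral lborel (\<lambda>t. indicator {0<..} t * h' t) (h e - h 0)"
    using has_bochner_integral_cong_AE[OF _ _ ae, THEN iffD1, OF _ _ *] by simp
  then show "integrable lborel (\<lambda>t. indicator {0<..} t * h' t)" "(LINT t|lborel. indicator {0<..} t * h' t) = - h 0"
    using z(1)[of e] by (auto simp: has_bochner_integral_iff)
qed

text \<open>\<open>f\<close> is the profile of the scalar test function across the graph, \<open>k\<close> that of the field tested against
  \<open>\<chi>\<^sub>F\<close>. The jump of \<open>\<chi>\<^sub>F\<close> across the graph is detected through \<open>k 0 = 1\<close>, the integral of \<open>-k'\<close> over \<open>t > 0\<close>.\<close>
lemma profiles:
  fixes e d :: real
  assumes d: "0 < d" "d \<le> e"
  obtains f f' k k' :: "real \<Rightarrow> real" where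
    "\<And>t. (f has_real_derivative f' t) (at t)" "continuous_on UNIV f'"
    "\<And>t. (k has_real_derivative k' t) (at t)" "continuous_on UNIV k'"
    "\<And>t. 0 \<le> k t" "\<And>t. k t \<le> f t" "\<And>t. t \<le> - d \<Longrightarrow> f t = 0" "\<And>t. t \<le> - d \<Longrightarrow> f' t = 0"
    "\<And>t. 0 \<le> t \<Longrightarrow> f t = (max 0 (1 - t / e))\<^sup>2" "\<And>t. 0 \<le> t \<Longrightarrow> f' t = - (2 / e) * max 0 (1 - t / e)"
    "\<And>t. f t \<le> 4" "\<And>t. t \<le> 0 \<Longrightarrow> \<bar>f' t\<bar> \<le> 20 / d"
    "\<And>t. d \<le> \<bar>t\<bar> \<Longrightarrow> k t = 0" "\<And>t. d \<le> \<bar>t\<bar> \<Longrightarrow> k' t = 0" "\<And>t. \<bar>k' t\<bar> \<le> 20 / d" "k 0 = 1"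
proof -
  have e: "0 < e" using d by simp
  \<comment> \<open>\<open>b\<close> decays upwards on the scale e; \<open>B\<close> equals 1 for t
    \<ge> 0 and cuts off at depth d; \<open>a\<close> is a two-sided bump of width d. The profiles
    are f = b B and k = b a, and k \<le> f because a \<le> B.\<close>
  define b where "b t = (max 0 (1 - t / e))\<^sup>2" for t
  define b' where "b' t = - (2 / e) * max 0 (1 - t / e)" for t
  define B where "B t = (max 0 (1 - (max 0 (- t / d))\<^sup>2))\<^sup>2" for t
  define B' where "B' t = (4 / d) * max 0 (1 - (max 0 (- t / d))\<^sup>2) * max 0 (- t / d)" for t
  define a where "a t = (max 0 (1 - (t / d)\<^sup>2))\<^sup>2" for t
  define a' where "a' t = - (4 / d) * max 0 (1 - (t / d)\<^sup>2) * (t / d)" for t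
  have bd: "(b has_real_derivative b' t) (at t)" for t
    unfolding b_def[abs_def] b'_def
    by (rule DERIV_pos_sq_compose[THEN DERIV_cong]) (use e in \<open>auto intro!: derivative_eq_intros\<close>)
  have Bd: "(B has_real_derivative B' t) (at t)" for t
    unfolding B_def[abs_def] B'_def
    by (rule DERIV_pos_sq_compose[THEN DERIV_cong], rule DERIV_diff, rule DERIV_const, rule DERIV_pos_sq_compose)
      (use d in \<open>auto intro!: derivative_eq_intros\<close>)
  have ad: "(a has_real_derivative a' t) (at t)" for t
    unfolding a_def[abs_def] a'_def
    by (rule DERIV_pos_sq_compose[THEN DERIV_cong]) (use d in \<open>auto intro!: derivative_eq_intros simp: power2_eq_square\<close>)
  have b0: "0 \<le> b t" "b' t \<le> 0" for t using e by (auto simp: b_def b'_def mult_nonneg_nonpos)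
  have bb: "b t \<le> 4" "\<bar>b' t\<bar> \<le> 4 / e" if "- d \<le> t" for t
  proof -
    have "- t / e \<le> 1" using divide_right_mono[of "- t" e e] that d e by simp
    then have m: "max 0 (1 - t / e) \<le> 2" by simp
    then show "b t \<le> 4" unfolding b_def using power_mono[of "max 0 (1 - t / e)" 2 2] by simp
    have "(2 / e) * max 0 (1 - t / e) \<le> (2 / e) * 2" using m e by (intro mult_left_mono) auto
    then show "\<bar>b' t\<bar> \<le> 4 / e" using e by (simp add: b'_def abs_mult)
  qed
  have le1: "max 0 (1 - x\<^sup>2) \<le> 1" for x :: real by simp
  have B0: "0 \<le> B t" "B t \<le> 1" for t
    using power_mono[OF le1, of "max 0 (- t / d)" 2] by (simp_all add: B_def)
  have a0: "0 \<le> a t" "a t \<le> 1" for t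
    using power_mono[OF le1, of "t / d" 2] by (simp_all add: a_def)
  have aB: "a t \<le> B t" for t
  proof (cases "t \<le> 0")
    case True
    then show ?thesis using d by (simp add: a_def B_def max_absorb2 divide_nonpos_pos)
  next
    case False
    then have "B t = 1" using d by (simp add: B_def max_absorb1)
    then show ?thesis using a0 by simp
  qed
  have out: "max 0 (1 - x\<^sup>2) = 0" if "1 \<le> \<bar>x\<bar>" for x :: real
    using power_mono[OF that, of 2] by simp
  have small: "max 0 (1 - x\<^sup>2) * \<bar>x\<bar> \<le> 1" for x :: real
  proof (cases "1 \<le> \<bar>x\<bar>")
    case False
    then have "max 0 (1 - x\<^sup>2) * \<bar>x\<bar> \<le> 1 * 1" by (intro mult_mono le1) auto
    then show ?thesis by simp
  qed (simp add: out)
  have a'b: "\<bar>a' t\<bar> \<le> 4 / d" for t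
  proof -
    have "\<bar>a' t\<bar> = (4 / d) * (max 0 (1 - (t / d)\<^sup>2) * \<bar>t / d\<bar>)"
      using d by (simp add: a'_def abs_mult)
    also have "\<dots> \<le> (4 / d) * 1" by (rule mult_left_mono[OF small]) (use d in simp)
    finally show ?thesis by simp
  qed
  have B'b: "\<bar>B' t\<bar> \<le> 4 / d" for t
  proof -
    have "\<bar>B' t\<bar> = (4 / d) * (max 0 (1 - (max 0 (- t / d))\<^sup>2) * \<bar>max 0 (- t / d)\<bar>)"
      using d by (simp add: B'_def abs_mult)
    also have "\<dots> \<le> (4 / d) * 1" by (rule mult_left_mono[OF small]) (use d in simp)
    finally show ?thesis by simp
  qed
  have ed: "4 / e \<le> 4 / d" using d by (intro divide_left_mono) auto
  \<comment> \<open>For t \<ge> - d \<ge> - e one has 1 - t/e \<le> 2, hence b \<le> 4 and |b'|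
    \<le> 4/e \<le> 4/d. The product rule then gives at most 4/d + 4 (4/d) = 20/d.\<close>
  have prod: "\<bar>b' t * x + b t * x'\<bar> \<le> 20 / d" if "- d \<le> t" "0 \<le> x" "x \<le> 1" "\<bar>x'\<bar> \<le> 4 / d" for t x x'
  proof -
    have "\<bar>b' t * x\<bar> \<le> (4 / e) * 1" unfolding abs_mult using bb[OF that(1)] that e by (intro mult_mono) auto
    moreover have "\<bar>b t * x'\<bar> \<le> 4 * (4 / d)" unfolding abs_mult using bb[OF that(1)] that b0 by (intro mult_mono) auto
    moreover have "\<bar>b' t * x + b t * x'\<bar> \<le> \<bar>b' t * x\<bar> + \<bar>b t * x'\<bar>" by (rule abs_triangle_ineq)
    ultimately show ?thesis using ed by (simp add: field_simps)
  qed
  have Bz: "B t = 0" "B' t = 0" if "t \<le> - d" for t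
  proof -
    have "1 \<le> - t / d" using divide_right_mono[of d "- t" d] that d by simp
    then have "1 \<le> \<bar>max 0 (- t / d)\<bar>" by linarith
    then show "B t = 0" "B' t = 0" unfolding B_def B'_def by (simp_all only: out) simp_all
  qed
  have az: "a t = 0" "a' t = 0" if "d \<le> \<bar>t\<bar>" for t
  proof -
    have "1 \<le> \<bar>t / d\<bar>" using that d by simp
    then show "a t = 0" "a' t = 0" unfolding a_def a'_def by (simp_all only: out) simp_all
  qed
  have B1: "B t = 1" "B' t = 0" if "0 \<le> t" for t
    using that d by (simp_all add: B_def B'_def max_absorb1)
  have cont: "continuous_on UNIV b" "continuous_on UNIV b'" "continuous_on UNIV B" "continuous_on UNIV B'"
     "continuous_on UNIV a" "continuous_on UNIV a'"
    unfolding b_def[abs_def] b'_def[abs_def] B_def[abs_def] B'_def[abs_def] a_def[abs_def] a'_def[abs_def]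
    using d e by (auto intro!: continuous_intros)
  show ?thesis
  proof (rule that[of "\<lambda>t. b t * B t" "\<lambda>t. b' t * B t + b t * B' t" "\<lambda>t. b t * a t" "\<lambda>t. b' t * a t + b t * a' t"])
    show "((\<lambda>t. b t * B t) has_real_derivative b' t * B t + b t * B' t) (at t)" for t
      using DERIV_mult[OF bd Bd] by (simp add: algebra_simps)
    show "((\<lambda>t. b t * a t) has_real_derivative b' t * a t + b t * a' t) (at t)" for t
      using DERIV_mult[OF bd ad] by (simp add: algebra_simps)
    show "continuous_on UNIV (\<lambda>t. b' t * B t + b t * B' t)" "continuous_on UNIV (\<lambda>t. b' t * a t + b t * a' t)"
      using cont by (auto intro!: continuous_intros)
    show "0 \<le> b t * a t" "b t * a t \<le> b t * B t" for t
      using b0 a0 aB by (auto intro!: mult_left_mono)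
    show "b t * B t = 0" "b' t * B t + b t * B' t = 0" if "t \<le> - d" for t using Bz[OF that] by simp_all
    show "b t * B t = (max 0 (1 - t / e))\<^sup>2" "b' t * B t + b t * B' t = - (2 / e) * max 0 (1 - t / e)"
      if "0 \<le> t" for t using B1[OF that] by (simp_all add: b_def b'_def)
    show "b t * B t \<le> 4" for t
    proof (cases "t \<le> - d")
      case False
      then have "b t * B t \<le> 4 * 1" using bb[of t] B0 b0 by (intro mult_mono) auto
      then show ?thesis by simp
    qed (simp add: Bz)
    show "\<bar>b' t * B t + b t * B' t\<bar> \<le> 20 / d" for t
    proof (cases "t \<le> - d")
      case True
      then show ?thesis using d Bz by simp
    next
      case False
      then show ?thesis by (intro prod B0 B'b) simp
    qed
    show "b t * a t = 0" "b' t * a t + b t * a' t = 0" if "d \<le> \<bar>t\<bar>" for t using az[OF that] by simp_all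
    show "\<bar>b' t * a t + b t * a' t\<bar> \<le> 20 / d" for t
    proof (cases "t \<le> - d")
      case True
      then have "d \<le> \<bar>t\<bar>" by simp
      then show ?thesis using d az by simp
    next
      case False
      then show ?thesis by (intro prod a0 a'b) simp
    qed
    show "b 0 * a 0 = 1" by (simp add: b_def a_def)
  qed
qed

text \<open>Expansion of the square root around \<open>g c \<surd>(1 + |P|\<^sup>2)\<close>; the quadratic error is controlled by
  \<open>|q|\<^sup>2 \<le> M g\<close>.\<close>
lemma grad_norm_le:
  fixes q P :: "'a::euclidean_space"
  assumes g: "0 \<le> g" and q: "(norm q)\<^sup>2 \<le> M * g" and c: "0 \<le> c" and f: "0 \<le> f" "f\<^sup>2 \<le> e / 2 * c" and e: "0 < e" and M: "0 \<le> M"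
  shows "norm (f *\<^sub>R q + (g * c) *\<^sub>R P, - (g * c))
    \<le> g * c * sqrt (1 + (norm P)\<^sup>2) + f * (q \<bullet> P / sqrt (1 + (norm P)\<^sup>2)) + e * M / 4"
proof -
  let ?w = "sqrt (1 + (norm P)\<^sup>2)"
  have w: "1 \<le> ?w" by simp
  have w2: "?w\<^sup>2 = 1 + (norm P)\<^sup>2" by (simp add: add_nonneg_nonneg)
  show ?thesis
  proof (cases "g * c = 0")
    \<comment> \<open>The expansion would divide by g c. If g = 0 then q = 0, and if c = 0 then f =
      0, so the left-hand side vanishes.\<close>
    case True
    have "f *\<^sub>R q = 0"
    proof (cases "g = 0")
      case True
      then have "(norm q)\<^sup>2 \<le> 0" using q by simp
      then show ?thesis by simp
    next
      case False
      then have "c = 0" using True by simp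
      then show ?thesis using f by simp
    qed
    then have "f * (q \<bullet> P) = 0" by auto
    then have 1: "f * (q \<bullet> P / ?w) = 0" by simp
    have 2: "g * c * ?w = 0" using True by simp
    have "f *\<^sub>R q + (g * c) *\<^sub>R P = 0" using True \<open>f *\<^sub>R q = 0\<close> by auto
    then have 3: "norm (f *\<^sub>R q + (g * c) *\<^sub>R P, - (g * c)) = 0" using True by (simp only: norm_Pair) simp
    have "0 \<le> e * M / 4" using e M by simp
    then show ?thesis unfolding 1 2 3 by simp
  next
    case False
    then have gc: "0 < g * c" using g c by (simp add: less_le)
    then have pos: "0 < g" "0 < c" using g c by (auto simp: zero_less_mult_iff)
    let ?v = "(f *\<^sub>R q + (g * c) *\<^sub>R P, - (g * c))"
    let ?b = "g * c * ?w"
    have b: "0 < ?b" by (rule mult_pos_pos[OF gc less_le_trans[OF zero_less_one w]])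
    have "(norm ?v)\<^sup>2 = ?v \<bullet> ?v" by (rule power2_norm_eq_inner)
    also have "\<dots> = f\<^sup>2 * (norm q)\<^sup>2 + 2 * f * (g * c) * (q \<bullet> P) + (g * c)\<^sup>2 * (norm P)\<^sup>2 + (g * c)\<^sup>2"
      by (simp add: dot_square_norm[of q] dot_square_norm[of P] inner_add_left inner_add_right inner_commute[of P q] power2_eq_square algebra_simps)
    also have "\<dots> = f\<^sup>2 * (norm q)\<^sup>2 + 2 * f * (g * c) * (q \<bullet> P) + ?b\<^sup>2"
      unfolding power_mult_distrib w2 by (simp add: algebra_simps)
    finally have n2: "(norm ?v)\<^sup>2 = f\<^sup>2 * (norm q)\<^sup>2 + 2 * f * (g * c) * (q \<bullet> P) + ?b\<^sup>2" .
    have "f\<^sup>2 * (norm q)\<^sup>2 \<le> (e / 2 * c) * (M * g)"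
      using f q c e by (intro mult_mono) auto
    also have "\<dots> \<le> (e / 2 * c) * (M * g) * ?w"
      using mult_left_mono[OF w, of "(e / 2 * c) * (M * g)"] e c M g by simp
    finally have fq: "f\<^sup>2 * (norm q)\<^sup>2 \<le> e * M / 2 * ?b" by (simp add: algebra_simps)
    \<comment> \<open>This bounds the square root from above by its tangent at \<open>?b\<close>
      squared. The term f^2 |q|^2 is at most e M / 2 times \<open>?b\<close>; division by 2
      \<open>?b\<close> leaves e M / 4.\<close>
    have "0 \<le> (norm ?v - ?b)\<^sup>2" by simp
    then have "2 * norm ?v * ?b \<le> (norm ?v)\<^sup>2 + ?b\<^sup>2" by (simp add: power2_diff)
    also have "\<dots> \<le> e * M / 2 * ?b + 2 * f * (g * c) * (q \<bullet> P) + 2 * ?b\<^sup>2"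
      unfolding n2 using fq by simp
    also have "\<dots> = 2 * (?b + f * (q \<bullet> P / ?w) + e * M / 4) * ?b"
    proof -
      have "1 + norm P * norm P \<noteq> 0" using add_pos_nonneg[of 1 "norm P * norm P"] by simp
      then show ?thesis by (simp add: power2_eq_square algebra_simps)
    qed
    finally have "2 * norm ?v \<le> 2 * (?b + f * (q \<bullet> P / ?w) + e * M / 4)"
      by (rule mult_right_le_imp_le[OF _ b])
    then show ?thesis by (rule mult_left_le_imp_le) simp
  qed
qed

lemma AE_snd_neq_0: "AE z in (lborel :: ('a::euclidean_space \<times> real) measure). snd z \<noteq> 0"
proof (rule AE_I'[of "UNIV \<times> {0}"])
  have "(UNIV :: 'a set) \<times> {0::real} \<in> sets borel" by (rule borel_Times) auto
  then show "(UNIV :: 'a set) \<times> {0::real} \<in> null_sets lborel"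
    using emeasure_lborel_Times[of "UNIV :: 'a set" "{0}"] by (simp add: null_sets_def)
qed auto

lemma compact_supp_in:
  assumes "{x. f x \<noteq> 0} \<subseteq> K" "compact K" shows "compact (supp f)"
proof -
  have "supp f \<subseteq> K" by (rule closure_minimal[OF assms(1) compact_imp_closed[OF assms(2)]])
  then show ?thesis using compact_Int_closed[OF assms(2) closed_closure, of "{x. f x \<noteq> 0}"] by (simp only: inf_absorb2)
qed

lemma has_cont_grad_fst:
  assumes "has_cont_grad g q"
  shows "has_cont_grad (\<lambda>z::'a::euclidean_space \<times> real. g (fst z)) (\<lambda>z. (q (fst z), 0))"
  unfolding has_cont_grad_def
proof (intro conjI allI)
  fix z :: "'a \<times> real"
  have "(g has_derivative (\<lambda>v. q (fst z) \<bullet> v)) (at (fst z))" using assms by (simp add: has_cont_grad_def)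
  from has_derivative_compose[OF has_derivative_fst[OF has_derivative_ident] this, of UNIV]
  show "((\<lambda>z. g (fst z)) has_derivative (\<lambda>v. (q (fst z), 0) \<bullet> v)) (at z)"
    by (simp add: inner_prod_def)
  have "continuous_on UNIV q" using assms by (simp add: has_cont_grad_def)
  from continuous_on_compose2[OF this continuous_on_fst[OF continuous_on_id] subset_UNIV]
  show "continuous_on UNIV (\<lambda>z::'a \<times> real. (q (fst z), 0))" by (intro continuous_intros) auto
qed

lemma has_cont_grad_height:
  assumes "has_cont_grad \<phi> P"
  shows "has_cont_grad (\<lambda>z::'a::euclidean_space \<times> real. snd z - \<phi> (fst z)) (\<lambda>z. (- P (fst z), 1))"
  unfolding has_cont_grad_def
proof (intro conjI allI)
  fix z :: "'a \<times> real"
  have "((\<lambda>z. \<phi> (fst z)) has_derivative (\<lambda>v. (P (fst z), 0) \<bullet> v)) (at z)"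
    using has_cont_grad_fst[OF assms] by (simp only: has_cont_grad_def)
  from has_derivative_diff[OF has_derivative_snd[OF has_derivative_ident] this]
  show "((\<lambda>z. snd z - \<phi> (fst z)) has_derivative (\<lambda>v. (- P (fst z), 1) \<bullet> v)) (at z)"
    by (simp add: inner_prod_def)
  have "continuous_on UNIV P" using assms by (simp add: has_cont_grad_def)
  from continuous_on_compose2[OF this continuous_on_fst[OF continuous_on_id] subset_UNIV]
  show "continuous_on UNIV (\<lambda>z::'a \<times> real. (- P (fst z), 1))" by (intro continuous_intros) auto
qed

lemma has_cont_deriv_fst:
  fixes m :: "'a::euclidean_space \<Rightarrow> 'c::euclidean_space"
  assumes "has_cont_deriv m D"
  shows "has_cont_deriv (\<lambda>z::'a \<times> real. m (fst z)) (\<lambda>z v. D (fst z) (fst v))"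
  unfolding has_cont_deriv_def
proof (intro conjI allI)
  fix z :: "'a \<times> real"
  have "(m has_derivative D (fst z)) (at (fst z))" using assms by (simp add: has_cont_deriv_def)
  from has_derivative_compose[OF has_derivative_fst[OF has_derivative_ident] this, of UNIV]
  show "((\<lambda>z. m (fst z)) has_derivative (\<lambda>v. D (fst z) (fst v))) (at z)" by simp
  fix v :: "'a \<times> real"
  have "continuous_on UNIV (\<lambda>y. D y (fst v))" using assms by (simp add: has_cont_deriv_def)
  from continuous_on_compose2[OF this continuous_on_fst[OF continuous_on_id] subset_UNIV]
  show "continuous_on UNIV (\<lambda>z::'a \<times> real. D (fst z) (fst v))" .
qed

text \<open>The antiderivative is a cubed positive part, written as 1 - t/e times the square so that
  the derivative of the squared positive part is enough.\<close>

lemma integral_pos_part_sq: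
  fixes e :: real
  assumes e: "0 < e"
  shows "integrable lborel (\<lambda>t. indicator {0<..} t * (max 0 (1 - t / e))\<^sup>2)"
    and "(LINT t|lborel. indicator {0<..} t * (max 0 (1 - t / e))\<^sup>2) = e / 3"
proof -
  let ?h = "\<lambda>t. - (e / 3) * ((1 - t / e) * (max 0 (1 - t / e))\<^sup>2)"
  have d: "(?h has_real_derivative (max 0 (1 - t / e))\<^sup>2) (at t)" for t
  proof -
    have 1: "((\<lambda>t. 1 - t / e) has_real_derivative - (1 / e)) (at t)"
      using e by (auto intro!: derivative_eq_intros)
    have m: "(1 - t / e) * max 0 (1 - t / e) = (max 0 (1 - t / e))\<^sup>2"
      by (simp add: max_def power2_eq_square)
    have "(?h has_real_derivative - (e / 3) * (- (1 / e) * (max 0 (1 - t / e))\<^sup>2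
        + 2 * max 0 (1 - t / e) * - (1 / e) * (1 - t / e))) (at t)"
      by (rule DERIV_cmult[OF DERIV_mult[OF 1 DERIV_pos_sq_compose[OF 1]]])
    moreover have "- (e / 3) * (- (1 / e) * (max 0 (1 - t / e))\<^sup>2
        + 2 * max 0 (1 - t / e) * - (1 / e) * (1 - t / e)) = (1/3) * ((max 0 (1 - t / e))\<^sup>2 + 2 * ((1 - t / e) * max 0 (1 - t / e)))"
      using e by (simp add: field_simps)
    ultimately show ?thesis unfolding m by simp
  qed
  have z: "max 0 (1 - t / e) = 0" if "e \<le> t" for t using that e by (simp add: max_def)
  have c: "continuous_on UNIV (\<lambda>t. (max 0 (1 - t / e))\<^sup>2)" using e by (intro continuous_intros) auto
  show "integrable lborel (\<lambda>t. indicator {0<..} t * (max 0 (1 - t / e))\<^sup>2)"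
    by (rule integral_indicator_FTC(1)[OF e d c]) (simp_all add: z)
  show "(LINT t|lborel. indicator {0<..} t * (max 0 (1 - t / e))\<^sup>2) = e / 3"
    by (subst integral_indicator_FTC(2)[OF e d c]) (simp_all add: z)
qed

text \<open>The layer \<open>t < 0\<close> contributes only through \<open>bad_layer\<close>, while for \<open>t > 0\<close> the indicator of \<open>F\<close>
  may be dropped from the right-hand side.\<close>
lemma perimeter_bound_layer:
  fixes \<phi> g :: "'a::euclidean_space \<Rightarrow> real" and m :: "'a \<Rightarrow> 'a \<times> real"
  assumes \<phi>: "has_cont_grad \<phi> P" and F[measurable]: "F \<in> sets borel" and cal: "perimeter_bound_borel F C" and C0: "0 \<le> C"
    and g: "has_cont_grad g q" and g0: "\<And>y. 0 \<le> g y" and sg: "compact (supp g)"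
    and M: "0 \<le> M" and qM: "\<And>y. (norm (q y))\<^sup>2 \<le> M * g y"
    and m: "has_cont_deriv m Dm" and m1: "\<And>y. y \<in> supp g \<Longrightarrow> norm (m y) \<le> 1"
    and badm: "\<And>h. bad_layer \<phi> F (supp g) h \<in> fmeasurable lborel"
    and e: "0 < e"
  obtains a where "\<And>d. 0 < d \<Longrightarrow> d \<le> e \<Longrightarrow> d \<le> 1 \<Longrightarrow>
    (LINT y|lborel. g y * (m y \<bullet> (P y, -1))) \<le>
      (LINT y|lborel. g y * sqrt (1 + (norm (P y))\<^sup>2))
      + e / 3 * ((LINT y|lborel. q y \<bullet> P y / sqrt (1 + (norm (P y))\<^sup>2)) + C * (LINT y|lborel. g y))
      + e\<^sup>2 * M / 4 * measure lborel (supp g)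
      + a * (d + measure lborel (bad_layer \<phi> F (supp g) d) / d)"
proof -
  define S where "S = supp g"
  have sS: "compact S" using sg by (simp only: S_def)
  have m1S: "norm (m y) \<le> 1" if "y \<in> S" for y using m1 that unfolding S_def by blast
  have badS: "bad_layer \<phi> F S h \<in> fmeasurable lborel" for h using badm unfolding S_def .
  define w where "w y = sqrt (1 + (norm (P y))\<^sup>2)" for y
  define T where "T y = q y \<bullet> P y / w y" for y
  define v where "v y = m y \<bullet> (P y, -1)" for y
  define dm where "dm y = (\<Sum>b\<in>Basis. Dm y (fst b) \<bullet> b)" for y
  \<comment> \<open>Collects what the divergence of the field contains without k': in sheared
    coordinates the divergence is k A - k' g v. As A is bounded and k lives on |t| < d, the first
    term integrates to O(d).\<close>
  define A where "A y = g y * dm y + q y \<bullet> fst (m y)" for y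
  have Pc: "continuous_on UNIV P" and qc: "continuous_on UNIV q" using \<phi> g by (simp_all add: has_cont_grad_def)
  have \<phi>c: "continuous_on UNIV \<phi>" and gc: "continuous_on UNIV g"
    using has_cont_grad_continuous \<phi> g by blast+
  have mc: "continuous_on UNIV m" by (rule has_cont_deriv_continuous[OF m])
  have w0: "0 < w y" for y unfolding w_def by (simp add: add_pos_nonneg)
  have wc: "continuous_on UNIV w" unfolding w_def[abs_def] by (intro continuous_intros Pc)
  have Tc: "continuous_on UNIV T" unfolding T_def[abs_def]
    using w0 by (intro continuous_intros Pc qc wc) (auto simp: less_le)
  have vc: "continuous_on UNIV v" unfolding v_def[abs_def] by (intro continuous_intros Pc mc)
  have dmc: "continuous_on UNIV dm"
    using m unfolding dm_def[abs_def] has_cont_deriv_def by (intro continuous_intros) auto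
  have Ac: "continuous_on UNIV A" unfolding A_def[abs_def] by (intro continuous_intros gc dmc qc mc)
  have gz: "g y = 0" if "y \<notin> S" for y using that unfolding S_def by (rule not_in_supp)
  have qz: "q y = 0" if "y \<notin> S" for y using has_cont_grad_off_supp[OF g] that unfolding S_def .
  obtain a0 where a0: "0 < a0" "\<And>y. norm (A y) \<le> a0"
    by (rule bounded_off_compact[OF Ac sS]) (simp_all add: A_def gz qz)
  have gvc: "continuous_on UNIV (\<lambda>y. g y * v y)" by (intro continuous_intros gc vc)
  obtain a1 where a1: "0 < a1" "\<And>y. norm (g y * v y) \<le> a1"
    by (rule bounded_off_compact[OF gvc sS]) (simp_all add: gz)
  obtain a2 where a2: "0 < a2" "\<And>y. norm (q y) \<le> a2"
    by (rule bounded_off_compact[OF qc sS]) (simp_all add: qz)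
  have gPc: "continuous_on UNIV (\<lambda>y. g y * (norm (P y) + 1))" by (intro continuous_intros gc Pc)
  obtain a3 where a3: "0 < a3" "\<And>y. norm (g y * (norm (P y) + 1)) \<le> a3"
    by (rule bounded_off_compact[OF gPc sS]) (simp_all add: gz)
  obtain a5 where a5: "0 < a5" "\<And>y. norm (g y) \<le> a5"
    by (rule bounded_off_compact[OF gc sS]) (simp_all add: gz)
  obtain a6 where a6: "0 < a6" "\<And>y. y \<in> S \<Longrightarrow> \<bar>\<phi> y\<bar> \<le> a6"
  proof -
    have "compact (\<phi> ` S)" using compact_continuous_image[OF continuous_on_subset[OF \<phi>c] sS] by simp
    then obtain B where "0 < B" "\<forall>x\<in>\<phi> ` S. norm x \<le> B"
      using compact_imp_bounded bounded_pos by metis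
    then show ?thesis by (intro that[of B]) (simp_all only: ball_simps real_norm_def)
  qed
  \<comment> \<open>Bound for the right-hand integrand below the graph, multiplied by d: 4
    \<open>a2\<close> comes from f |q|, 20 \<open>a3\<close> from |f'| g (|P| + 1), and 4 C
    \<open>a5\<close> from C g f. The hypothesis d \<le> 1 allows all three to be divided by
    d.\<close>
  define a4 where "a4 = 4 * a2 + 20 * a3 + 4 * C * a5"
  define F' where "F' = {z. (fst z, \<phi> (fst z) + snd z) \<in> F}"
  have \<phi>m[measurable]: "\<phi> \<in> borel_measurable borel" using \<phi>c by (rule borel_measurable_continuous_onI)
  have Sm[measurable]: "S \<in> sets borel" using sS by (simp add: borel_compact)
  have Sfin: "emeasure lborel S < \<infinity>" using emeasure_compact_finite[OF sS] .
  have iS: "integrable lborel (indicator S :: 'a \<Rightarrow> real)" using Sfin by simp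
  have int_off: "integrable lborel h" if "continuous_on UNIV h" "\<And>y. y \<notin> S \<Longrightarrow> h y = 0" for h :: "'a \<Rightarrow> real"
    by (rule integrable_continuous_support[OF that(1) compact_imp_bounded[OF sS]]) (rule that(2))
  have igv: "integrable lborel (\<lambda>y. g y * v y)" by (rule int_off[OF gvc]) (simp add: gz)
  have igw: "integrable lborel (\<lambda>y. g y * w y)" by (rule int_off) (auto intro!: continuous_intros gc wc simp: gz)
  have iT: "integrable lborel T" by (rule int_off[OF Tc]) (simp add: T_def qz)
  have ig: "integrable lborel g" by (rule int_off[OF gc]) (rule gz)
  have goal: "(LINT y|lborel. g y * v y) \<le> (LINT y|lborel. g y * w y)
      + e / 3 * ((LINT y|lborel. T y) + C * (LINT y|lborel. g y))
      + e\<^sup>2 * M / 4 * measure lborel S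
      + (8 * a0 * measure lborel S + 20 * a1 + a4) * (d + measure lborel (bad_layer \<phi> F S d) / d)"
    if d: "0 < d" "d \<le> e" "d \<le> 1" for d
  proof -
    obtain f f' k k' :: "real \<Rightarrow> real" where
      fd: "\<And>t. (f has_real_derivative f' t) (at t)" and f'c: "continuous_on UNIV f'"
      and kd: "\<And>t. (k has_real_derivative k' t) (at t)" and k'c: "continuous_on UNIV k'"
      and k0: "\<And>t. 0 \<le> k t" and kf: "\<And>t. k t \<le> f t"
      and fl: "\<And>t. t \<le> - d \<Longrightarrow> f t = 0" "\<And>t. t \<le> - d \<Longrightarrow> f' t = 0"
      and fr: "\<And>t. 0 \<le> t \<Longrightarrow> f t = (max 0 (1 - t / e))\<^sup>2" "\<And>t. 0 \<le> t \<Longrightarrow> f' t = - (2 / e) * max 0 (1 - t / e)"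
      and f4: "\<And>t. f t \<le> 4" and f'b: "\<And>t. t \<le> 0 \<Longrightarrow> \<bar>f' t\<bar> \<le> 20 / d"
      and kz: "\<And>t. d \<le> \<bar>t\<bar> \<Longrightarrow> k t = 0" "\<And>t. d \<le> \<bar>t\<bar> \<Longrightarrow> k' t = 0"
      and k'b: "\<And>t. \<bar>k' t\<bar> \<le> 20 / d" and k1: "k 0 = 1"
    proof (rule profiles[OF d(1,2)], goal_cases)
      case (1 f f' k k')
      from 1(2-17) show ?case by (rule 1(1))
    qed
    let ?bad = "bad_layer \<phi> F S d"
    have f0: "0 \<le> f t" for t using k0[of t] kf[of t] by linarith
    have k4: "k t \<le> 4" for t using kf[of t] f4[of t] by linarith
    have fbig: "f t = 0" "f' t = 0" if "e \<le> t" for t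
      using that e fr[of t] by (simp_all add: max_def)
    note gg = has_cont_grad_fst[OF g] and hh = has_cont_grad_height[OF \<phi>]
    define psi where "psi z = g (fst z) * f (snd z - \<phi> (fst z))" for z
    define G where "G z = g (fst z) *\<^sub>R (f' (snd z - \<phi> (fst z)) *\<^sub>R (- P (fst z), 1::real))
        + f (snd z - \<phi> (fst z)) *\<^sub>R (q (fst z), 0::real)" for z :: "'a \<times> real"
    have psi: "has_cont_grad psi G"
      unfolding psi_def[abs_def] G_def[abs_def]
      by (rule has_cont_grad_mult[OF gg has_cont_grad_compose[OF hh fd f'c]])
    define u where "u z = g (fst z) * k (snd z - \<phi> (fst z))" for z
    define U where "U z = g (fst z) *\<^sub>R (k' (snd z - \<phi> (fst z)) *\<^sub>R (- P (fst z), 1::real))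
        + k (snd z - \<phi> (fst z)) *\<^sub>R (q (fst z), 0::real)" for z :: "'a \<times> real"
    have u: "has_cont_grad u U"
      unfolding u_def[abs_def] U_def[abs_def]
      by (rule has_cont_grad_mult[OF gg has_cont_grad_compose[OF hh kd k'c]])
    define Y where "Y z = u z *\<^sub>R m (fst z)" for z
    note mf = has_cont_deriv_fst[OF m]
    have Y: "has_cont_deriv Y (\<lambda>z v. u z *\<^sub>R Dm (fst z) (fst v) + (U z \<bullet> v) *\<^sub>R m (fst z))"
      unfolding Y_def[abs_def] by (rule has_cont_deriv_scaleR[OF u mf])
    have divY: "divergence Y z = u z * dm (fst z) + U z \<bullet> m (fst z)" for z
      unfolding Y_def[abs_def] using divergence_scaleR[OF u mf] by (simp add: divergence_eq[OF mf] dm_def)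
    \<comment> \<open>A box in the original coordinates that contains the supports of both test
      functions: on \<open>S\<close> the graph has height at most \<open>a6\<close>, and the
      profiles live between - d and e above it.\<close>
    define R where "R = S \<times> {- (a6 + e)..a6 + e}"
    have cR: "compact R" unfolding R_def by (intro compact_Times sS compact_Icc)
    have inR: "z \<in> R" if "g (fst z) \<noteq> 0" "f (snd z - \<phi> (fst z)) \<noteq> 0" for z
    proof -
      have S: "fst z \<in> S" using gz[of "fst z"] that(1) by metis
      have "\<bar>\<phi> (fst z)\<bar> \<le> a6" by (rule a6(2)[OF S])
      moreover have "- d < snd z - \<phi> (fst z)" "snd z - \<phi> (fst z) < e"
        using that(2) fl(1) fbig(1) not_le by blast+
      ultimately have "- (a6 + e) \<le> snd z" "snd z \<le> a6 + e" using d by linarith+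
      then show ?thesis using S by (simp add: R_def mem_Times_iff)
    qed
    have kff: "k t = 0" if "f t = 0" for t using k0[of t] kf[of t] that by linarith
    have subpsi: "{z. psi z \<noteq> 0} \<subseteq> R" using inR by (auto simp: psi_def)
    have subY: "{z. Y z \<noteq> 0} \<subseteq> R"
    proof
      fix z assume "z \<in> {z. Y z \<noteq> 0}"
      then have "g (fst z) \<noteq> 0" "k (snd z - \<phi> (fst z)) \<noteq> 0" by (auto simp: Y_def u_def)
      then show "z \<in> R" using inR[of z] kff[of "snd z - \<phi> (fst z)"] by metis
    qed
    have spsi: "compact (supp psi)" and sY: "compact (supp Y)"
      by (rule compact_supp_in[OF subpsi cR], rule compact_supp_in[OF subY cR])
    have le: "\<forall>z. norm (Y z) \<le> psi z"
    proof
      fix z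
      show "norm (Y z) \<le> psi z"
      proof (cases "fst z \<in> S")
        case True
        have "norm (Y z) = g (fst z) * k (snd z - \<phi> (fst z)) * norm (m (fst z))"
          using g0 k0 by (simp add: Y_def u_def abs_mult)
        also have "\<dots> \<le> g (fst z) * k (snd z - \<phi> (fst z)) * 1"
          using g0 k0 m1S[OF True] by (intro mult_left_mono) auto
        also have "\<dots> \<le> psi z" unfolding psi_def using g0 kf by (simp add: mult_left_mono)
        finally show ?thesis .
      next
        case False
        then show ?thesis by (simp add: Y_def u_def psi_def gz)
      qed
    qed
    have ineq: "(LINT x|lborel. indicator F x * divergence Y x)
        \<le> (LINT x|lborel. indicator F x * norm (G x)) + C * (LINT x|lborel. indicator F x * psi x)"
      by (rule cal[unfolded perimeter_bound_borel_def, rule_format, OF Y sY psi spsi spec[OF le]])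
    have sh: "(LINT x|lborel. indicator F x * h x) = (LINT z|lborel. indicator F' z * h (fst z, \<phi> (fst z) + snd z))"
        "integrable lborel (\<lambda>z. indicator F' z * h (fst z, \<phi> (fst z) + snd z))"
      if hc: "continuous_on UNIV h" and hz: "\<forall>z. z \<notin> R \<longrightarrow> h z = 0" for h :: "'a \<times> real \<Rightarrow> real"
    proof -
      have [measurable]: "h \<in> borel_measurable borel" using hc by (rule borel_measurable_continuous_onI)
      have "integrable lborel h"
        by (rule integrable_continuous_support[OF hc compact_imp_bounded[OF cR]]) (use hz in blast)
      then have i: "integrable lborel (\<lambda>z. indicator F z * h z)"
        using integrable_mult_indicator[of F lborel h] by simp
      have mm: "(\<lambda>z. indicator F z * h z) \<in> borel_measurable borel" by measurable
      have ii: "indicator F (fst z, \<phi> (fst z) + snd z) = (indicator F' z :: real)" for z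
        by (simp add: F'_def indicator_def)
      show "(LINT x|lborel. indicator F x * h x) = (LINT z|lborel. indicator F' z * h (fst z, \<phi> (fst z) + snd z))"
        using integral_shear_lborel(1)[OF \<phi>m mm] by (simp only: ii)
      show "integrable lborel (\<lambda>z. indicator F' z * h (fst z, \<phi> (fst z) + snd z))"
        using integral_shear_lborel(2)[OF \<phi>m mm i] by (simp only: ii)
    qed
    have supR: "supp Y \<subseteq> R" "supp psi \<subseteq> R"
      by (rule closure_minimal[OF subY compact_imp_closed[OF cR]], rule closure_minimal[OF subpsi compact_imp_closed[OF cR]])
    have Rz: "\<forall>z. z \<notin> R \<longrightarrow> divergence Y z = 0" "\<forall>z. z \<notin> R \<longrightarrow> norm (G z) = 0" "\<forall>z. z \<notin> R \<longrightarrow> psi z = 0"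
    proof -
      have "divergence Y z = 0 \<and> norm (G z) = 0 \<and> psi z = 0" if "z \<notin> R" for z
      proof (intro conjI)
        have nY: "z \<notin> supp Y" and np: "z \<notin> supp psi" using supR that by blast+
        show "divergence Y z = 0" by (rule divergence_off_supp[OF Y nY])
        show "norm (G z) = 0" using has_cont_grad_off_supp[OF psi np] by (simp only: norm_zero)
        show "psi z = 0" by (rule not_in_supp[OF np])
      qed
      then show "\<forall>z. z \<notin> R \<longrightarrow> divergence Y z = 0" "\<forall>z. z \<notin> R \<longrightarrow> norm (G z) = 0" "\<forall>z. z \<notin> R \<longrightarrow> psi z = 0"
        by blast+
    qed
    have Gc: "continuous_on UNIV (\<lambda>z. norm (G z))" using psi by (auto simp: has_cont_grad_def intro: continuous_on_norm)
    note s1 = sh[OF divergence_continuous[OF Y] Rz(1)] and s2 = sh[OF Gc Rz(2)]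
      and s3 = sh[OF has_cont_grad_continuous[OF psi] Rz(3)]
    \<comment> \<open>\<open>lw\<close> and \<open>rw\<close> are the two integrands of the
      perimeter bound after shearing; \<open>ng\<close> is the length of the gradient in these
      coordinates.\<close>
    define lw where "lw z = indicator F' z * (k (snd z) * A (fst z) - k' (snd z) * (g (fst z) * v (fst z)))" for z :: "'a \<times> real"
    define ng where "ng z = norm (f (snd z) *\<^sub>R q (fst z) + (g (fst z) * - f' (snd z)) *\<^sub>R P (fst z), - (g (fst z) * - f' (snd z)))" for z
    define rw where "rw z = indicator F' z * ng z + C * (indicator F' z * (g (fst z) * f (snd z)))" for z
    have e1: "indicator F' z * divergence Y (fst z, \<phi> (fst z) + snd z) = lw z" for z
      by (simp add: divY u_def U_def lw_def A_def v_def inner_prod_def inner_add_left inner_diff_right inner_commute algebra_simps)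
    have e2: "norm (G (fst z, \<phi> (fst z) + snd z)) = ng z" for z
      by (simp add: G_def ng_def algebra_simps)
    have e3: "psi (fst z, \<phi> (fst z) + snd z) = g (fst z) * f (snd z)" for z
      by (simp add: psi_def)
    have ilw: "integrable lborel lw" using s1(2) by (simp only: e1)
    have irw: "integrable lborel rw" unfolding rw_def[abs_def]
      using s2(2) s3(2) by (simp add: e2 e3)
    have lr: "(LINT z|lborel. lw z) \<le> (LINT z|lborel. rw z)"
      using ineq s2(2) s3(2) unfolding s1(1) s2(1) s3(1) e1 e2 e3 rw_def by simp
    let ?p = "indicator {0<..} :: real \<Rightarrow> real"
    \<comment> \<open>If \<open>F'\<close> were exactly t > 0, only - k' g v on t > 0 and the term
      with A would remain. The latter is replaced by its worst value on a strip of width 2 d, and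
      the deviation of \<open>F'\<close> costs at most 20/d times \<open>a1\<close> on the bad
      layer. The first term integrates to that of g v, since - k' has integral
      \<open>k 0 = 1\<close> over t > 0.\<close>
    define LB where "LB z = - ((g (fst z) * v (fst z)) * (?p (snd z) * k' (snd z)))
        - 4 * a0 * (indicator S (fst z) * indicator {-d..d} (snd z)) - 20 / d * a1 * indicator ?bad z" for z
    \<comment> \<open>Above the graph this is the expansion of the gradient length with c = - f'
      plus the term with C; its first part integrates to that of g w because \<open>f 0 = 1\<close>.
      The error e M / 4 on a slab of height e produces the e^2 M / 4 of the claim.\<close>
    define UB where "UB z = - ((g (fst z) * w (fst z)) * (?p (snd z) * f' (snd z)))
        + T (fst z) * (?p (snd z) * (max 0 (1 - snd z / e))\<^sup>2)
        + e * M / 4 * (indicator S (fst z) * indicator {0..e} (snd z))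
        + C * (g (fst z) * (?p (snd z) * (max 0 (1 - snd z / e))\<^sup>2))
        + a4 / d * indicator ?bad z" for z
    have pint: "integrable lborel (\<lambda>t. ?p t * k' t)" "(LINT t|lborel. ?p t * k' t) = - 1"
      using integral_indicator_FTC[OF d(1) kd k'c] kz k1 by simp_all
    have fint: "integrable lborel (\<lambda>t. ?p t * f' t)" "(LINT t|lborel. ?p t * f' t) = - 1"
      using integral_indicator_FTC[OF e fd f'c] fbig fr(1)[of 0] by simp_all
    note sqint = integral_pos_part_sq[OF e]
    have dint: "integrable lborel (indicator {-d..d} :: real \<Rightarrow> real)" "(LINT t|lborel. (indicator {-d..d} t :: real)) = 2 * d"
      using d by simp_all
    have eint: "integrable lborel (indicator {0..e} :: real \<Rightarrow> real)" "(LINT t|lborel. (indicator {0..e} t :: real)) = e"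
      using e by simp_all
    have ibad: "integrable lborel (indicator ?bad :: _ \<Rightarrow> real)"
      using badS[of d] by (simp add: fmeasurable_def)
    have iLB: "integrable lborel LB" unfolding LB_def[abs_def]
      by (intro Bochner_Integration.integrable_diff Bochner_Integration.integrable_minus integrable_mult_right
        integral_Times_lborel(1) igv pint iS dint ibad)
    have LBI: "(LINT z|lborel. LB z) = (LINT y|lborel. g y * v y) - 4 * a0 * (measure lborel S * (2 * d)) - 20 / d * a1 * measure lborel ?bad"
    proof -
      note t1 = integral_Times_lborel[OF igv pint(1)] and t2 = integral_Times_lborel[OF iS dint(1)]
      have "(LINT z|lborel. LB z) = - (LINT z|lborel. (g (fst z) * v (fst z)) * (?p (snd z) * k' (snd z)))
        - 4 * a0 * (LINT z|lborel. indicator S (fst z) * indicator {-d..d} (snd z)) - 20 / d * a1 * (LINT z|lborel. indicator ?bad z)"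
        unfolding LB_def using t1(1) t2(1) ibad by simp
      then show ?thesis unfolding t1(2) t2(2) pint(2) dint(2) by simp
    qed
    have iUB: "integrable lborel UB" unfolding UB_def[abs_def]
      by (intro Bochner_Integration.integrable_add Bochner_Integration.integrable_minus integrable_mult_right
        integral_Times_lborel(1) igw fint iT sqint ig iS eint ibad)
    have UBI: "(LINT z|lborel. UB z) = (LINT y|lborel. g y * w y) + (LINT y|lborel. T y) * (e / 3)
       + e * M / 4 * (measure lborel S * e) + C * ((LINT y|lborel. g y) * (e / 3)) + a4 / d * measure lborel ?bad"
    proof -
      note t1 = integral_Times_lborel[OF igw fint(1)] and t2 = integral_Times_lborel[OF iT sqint(1)]
        and t3 = integral_Times_lborel[OF iS eint(1)] and t4 = integral_Times_lborel[OF ig sqint(1)]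
      have "(LINT z|lborel. UB z) = - (LINT z|lborel. (g (fst z) * w (fst z)) * (?p (snd z) * f' (snd z)))
        + (LINT z|lborel. T (fst z) * (?p (snd z) * (max 0 (1 - snd z / e))\<^sup>2))
        + e * M / 4 * (LINT z|lborel. indicator S (fst z) * indicator {0..e} (snd z))
        + C * (LINT z|lborel. g (fst z) * (?p (snd z) * (max 0 (1 - snd z / e))\<^sup>2))
        + a4 / d * (LINT z|lborel. indicator ?bad z)"
        unfolding UB_def using t1(1) t2(1) t3(1) t4(1) ibad by simp
      then show ?thesis unfolding t1(2) t2(2) t3(2) t4(2) fint(2) sqint(2) eint(2) by simp
    qed
    have badI: "z \<in> ?bad \<longleftrightarrow> fst z \<in> S \<and> \<bar>snd z\<bar> < d \<and> (snd z < 0 \<and> z \<in> F' \<or> 0 < snd z \<and> z \<notin> F')" for z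
      by (auto simp: bad_layer_def F'_def)
    have kA: "\<bar>k t * A y\<bar> \<le> 4 * a0" for t y
      unfolding abs_mult using k0[of t] k4[of t] a0 by (intro mult_mono) auto
    have kg: "\<bar>k' t * (g y * v y)\<bar> \<le> 20 / d * a1" for t y
      unfolding abs_mult[of "k' t"] using k'b[of t] a1 d by (intro mult_mono) auto
    have low: "LB z \<le> lw z" if nz: "snd z \<noteq> 0" for z
    proof (cases "fst z \<in> S \<and> \<bar>snd z\<bar> < d")
      case False
      then have "z \<notin> ?bad" by (auto simp: badI)
      then have b0: "indicator ?bad z = (0 :: real)" by simp
      have out: "fst z \<notin> S \<or> d \<le> \<bar>snd z\<bar>" using False by auto
      have l0: "lw z = 0" using out kz[of "snd z"] by (auto simp: lw_def gz qz A_def)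
      have p0: "(g (fst z) * v (fst z)) * (?p (snd z) * k' (snd z)) = 0" using out kz[of "snd z"] by (auto simp: gz)
      show ?thesis unfolding LB_def l0 p0 b0 using a0 by simp
    next
      case True
      note kA[of "snd z" "fst z"] kg[of "snd z" "fst z"]
      moreover have "LB z = - ((g (fst z) * v (fst z)) * (?p (snd z) * k' (snd z))) - 4 * a0 - 20 / d * a1 * indicator ?bad z"
      proof -
        have "indicator S (fst z) * indicator {-d..d} (snd z) = (1 :: real)" using True by (auto simp: indicator_def)
        then show ?thesis unfolding LB_def by simp
      qed
      moreover have "z \<in> ?bad \<longleftrightarrow> (snd z < 0 \<and> z \<in> F' \<or> 0 < snd z \<and> z \<notin> F')" using True by (simp add: badI)
      moreover have "0 < 20 / d * a1" using d a1 by simp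
      ultimately show ?thesis using nz a0(1)
        by (cases "0 < snd z"; cases "z \<in> F'") (auto simp: lw_def mult.commute[of "k' _"] abs_le_iff)
    qed
    have a4p: "0 \<le> a4 / d" using a2 a3 a5 C0 d by (simp add: a4_def)
    \<comment> \<open>Above the graph the integrand without the indicator of \<open>F'\<close> is
      nonnegative, so the indicator is simply dropped. Below the graph, points of \<open>F'\<close>
      where the integrand is nonzero lie in the bad layer.\<close>
    have up: "rw z \<le> UB z" if nz: "snd z \<noteq> 0" for z
    proof (cases "0 < snd z")
      case True
      let ?c = "- f' (snd z)"
      let ?s = "max 0 (1 - snd z / e)"
      \<comment> \<open>With s = \<open>?s\<close> in [0, 1], f = s^2 and - f' = (2/e) s, so the
        condition f^2 \<le> (e/2) c required for the expansion is s^4 \<le> s.\<close>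
      have fs: "f (snd z) = ?s\<^sup>2" and cs: "?c = (2 / e) * ?s" using fr[of "snd z"] True by simp_all
      have s1: "?s \<le> 1" using True e by simp
      have s0: "0 \<le> ?s" by simp
      have "(?s\<^sup>2)\<^sup>2 \<le> ?s" 
      proof -
        have "?s\<^sup>2 \<le> 1" using power_le_one[OF s0 s1] .
        then have "(?s\<^sup>2)\<^sup>2 \<le> ?s\<^sup>2" using mult_left_mono[of "?s\<^sup>2" 1 "?s\<^sup>2"] by (simp add: power2_eq_square)
        also have "\<dots> \<le> ?s" using mult_left_mono[OF s1 s0] by (simp add: power2_eq_square)
        finally show ?thesis .
      qed
      then have f2: "(f (snd z))\<^sup>2 \<le> e / 2 * ?c" unfolding fs cs using e by simp
      have c0: "0 \<le> ?c" unfolding cs using e by simp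
      have n: "ng z \<le> g (fst z) * ?c * w (fst z) + f (snd z) * T (fst z) + e * M / 4"
        unfolding ng_def w_def T_def by (rule grad_norm_le[OF g0 qM c0 f0 f2 e M])
      have ng0: "0 \<le> ng z" by (simp add: ng_def)
      have main: "ng z \<le> g (fst z) * ?c * w (fst z) + f (snd z) * T (fst z)
          + e * M / 4 * (indicator S (fst z) * indicator {0..e} (snd z))"
      proof (cases "fst z \<in> S \<and> snd z \<le> e")
        case True
        then show ?thesis using n \<open>0 < snd z\<close> by simp
      next
        case False
        then have "fst z \<notin> S \<or> e \<le> snd z" by auto
        then have n0: "ng z = 0" and n1: "g (fst z) * ?c * w (fst z) = 0" and n2: "f (snd z) * T (fst z) = 0"
          using fbig[of "snd z"] by (auto simp: ng_def gz qz T_def norm_Pair)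
        show ?thesis unfolding n0 n1 n2 using e M by simp
      qed
      have Cgf: "0 \<le> C * (g (fst z) * f (snd z))" using C0 g0 f0 by simp
      have "rw z \<le> ng z + C * (g (fst z) * f (snd z))"
        using ng0 Cgf by (auto simp: rw_def indicator_def)
      also have "\<dots> \<le> UB z - a4 / d * indicator ?bad z"
        using main True by (simp add: UB_def fs algebra_simps)
      also have "\<dots> \<le> UB z" using a4p by (simp add: indicator_def)
      finally show ?thesis .
    next
      case False
      then have neg: "snd z < 0" using nz by simp
      have UBz: "UB z = a4 / d * indicator ?bad z" using neg by (simp add: UB_def)
      show ?thesis
      proof (cases "z \<in> ?bad")
        case True
        have "ng z \<le> norm (f (snd z) *\<^sub>R q (fst z) + (g (fst z) * - f' (snd z)) *\<^sub>R P (fst z)) + norm (- (g (fst z) * - f' (snd z)))"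
          unfolding ng_def by (rule norm_Pair_le)
        also have "\<dots> \<le> f (snd z) * norm (q (fst z)) + \<bar>f' (snd z)\<bar> * (g (fst z) * (norm (P (fst z)) + 1))"
          using norm_triangle_ineq[of "f (snd z) *\<^sub>R q (fst z)" "(g (fst z) * - f' (snd z)) *\<^sub>R P (fst z)"] f0[of "snd z"] g0[of "fst z"]
          by (simp add: abs_mult algebra_simps)
        also have "\<dots> \<le> 4 * a2 + 20 / d * a3"
        proof (intro add_mono mult_mono)
          show "g (fst z) * (norm (P (fst z)) + 1) \<le> a3" using a3(2)[of "fst z"] by simp
        qed (use f4 f'b[of "snd z"] a2 f0 g0 d neg in auto)
        finally have "ng z \<le> 4 * a2 + 20 / d * a3" .
        moreover have "C * (g (fst z) * f (snd z)) \<le> C * (a5 * 4)"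
          using C0 g0 f0 f4 a5(2)[of "fst z"] a5(1) by (intro mult_left_mono mult_mono) auto
        moreover have "rw z \<le> ng z + C * (g (fst z) * f (snd z))"
          using C0 g0 f0 by (auto simp: rw_def indicator_def ng_def)
        ultimately have "rw z \<le> 4 * a2 + 20 / d * a3 + C * (a5 * 4)" by linarith
        also have "\<dots> \<le> 4 * a2 / d + 20 / d * a3 + C * (a5 * 4) / d"
        proof -
          have "x \<le> x / d" if "0 \<le> x" for x
            using mult_left_mono[OF d(3) that] d(1) by (simp add: pos_le_divide_eq)
          from this[of "4 * a2"] this[of "C * (a5 * 4)"] show ?thesis using a2 a5 C0 by simp
        qed
        also have "\<dots> = a4 / d" by (simp add: a4_def add_divide_distrib)
        finally show ?thesis using True by (simp add: UBz)
      next
        case bad: False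
        have "rw z = 0"
        proof (cases "fst z \<in> S \<and> - d < snd z")
          case True
          then have "z \<notin> F'" using bad neg by (auto simp: badI)
          then show ?thesis by (simp add: rw_def)
        next
          case False
          then have "fst z \<notin> S \<or> snd z \<le> - d" by auto
          then show ?thesis using fl[of "snd z"] by (auto simp: rw_def ng_def gz qz norm_Pair)
        qed
        then show ?thesis using bad by (simp add: UBz)
      qed
    qed
    have "(LINT z|lborel. LB z) \<le> (LINT z|lborel. lw z)"
      using AE_snd_neq_0 by (intro integral_mono_AE iLB ilw) (auto elim!: eventually_mono intro: low)
    also note lr
    also have "(LINT z|lborel. rw z) \<le> (LINT z|lborel. UB z)"
      using AE_snd_neq_0 by (intro integral_mono_AE iUB irw) (auto elim!: eventually_mono intro: up)
    finally have fin: "(LINT y|lborel. g y * v y) - 4 * a0 * (measure lborel S * (2 * d)) - 20 / d * a1 * measure lborel ?bad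
       \<le> (LINT y|lborel. g y * w y) + (LINT y|lborel. T y) * (e / 3)
       + e * M / 4 * (measure lborel S * e) + C * ((LINT y|lborel. g y) * (e / 3)) + a4 / d * measure lborel ?bad"
      unfolding LBI UBI .
    let ?mu = "measure lborel S" and ?be = "measure lborel ?bad"
    have "4 * a0 * (?mu * (2 * d)) + 20 / d * a1 * ?be + a4 / d * ?be
        \<le> (8 * a0 * ?mu + 20 * a1 + a4) * (d + ?be / d)"
    proof -
      have "0 \<le> (8 * a0 * ?mu) * (?be / d)" "0 \<le> (20 * a1 + a4) * d"
        using a0 a1 a2 a3 a5 C0 d by (auto simp: a4_def)
      then show ?thesis by (simp add: algebra_simps)
    qed
    then show ?thesis using fin by (simp add: power2_eq_square algebra_simps)
  qed
  show ?thesis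
    by (rule that[of "8 * a0 * measure lborel S + 20 * a1 + a4"]) (use goal in \<open>simp add: v_def w_def T_def S_def\<close>)
qed

section \<open>Approximation of the unit normal and passage to the limit\<close>

lemma has_cont_grad_real_polynomial:
  "real_polynomial_function p \<Longrightarrow> \<exists>G. has_cont_grad (p :: 'a::euclidean_space \<Rightarrow> real) G"
proof (induction rule: real_polynomial_function.induct)
  case (linear f)
  have e: "f v = (\<Sum>b\<in>Basis. f b *\<^sub>R b) \<bullet> v" for v
  proof -
    have "f v = f (\<Sum>b\<in>Basis. (v \<bullet> b) *\<^sub>R b)" by (simp add: euclidean_representation)
    also have "\<dots> = (\<Sum>b\<in>Basis. (v \<bullet> b) *\<^sub>R f b)"
      using bounded_linear.linear[OF linear] by (simp add: linear_sum linear_scale)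
    also have "\<dots> = (\<Sum>b\<in>Basis. f b *\<^sub>R b) \<bullet> v"
      unfolding inner_sum_left by (intro sum.cong refl) (simp add: inner_commute)
    finally show ?thesis .
  qed
  have "(f has_derivative (\<lambda>v. (\<Sum>b\<in>Basis. f b *\<^sub>R b) \<bullet> v)) (at x)" for x
  proof -
    have "(\<lambda>v. (\<Sum>b\<in>Basis. f b *\<^sub>R b) \<bullet> v) = f" by (rule ext) (rule e[symmetric])
    then show ?thesis using bounded_linear_imp_has_derivative[OF linear] by simp
  qed
  then have "has_cont_grad f (\<lambda>x. \<Sum>b\<in>Basis. f b *\<^sub>R b)"
    unfolding has_cont_grad_def by (intro conjI allI continuous_on_const)
  then show ?case by (rule exI[of "has_cont_grad f"])
next
  case (const c)
  show ?case using has_cont_grad_const by blast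
next
  case (add f g)
  then show ?case using has_cont_grad_add by blast
next
  case (mult f g)
  then show ?case using has_cont_grad_mult by blast
qed

lemma has_cont_deriv_polynomial:
  fixes p :: "'a::euclidean_space \<Rightarrow> 'c::euclidean_space"
  assumes "polynomial_function p"
  shows "\<exists>D. has_cont_deriv p D"
proof -
  have "\<exists>G. has_cont_grad (\<lambda>x. p x \<bullet> b) G" if "b \<in> Basis" for b
    using assms that has_cont_grad_real_polynomial unfolding polynomial_function_iff_Basis_inner by blast
  then obtain G where G: "\<And>b. b \<in> Basis \<Longrightarrow> has_cont_grad (\<lambda>x. p x \<bullet> b) (G b)" by metis
  have "has_cont_deriv p (\<lambda>x v. \<Sum>b\<in>Basis. (G b x \<bullet> v) *\<^sub>R b)"
    unfolding has_cont_deriv_def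
  proof (intro conjI allI)
    fix x
    have "((\<lambda>x. \<Sum>b\<in>Basis. (p x \<bullet> b) *\<^sub>R b) has_derivative (\<lambda>v. \<Sum>b\<in>Basis. (G b x \<bullet> v) *\<^sub>R b)) (at x)"
      using G by (intro has_derivative_sum has_derivative_scaleR_left) (simp add: has_cont_grad_def)
    then show "(p has_derivative (\<lambda>v. \<Sum>b\<in>Basis. (G b x \<bullet> v) *\<^sub>R b)) (at x)"
      by (simp add: euclidean_representation)
    fix v
    show "continuous_on UNIV (\<lambda>x. \<Sum>b\<in>Basis. (G b x \<bullet> v) *\<^sub>R b)"
      using G by (intro continuous_intros) (simp add: has_cont_grad_def)
  qed
  then show ?thesis by (rule exI[of "has_cont_deriv p"])
qed

text \<open>The normal of a C^1 graph is only continuous, while the perimeter is tested by C^1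
  fields. A polynomial field within h of it may have norm up to 1 + h; multiplying by 1/(1 + h)
  restores the bound 1 and costs at most another h.\<close>

lemma smooth_field_approx:
  fixes n :: "'a::euclidean_space \<Rightarrow> 'c::euclidean_space"
  assumes S: "compact S" and n: "continuous_on S n" and n1: "\<And>y. y \<in> S \<Longrightarrow> norm (n y) \<le> 1" and h: "0 < h"
  obtains m D where "has_cont_deriv m D" "\<And>y. y \<in> S \<Longrightarrow> norm (m y) \<le> 1" "\<And>y. y \<in> S \<Longrightarrow> norm (n y - m y) \<le> 2 * h"
proof -
  obtain p where p: "polynomial_function p" and np: "\<And>y. y \<in> S \<Longrightarrow> norm (n y - p y) < h"
    using Stone_Weierstrass_polynomial_function[OF S n h] by blast
  obtain D where D: "has_cont_deriv p D" using has_cont_deriv_polynomial[OF p] by blast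
  define c where "c = 1 / (1 + h)"
  have c: "0 < c" "c * (1 + h) = 1" using h by (simp_all add: c_def)
  have pb: "norm (p y) \<le> 1 + h" if "y \<in> S" for y
    using norm_triangle_ineq4[of "n y" "n y - p y"] np[OF that] n1[OF that] by simp
  show ?thesis
  proof (rule that[OF has_cont_deriv_scaleR[OF has_cont_grad_const[of c] D]])
    fix y assume y: "y \<in> S"
    have "c * norm (p y) \<le> c * (1 + h)" using pb[OF y] c by (intro mult_left_mono) auto
    then show "norm (c *\<^sub>R p y) \<le> 1" using c by simp
    have "n y - c *\<^sub>R p y = (n y - p y) + (1 - c) *\<^sub>R p y" by (simp add: algebra_simps)
    then have "norm (n y - c *\<^sub>R p y) \<le> norm (n y - p y) + \<bar>1 - c\<bar> * norm (p y)"
      by (metis norm_scaleR norm_triangle_ineq)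
    also have "1 - c = c * h" using c by (simp add: algebra_simps)
    also have "\<bar>c * h\<bar> * norm (p y) \<le> (c * h) * (1 + h)"
      using pb[OF y] c h by (simp add: abs_mult mult_left_mono)
    also have "(c * h) * (1 + h) = h" using c(2) by (metis mult.commute mult.left_commute mult.right_neutral)
    finally show "norm (n y - c *\<^sub>R p y) \<le> 2 * h" using np[OF y] by simp
  qed
qed

text \<open>Serves three limits: the approximation of the normal, the height of the layer, and the
  regularisation of the positive part.\<close>

lemma nonneg_of_le_small:
  fixes X Y :: real
  assumes "\<And>e. 0 < e \<Longrightarrow> e < 1 \<Longrightarrow> 0 \<le> X + e * Y"
  shows "0 \<le> X"
proof -
  have "((\<lambda>e. X + e * Y) \<longlongrightarrow> X + 0 * Y) (at_right 0)" by (intro tendsto_intros)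
  moreover have "eventually (\<lambda>e. 0 \<le> X + e * Y) (at_right (0::real))"
    using eventually_at_right_real[of 0 1] by (auto elim!: eventually_mono intro: assms)
  ultimately show ?thesis using tendsto_lowerbound[of "\<lambda>e. X + e * Y" "X + 0 * Y" "at_right 0" 0] by simp
qed

text \<open>The constant from \<open>perimeter_bound_layer\<close> depends on the derivative of the
  field and on e, so the depth tends to 0 first, with field and height fixed. The field then tends
  to the unit normal, whose product with (P, -1) is the area density, and the area integrals on both
  sides cancel. What remains is divided by e/3 before e tends to 0.\<close>

lemma first_variation_nonneg:
  fixes \<phi> g :: "'a::euclidean_space \<Rightarrow> real"
  assumes \<phi>: "has_cont_grad \<phi> P" and L: "\<And>x. norm (P x) \<le> L" and F: "F \<in> sets borel" and cal: "perimeter_bound_borel F C" and C0: "0 \<le> C"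
    and W: "open W" and nor: "AE y in lborel. y \<in> W \<longrightarrow>
      normal_limits F (y, \<phi> y) ((1 / sqrt (1 + (norm (P y))\<^sup>2)) *\<^sub>R (P y, -1))"
    and g: "has_cont_grad g q" and g0: "\<And>y. 0 \<le> g y" and sg: "compact (supp g)" and sW: "supp g \<subseteq> W"
    and M: "0 \<le> M" and qM: "\<And>y. (norm (q y))\<^sup>2 \<le> M * g y"
  shows "0 \<le> (LINT y|lborel. q y \<bullet> P y / sqrt (1 + (norm (P y))\<^sup>2)) + C * (LINT y|lborel. g y)"
proof -
  define S where "S = supp g"
  have sS: "compact S" using sg by (simp only: S_def)
  note bl = bad_layer_tendsto_0[OF \<phi> L F W sg sW nor]
  let ?w = "\<lambda>y. sqrt (1 + (norm (P y))\<^sup>2)"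
  let ?T = "LINT y|lborel. q y \<bullet> P y / ?w y" and ?g = "LINT y|lborel. g y" and ?gw = "LINT y|lborel. g y * ?w y"
  let ?mu = "measure lborel S"
  have Pc: "continuous_on UNIV P" using \<phi> by (simp add: has_cont_grad_def)
  have gc: "continuous_on UNIV g" by (rule has_cont_grad_continuous[OF g])
  have w0: "0 < ?w y" for y by (simp add: add_pos_nonneg)
  have wc: "continuous_on UNIV ?w" by (intro continuous_intros Pc)
  have gz: "g y = 0" if "y \<notin> S" for y using that unfolding S_def by (rule not_in_supp)
  have int_off: "integrable lborel (\<lambda>y. g y * f y)" if "continuous_on UNIV f" for f :: "'a \<Rightarrow> real"
    by (rule integrable_continuous_support[OF _ compact_imp_bounded[OF sS]])
      (simp_all add: gz that gc continuous_on_mult)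
  have step: "(LINT y|lborel. g y * (m y \<bullet> (P y, -1))) \<le> ?gw + e / 3 * (?T + C * ?g) + e\<^sup>2 * M / 4 * ?mu"
    if e: "0 < e" and m: "has_cont_deriv m Dm" "\<And>y. y \<in> S \<Longrightarrow> norm (m y) \<le> 1" for e and m :: "'a \<Rightarrow> 'a \<times> real" and Dm
  proof -
    obtain a where a: "\<And>d. 0 < d \<Longrightarrow> d \<le> e \<Longrightarrow> d \<le> 1 \<Longrightarrow>
        (LINT y|lborel. g y * (m y \<bullet> (P y, -1))) \<le> ?gw + e / 3 * (?T + C * ?g) + e\<^sup>2 * M / 4 * ?mu
          + a * (d + measure lborel (bad_layer \<phi> F S d) / d)"
      using perimeter_bound_layer[OF \<phi> F cal C0 g g0 sg M qM m(1) m(2)[unfolded S_def] bl(2) e]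
      unfolding S_def by blast
    let ?X = "?gw + e / 3 * (?T + C * ?g) + e\<^sup>2 * M / 4 * ?mu"
    let ?b = "\<lambda>n. 1 / real (Suc n) + real (Suc n) * measure lborel (bad_layer \<phi> F S (1 / real (Suc n)))"
    have d0: "(\<lambda>n. 1 / real (Suc n)) \<longlonglongrightarrow> 0" by (rule LIMSEQ_Suc[OF lim_1_over_n])
    have "(\<lambda>n. ?X + a * ?b n) \<longlonglongrightarrow> ?X + a * (0 + 0)"
      by (intro tendsto_intros d0 bl(1)[folded S_def])
    moreover have "eventually (\<lambda>n. (LINT y|lborel. g y * (m y \<bullet> (P y, -1))) \<le> ?X + a * ?b n) sequentially"
      using order_tendstoD(2)[OF d0 e]
    proof eventually_elim
      case (elim n)
      have "(LINT y|lborel. g y * (m y \<bullet> (P y, -1)))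
          \<le> ?X + a * (1 / real (Suc n) + measure lborel (bad_layer \<phi> F S (1 / real (Suc n))) / (1 / real (Suc n)))"
        by (rule a) (use elim in auto)
      then show ?case by (simp add: mult.commute)
    qed
    ultimately show ?thesis using tendsto_lowerbound by fastforce
  qed
  define n where "n y = (1 / ?w y) *\<^sub>R (P y, -1::real)" for y
  have nP: "norm (P y, -1::real) = ?w y" for y by (simp add: norm_Pair add.commute)
  have inv1: "\<bar>1 / r\<bar> * r = 1" "1 / r * r\<^sup>2 = r" if "0 < r" for r :: real
    using that by (simp_all add: power2_eq_square)
  have n1: "norm (n y) = 1" for y unfolding n_def norm_scaleR nP using w0[of y] by (intro inv1)
  have nv: "n y \<bullet> (P y, -1) = ?w y" for y
  proof -
    have "(P y, -1::real) \<bullet> (P y, -1) = (?w y)\<^sup>2" by (simp only: dot_square_norm nP)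
    then show ?thesis unfolding n_def inner_scaleR_left using inv1(2)[OF w0[of y]] by (simp only:)
  qed
  have nc: "continuous_on S n" unfolding n_def[abs_def]
    using continuous_on_subset[OF wc] continuous_on_subset[OF Pc] w0
    by (intro continuous_intros) (auto simp: less_le)
  have 1: "0 \<le> (e / 3 * (?T + C * ?g) + e\<^sup>2 * M / 4 * ?mu) + h * (2 * ?gw)" if e: "0 < e" and h: "0 < h" for e h
  proof -
    obtain m D where m: "has_cont_deriv m D" "\<And>y. y \<in> S \<Longrightarrow> norm (m y) \<le> 1" "\<And>y. y \<in> S \<Longrightarrow> norm (n y - m y) \<le> 2 * h"
      using smooth_field_approx[OF sS nc _ h] n1 by (metis order_refl)
    have mc: "continuous_on UNIV (\<lambda>y. m y \<bullet> (P y, -1::real))"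
      using has_cont_deriv_continuous[OF m(1)] by (intro continuous_intros Pc)
    have "g y * ?w y \<le> g y * (m y \<bullet> (P y, -1)) + h * (2 * (g y * ?w y))" for y
    proof (cases "y \<in> S")
      case True
      have "?w y - m y \<bullet> (P y, -1) = (n y - m y) \<bullet> (P y, -1)" by (simp only: inner_diff_left nv)
      also have "\<dots> \<le> norm (n y - m y) * norm (P y, -1::real)" by (rule norm_cauchy_schwarz)
      also have "\<dots> \<le> 2 * h * ?w y" unfolding nP using m(3)[OF True] w0[of y] by (intro mult_right_mono) auto
      finally have "g y * ?w y \<le> g y * (m y \<bullet> (P y, -1) + 2 * h * ?w y)" using g0[of y] by (intro mult_left_mono) auto
      then show ?thesis by (simp add: algebra_simps)
    qed (simp add: gz)
    then have "?gw \<le> (LINT y|lborel. g y * (m y \<bullet> (P y, -1)) + h * (2 * (g y * ?w y)))"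
      by (intro integral_mono Bochner_Integration.integrable_add integrable_mult_right int_off mc wc) simp
    also have "\<dots> = (LINT y|lborel. g y * (m y \<bullet> (P y, -1))) + h * (2 * ?gw)"
      using int_off[OF mc] int_off[OF wc] by simp
    also have "\<dots> \<le> (?gw + e / 3 * (?T + C * ?g) + e\<^sup>2 * M / 4 * ?mu) + h * (2 * ?gw)"
      using step[OF e m(1,2)] by simp
    finally show ?thesis by simp
  qed
  have 2: "0 \<le> (?T + C * ?g) + e * (3 * M / 4 * ?mu)" if e: "0 < e" for e
  proof -
    have "0 \<le> e / 3 * (?T + C * ?g) + e\<^sup>2 * M / 4 * ?mu"
      by (rule nonneg_of_le_small[OF 1[OF e]])
    also have "\<dots> = e / 3 * ((?T + C * ?g) + e * (3 * M / 4 * ?mu))" by (simp add: power2_eq_square algebra_simps)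
    finally show ?thesis using e by (simp add: zero_le_mult_iff)
  qed
  show ?thesis by (rule nonneg_of_le_small[OF 2])
qed

section \<open>Cutoffs and signed test functions\<close>

lemma has_cont_grad_unique:
  assumes "has_cont_grad f G" "has_cont_grad f H" shows "G x = H x"
proof -
  have "(\<lambda>v. G x \<bullet> v) = (\<lambda>v. H x \<bullet> v)"
    by (rule has_derivative_unique[of f _ x]) (use assms in \<open>simp_all only: has_cont_grad_def\<close>)
  then have "(G x - H x) \<bullet> (G x - H x) = 0" using fun_cong[of _ _ "G x - H x"] by (simp only: inner_diff_left)
  then show ?thesis by simp
qed

lemma has_cont_grad_sum:
  assumes "finite I" "\<And>i. i \<in> I \<Longrightarrow> has_cont_grad (f i) (G i)"
  shows "has_cont_grad (\<lambda>x. \<Sum>i\<in>I. f i x) (\<lambda>x. \<Sum>i\<in>I. G i x)"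
  using assms
proof (induction I rule: finite_induct)
  case empty
  show ?case by (simp add: has_cont_grad_const)
next
  case (insert i I)
  have "has_cont_grad (\<lambda>x. f i x + (\<Sum>i\<in>I. f i x)) (\<lambda>x. G i x + (\<Sum>i\<in>I. G i x))"
    by (rule has_cont_grad_add) (use insert in auto)
  then show ?case using insert by simp
qed

text \<open>A sum of squared positive parts of d^2 - |y - x|^2 over the centres of a finite cover of
  \<open>S\<close> by balls of radius d; d is so small that the closed balls stay in
  \<open>V\<close>.\<close>

lemma bump_exists:
  fixes S :: "'a::euclidean_space set"
  assumes S: "compact S" and V: "open V" "S \<subseteq> V"
  obtains s G where "has_cont_grad s G" "\<And>y. 0 \<le> s y" "\<And>y. y \<in> S \<Longrightarrow> 0 < s y" "compact (supp s)" "supp s \<subseteq> V"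
proof -
  obtain d where d: "0 < d" "(\<Union>x\<in>S. cball x d) \<subseteq> V"
    using compact_subset_open_imp_cball_epsilon_subset[OF S V] by auto
  obtain I where I: "I \<subseteq> S" "finite I" "S \<subseteq> (\<Union>x\<in>I. ball x d)"
    by (rule compactE_image[OF S, of S "\<lambda>x. ball x d"]) (use d(1) in auto)
  define u where "u x y = d\<^sup>2 - (norm (y - x))\<^sup>2" for x y :: 'a
  have u: "has_cont_grad (u x) (\<lambda>y. - 2 *\<^sub>R (y - x))" for x
    unfolding has_cont_grad_def u_def power2_norm_eq_inner
    by (auto intro!: derivative_eq_intros continuous_intros simp: inner_commute)
  define b where "b x y = (max 0 (u x y))\<^sup>2" for x y
  have b: "has_cont_grad (b x) (\<lambda>y. (2 * max 0 (u x y)) *\<^sub>R (- 2 *\<^sub>R (y - x)))" for x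
    unfolding b_def by (rule has_cont_grad_compose[OF u has_real_derivative_pos_sq]) (intro continuous_intros)
  have b0: "0 \<le> b x y" for x y by (simp add: b_def)
  have bpos: "0 < b x y" if "y \<in> ball x d" for x y
  proof -
    have "norm (y - x) < d" using that by (simp add: dist_norm norm_minus_commute)
    then have "0 < u x y" unfolding u_def using power_strict_mono[of "norm (y - x)" d 2] by simp
    then show ?thesis by (simp add: b_def)
  qed
  have bz: "b x y = 0" if "y \<notin> cball x d" for x y
  proof -
    have "d \<le> norm (y - x)" using that by (simp add: dist_norm norm_minus_commute)
    then have "u x y \<le> 0" unfolding u_def using power_mono[of d "norm (y - x)" 2] d(1) by simp
    then show ?thesis by (simp add: b_def)
  qed
  define s where "s y = (\<Sum>x\<in>I. b x y)" for y
  define K where "K = (\<Union>x\<in>I. cball x d)"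
  have K: "compact K" unfolding K_def using I(2) by (intro compact_UN) auto
  have sK: "{y. s y \<noteq> 0} \<subseteq> K"
  proof
    fix y assume "y \<in> {y. s y \<noteq> 0}"
    moreover have "s y = 0" if "\<forall>x\<in>I. b x y = 0" using that by (simp add: s_def)
    ultimately have "\<not> (\<forall>x\<in>I. b x y = 0)" by blast
    then obtain x where "x \<in> I" "b x y \<noteq> 0" by blast
    then show "y \<in> K" using bz unfolding K_def by blast
  qed
  show ?thesis
  proof (rule that)
    show "has_cont_grad s (\<lambda>y. \<Sum>x\<in>I. (2 * max 0 (u x y)) *\<^sub>R (- 2 *\<^sub>R (y - x)))"
      unfolding s_def[abs_def] by (rule has_cont_grad_sum[OF I(2) b])
    show "0 \<le> s y" for y unfolding s_def by (intro sum_nonneg b0)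
    show "0 < s y" if y: "y \<in> S" for y
    proof -
      obtain x where x: "x \<in> I" "y \<in> ball x d" using subsetD[OF I(3) y] by auto
      then show ?thesis unfolding s_def using I(2) b0 bpos by (intro sum_pos2[of I x]) auto
    qed
    show "compact (supp s)" by (rule compact_supp_in[OF sK K])
    have "supp s \<subseteq> K" by (rule closure_minimal[OF sK compact_imp_closed[OF K]])
    also have "K \<subseteq> V" using d(2) I(1) unfolding K_def by blast
    finally show "supp s \<subseteq> V" .
  qed
qed

text \<open>The bump is at least some m > 0 on \<open>S\<close>. Composing 2 s / m with a C^1
  function that is 0 at 0 and 1 from 1 on gives the value 1 wherever s exceeds m/2. That this is an
  open neighbourhood of \<open>S\<close> matters: a product with the cutoff keeps its gradient
  there.\<close>

lemma cutoff_exists: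
  fixes S :: "'a::euclidean_space set"
  assumes S: "compact S" and V: "open V" "S \<subseteq> V"
  obtains c G W where "has_cont_grad c G" "\<And>y. 0 \<le> c y" "open W" "S \<subseteq> W" "\<And>y. y \<in> W \<Longrightarrow> c y = 1"
    "compact (supp c)" "supp c \<subseteq> V"
proof -
  obtain s G where s: "has_cont_grad s G" "\<And>y. 0 \<le> s y" "\<And>y. y \<in> S \<Longrightarrow> 0 < s y" "compact (supp s)" "supp s \<subseteq> V"
    using bump_exists[OF S V] by metis
  have sc: "continuous_on UNIV s" by (rule has_cont_grad_continuous[OF s(1)])
  obtain m where m: "0 < m" "\<And>y. y \<in> S \<Longrightarrow> m \<le> s y"
  proof (cases "S = {}")
    case True
    then show ?thesis using that[of 1] by simp
  next
    case False
    then obtain x where "x \<in> S" "\<forall>y\<in>S. s x \<le> s y"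
      using continuous_attains_inf[OF S False continuous_on_subset[OF sc subset_UNIV]] by blast
    then show ?thesis by (intro that[of "s x"] s(3)) simp_all
  qed
  define th where "th x = 1 - (max 0 (1 - x))\<^sup>2" for x :: real
  have th: "(th has_real_derivative 2 * max 0 (1 - x)) (at x)" for x
    unfolding th_def[abs_def]
  proof -
    have u: "((\<lambda>x. 1 - x) has_real_derivative - 1) (at x)" by (auto intro!: derivative_eq_intros)
    from DERIV_diff[OF DERIV_const DERIV_pos_sq_compose[OF u], of 1]
    show "((\<lambda>x. 1 - (max 0 (1 - x))\<^sup>2) has_real_derivative 2 * max 0 (1 - x)) (at x)" by simp
  qed
  define c where "c y = th (0 + (2 / m) * s y)" for y
  have c: "has_cont_grad c (\<lambda>y. (2 * max 0 (1 - (0 + (2 / m) * s y))) *\<^sub>R ((2 / m) *\<^sub>R G y))"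
    unfolding c_def[abs_def] by (rule has_cont_grad_compose[OF has_cont_grad_affine[OF s(1)] th]) (intro continuous_intros)
  have sub: "{y. c y \<noteq> 0} \<subseteq> {y. s y \<noteq> 0}" by (auto simp: c_def th_def)
  show ?thesis
  proof (rule that[OF c])
    show "0 \<le> c y" for y
    proof -
      have "0 \<le> (2 / m) * s y" using m s(2) by simp
      then have "max 0 (1 - (0 + (2 / m) * s y)) \<le> 1" by simp
      then show ?thesis using power_le_one[of "max 0 (1 - (0 + (2 / m) * s y))" 2] by (simp add: c_def th_def)
    qed
    show "open {y. m / 2 < s y}" by (rule open_Collect_less[OF continuous_on_const sc])
    show "S \<subseteq> {y. m / 2 < s y}"
    proof
      fix y assume "y \<in> S"
      then have "m \<le> s y" by (rule m(2))
      then show "y \<in> {y. m / 2 < s y}" using m(1) by simp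
    qed
    show "c y = 1" if "y \<in> {y. m / 2 < s y}" for y
    proof -
      have "1 \<le> (2 / m) * s y" using that m(1) by (simp add: field_simps)
      then show ?thesis by (simp add: c_def th_def)
    qed
    show "compact (supp c)" by (rule compact_supp_subset[OF s(4) sub])
    show "supp c \<subseteq> V" by (rule subset_trans[OF closure_mono[OF sub] s(5)])
  qed
qed

text \<open>\<open>V\<close> and the complement of \<open>K\<close> form an open cover; on their
  overlap the given gradient vanishes by uniqueness of derivatives, so the two local gradients fit
  together.\<close>

lemma has_cont_grad_extend:
  fixes f :: "'a::euclidean_space \<Rightarrow> real"
  assumes V: "open V" and d: "\<And>y. y \<in> V \<Longrightarrow> (f has_derivative (\<lambda>v. G y \<bullet> v)) (at y)" and c: "continuous_on V G"
    and K: "closed K" "K \<subseteq> V" and z: "\<And>y. y \<notin> K \<Longrightarrow> f y = 0"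
  shows "has_cont_grad f (\<lambda>y. if y \<in> V then G y else 0)"
  unfolding has_cont_grad_def
proof (intro conjI allI)
  let ?G = "\<lambda>y. if y \<in> V then G y else 0"
  have out: "(f has_derivative (\<lambda>v. 0)) (at y)" if "y \<notin> K" for y
  proof -
    have "((\<lambda>_. 0) has_derivative (\<lambda>_. 0)) (at y)" by simp
    moreover have "open (- K)" using K(1) by (rule open_Compl)
    ultimately show ?thesis
      by (rule has_derivative_transform_within_open) (use that z in auto)
  qed
  show "(f has_derivative (\<lambda>v. ?G y \<bullet> v)) (at y)" for y
    using d[of y] out[of y] K(2) by (cases "y \<in> V") auto
  have G0: "?G y = 0" if "y \<in> - K" for y
  proof (cases "y \<in> V")
    case True
    have "(\<lambda>v. G y \<bullet> v) = (\<lambda>v. 0)" using has_derivative_unique[OF d[OF True] out] that by blast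
    then have "G y \<bullet> G y = 0" by meson
    then show ?thesis by simp
  qed simp
  have "continuous_on V ?G" using c by (rule continuous_on_eq) simp
  moreover have "continuous_on (- K) ?G"
    by (rule continuous_on_eq[OF continuous_on_const]) (rule G0[symmetric])
  ultimately have "continuous_on (V \<union> - K) ?G"
    using V K(1) by (intro continuous_on_open_Un) auto
  moreover have "V \<union> - K = UNIV" using K(2) by blast
  ultimately show "continuous_on UNIV ?G" by simp
qed

lemma C1_on_grad:
  assumes "C1_on V f"
  shows "y \<in> V \<Longrightarrow> (f has_derivative (\<lambda>v. grad f y \<bullet> v)) (at y)" and "continuous_on V (grad f)"
proof -
  show "(f has_derivative (\<lambda>v. grad f y \<bullet> v)) (at y)" if "y \<in> V"
  proof -
    have d: "(f has_derivative frechet_derivative f (at y)) (at y)"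
      using assms that by (simp add: C1_on_def frechet_derivative_works)
    have "frechet_derivative f (at y) v = grad f y \<bullet> v" for v
    proof -
      have "frechet_derivative f (at y) v = frechet_derivative f (at y) (\<Sum>b\<in>Basis. (v \<bullet> b) *\<^sub>R b)"
        by (simp add: euclidean_representation)
      also have "\<dots> = (\<Sum>b\<in>Basis. (v \<bullet> b) *\<^sub>R frechet_derivative f (at y) b)"
        using has_derivative_linear[OF d] by (simp add: linear_sum linear_scale)
      also have "\<dots> = grad f y \<bullet> v"
        unfolding grad_def inner_sum_left by (intro sum.cong refl) (simp add: inner_commute)
      finally show ?thesis .
    qed
    then have "frechet_derivative f (at y) = (\<lambda>v. grad f y \<bullet> v)" by (rule ext)
    then show ?thesis using d by simp
  qed
  show "continuous_on V (grad f)"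
    unfolding grad_def[abs_def] using assms by (auto simp: C1_on_def intro!: continuous_intros)
qed

text \<open>Only first derivatives of the test function enter the argument; their continuity follows
  by unfolding \<open>smooth_on\<close> twice.\<close>

lemma Cinf_c_C1:
  assumes h: "Cinf_c V h" and V: "open V"
  shows "C1_on V h"
proof -
  have s: "smooth_on V h" using h by (simp add: Cinf_c_def)
  then have d: "\<forall>y\<in>V. h differentiable (at y)" and p: "\<forall>b\<in>Basis. smooth_on V (\<lambda>y. frechet_derivative h (at y) b)"
    by (auto elim: smooth_on.cases)
  have "continuous_on V (\<lambda>y. frechet_derivative h (at y) b)" if "b \<in> Basis" for b
  proof (rule continuous_at_imp_continuous_on, rule ballI)
    fix y assume "y \<in> V"
    moreover have "smooth_on V (\<lambda>y. frechet_derivative h (at y) b)" using p that by blast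
    then have "\<forall>y\<in>V. (\<lambda>y. frechet_derivative h (at y) b) differentiable (at y)"
      by (auto elim: smooth_on.cases)
    ultimately show "isCont (\<lambda>y. frechet_derivative h (at y) b) y"
      using differentiable_imp_continuous_within by blast
  qed
  with d show ?thesis by (simp add: C1_on_def)
qed

text \<open>A signed test function is a difference of two nonnegative ones with \<open>|q|\<^sup>2 \<le> M g\<close>, at an arbitrarily
  small cost in the \<open>L\<^sup>1\<close> norm.\<close>
lemma signed_decomposition:
  fixes h :: "'a::euclidean_space \<Rightarrow> real"
  assumes h: "has_cont_grad h H" and c: "has_cont_grad c Gc" "\<And>y. 0 \<le> c y" "compact (supp c)" and s: "0 < s"
  obtains q M where "has_cont_grad (\<lambda>y. (c y)\<^sup>2 * ((sqrt ((h y)\<^sup>2 + s\<^sup>2) + h y) / 2)) q" "0 \<le> M"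
    "\<And>y. (norm (q y))\<^sup>2 \<le> M * ((c y)\<^sup>2 * ((sqrt ((h y)\<^sup>2 + s\<^sup>2) + h y) / 2))"
    "\<And>y. 0 \<le> (c y)\<^sup>2 * ((sqrt ((h y)\<^sup>2 + s\<^sup>2) + h y) / 2)"
proof -
  \<comment> \<open>A strictly positive regularisation of the positive part with p(x) - p(-x) = x
    and p(x) + p(-x) = sqrt(x^2 + s^2).\<close>
  define p where "p x = (sqrt (x\<^sup>2 + s\<^sup>2) + x) / 2" for x
  define p' where "p' x = (x / sqrt (x\<^sup>2 + s\<^sup>2) + 1) / 2" for x
  have pos: "0 < x\<^sup>2 + s\<^sup>2" for x using s by (simp add: add_nonneg_pos)
  have pd: "(p has_real_derivative p' x) (at x)" for x
    unfolding p_def[abs_def] p'_def using pos[of x] by (auto intro!: derivative_eq_intros simp: field_simps)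
  have p'c: "continuous_on UNIV p'"
    unfolding p'_def[abs_def] using pos by (intro continuous_intros) (auto simp: less_le)
  have pp: "0 < p x" for x
  proof -
    have "sqrt (x\<^sup>2) < sqrt (x\<^sup>2 + s\<^sup>2)" by (rule real_sqrt_less_mono) (use s in simp)
    then show ?thesis by (simp add: p_def)
  qed
  \<comment> \<open>Because c enters squared, the gradient of c^2 p(h) factors as c times
    \<open>q0\<close>. Its square is at most c^2 B^2, while the function itself is at least c^2 m on
    the support of c, as p is bounded below there. Hence M = B^2 / m.\<close>
  define q0 where "q0 y = c y *\<^sub>R (p' (h y) *\<^sub>R H y) + (2 * p (h y)) *\<^sub>R Gc y" for y
  have ph: "has_cont_grad (\<lambda>y. p (h y)) (\<lambda>y. p' (h y) *\<^sub>R H y)" by (rule has_cont_grad_compose[OF h pd p'c])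
  have cc: "has_cont_grad (\<lambda>y. c y * c y) (\<lambda>y. c y *\<^sub>R Gc y + c y *\<^sub>R Gc y)" by (rule has_cont_grad_mult[OF c(1) c(1)])
  have g: "has_cont_grad (\<lambda>y. (c y)\<^sup>2 * p (h y)) (\<lambda>y. c y *\<^sub>R q0 y)"
    using has_cont_grad_mult[OF cc ph] by (simp add: q0_def power2_eq_square algebra_simps scaleR_2[symmetric])
  have phc: "continuous_on UNIV (\<lambda>y. p (h y))" by (rule has_cont_grad_continuous[OF ph])
  have q0c: "continuous_on UNIV q0" unfolding q0_def[abs_def]
  proof -
    have "continuous_on UNIV (\<lambda>y. p' (h y) *\<^sub>R H y)" "continuous_on UNIV Gc"
      using ph c(1) by (simp_all only: has_cont_grad_def)
    then show "continuous_on UNIV (\<lambda>y. c y *\<^sub>R (p' (h y) *\<^sub>R H y) + (2 * p (h y)) *\<^sub>R Gc y)"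
      using continuous_on_add[OF continuous_on_scaleR[OF has_cont_grad_continuous[OF c(1)]]
          continuous_on_scaleR[OF continuous_on_mult[OF continuous_on_const phc]]] by blast
  qed
  obtain B where B: "0 < B" "\<And>y. norm (q0 y) \<le> B"
  proof (rule bounded_off_compact[OF q0c c(3)])
    fix y assume y: "y \<notin> supp c"
    show "q0 y = 0" using not_in_supp[OF y] has_cont_grad_off_supp[OF c(1) y] by (simp only: q0_def scaleR_zero_left scaleR_zero_right mult_zero_right add_0)
  qed blast
  obtain m where m: "0 < m" "\<And>y. y \<in> supp c \<Longrightarrow> m \<le> p (h y)"
  proof (cases "supp c = {}")
    case True
    then show ?thesis using that[of 1] by (simp only: empty_iff zero_less_one)
  next
    case False
    then obtain x where "\<forall>y\<in>supp c. p (h x) \<le> p (h y)"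
      using continuous_attains_inf[OF c(3) False continuous_on_subset[OF phc subset_UNIV]] by blast
    then show ?thesis using pp[of "h x"] that[of "p (h x)"] by blast
  qed
  have bound: "(norm (c y *\<^sub>R q0 y))\<^sup>2 \<le> B\<^sup>2 / m * ((c y)\<^sup>2 * p (h y))" for y
  proof (cases "y \<in> supp c")
    case True
    have "(norm (q0 y))\<^sup>2 \<le> B\<^sup>2" using B by (intro power_mono) auto
    then have "(norm (c y *\<^sub>R q0 y))\<^sup>2 \<le> (c y)\<^sup>2 * B\<^sup>2" by (simp add: power_mult_distrib mult_left_mono)
    also have "\<dots> \<le> (c y)\<^sup>2 * B\<^sup>2 * (p (h y) / m)"
      using m(1) m(2)[OF True] mult_left_mono[of 1 "p (h y) / m" "(c y)\<^sup>2 * B\<^sup>2"] by simp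
    finally show ?thesis by (simp add: algebra_simps)
  next
    case False
    then have "c y = 0" by (rule not_in_supp)
    then show ?thesis by simp
  qed
  have "0 \<le> (c y)\<^sup>2 * p (h y)" for y using pp[of "h y"] by simp
  with g bound show ?thesis
    by (intro that[of "\<lambda>y. c y *\<^sub>R q0 y" "B\<^sup>2 / m"]) (use m(1) in \<open>simp_all add: p_def\<close>)
qed

section \<open>Return to the original set, both signs and conclusion\<close>

lemma perimeter_bound_first_variation:
  fixes E :: "('a::euclidean_space \<times> real) set" and Q :: "'a \<times> real \<Rightarrow> 'a \<times> real" and \<phi> g :: "'a \<Rightarrow> real"
  assumes cal: "perimeter_bound E C" and E: "E \<in> sets lebesgue" and C0: "0 \<le> C" and Q: "orthogonal_transformation Q"
    and \<phi>: "has_cont_grad \<phi> P" and L: "\<And>x. norm (P x) \<le> L" and W: "open W"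
    and nor: "AE y in lborel. y \<in> W \<longrightarrow>
      mt_outer_normal E (Q (y, \<phi> y)) (Q ((1 / sqrt (1 + (norm (P y))\<^sup>2)) *\<^sub>R (P y, -1)))"
    and g: "has_cont_grad g q" and g0: "\<And>y. 0 \<le> g y" and sg: "compact (supp g)" and sW: "supp g \<subseteq> W"
    and M: "0 \<le> M" and qM: "\<And>y. (norm (q y))\<^sup>2 \<le> M * g y"
  shows "0 \<le> (LINT y|lborel. q y \<bullet> P y / sqrt (1 + (norm (P y))\<^sup>2)) + C * (LINT y|lborel. g y)"
proof -
  define F where "F = main_part lborel E"
  have F: "F \<in> sets borel" using main_part_sets[OF E] by (simp add: F_def)
  have eq: "AE x in lborel. (x \<in> E) = (x \<in> F)"
    using AE_in_main_part[OF E] unfolding AE_completion_iff F_def by eventually_elim simp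
  have Qm: "Q \<in> borel_measurable borel" by (rule orthogonal_borel_measurable[OF Q])
  have F': "Q -` F \<in> sets borel" using measurable_sets[OF Qm F] by simp
  have cal': "perimeter_bound_borel (Q -` F) C"
    by (rule perimeter_bound_borel_rotate[OF perimeter_bound_imp_borel[OF cal F eq] Q F])
  have "AE y in lborel. y \<in> W \<longrightarrow>
      normal_limits (Q -` F) (y, \<phi> y) ((1 / sqrt (1 + (norm (P y))\<^sup>2)) *\<^sub>R (P y, -1))"
    using nor
  proof eventually_elim
    case (elim y)
    show ?case
    proof
      assume "y \<in> W"
      with elim have n: "mt_outer_normal E (Q (y, \<phi> y)) (Q ((1 / sqrt (1 + (norm (P y))\<^sup>2)) *\<^sub>R (P y, -1)))" by blast
      show "normal_limits (Q -` F) (y, \<phi> y) ((1 / sqrt (1 + (norm (P y))\<^sup>2)) *\<^sub>R (P y, -1))"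
        unfolding normal_limits_def
        by (intro conjI mt_outer_normal_rotate(1)[OF n Q E F eq] mt_outer_normal_rotate(2)[OF n Q E F eq])
    qed
  qed
  from first_variation_nonneg[OF \<phi> L F' cal' C0 W this g g0 sg sW M qM] show ?thesis .
qed

lemma orthogonal_transformation_flip:
  "orthogonal_transformation (\<lambda>z::'a::euclidean_space \<times> real. (fst z, - snd z))"
  unfolding orthogonal_transformation_def
  by (auto intro!: linearI simp: inner_prod_def)

theorem theorem4:
  fixes K :: "'a::euclidean_space \<times> real \<Rightarrow> real"
    and E :: "('a \<times> real) set"
    and Q :: "'a \<times> real \<Rightarrow> 'a \<times> real"
    and \<phi> :: "'a \<Rightarrow> real"
    and V0 :: "'a set"
    and p lam :: real
  assumes "1 \<le> p" and "0 < lam"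
    and "kernel_assms K p"
    and "(indicator E :: 'a \<times> real \<Rightarrow> real) \<in> minimizer_class K p lam"
    and "orthogonal_transformation Q"
    and "open V0"
    and "C1_on V0 \<phi>"
    and "\<forall>y\<in>V0. Q (y, \<phi> y) \<in> mt_boundary E"
    and "AE y in lebesgue. y \<in> V0 \<longrightarrow>
           mt_outer_normal E (Q (y, \<phi> y))
             (Q ((1 / sqrt (1 + (norm (grad \<phi> y))\<^sup>2)) *\<^sub>R (grad \<phi> y, -1)))"
  shows "\<forall>g. Cinf_c V0 g \<longrightarrow>
           \<bar>LINT y:V0|lebesgue. grad g y \<bullet> grad \<phi> y / sqrt (1 + (norm (grad \<phi> y))\<^sup>2)\<bar>
             \<le> lam * lp_norm p K * (LINT y:V0|lebesgue. \<bar>g y\<bar>)"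
proof (intro allI impI)
  fix h assume hc: "Cinf_c V0 h"
  define C where "C = lam * lp_norm p K"
  have C0: "0 \<le> C" using assms(2) by (simp add: C_def lp_norm_def)
  note mc = minimizer_perimeter_bound[OF assms(1-4), folded C_def]
  note Q = assms(5) and V0 = assms(6) and \<phi>C1 = assms(7)
  define S where "S = supp h"
  have S: "compact S" "S \<subseteq> V0" using hc unfolding S_def Cinf_c_def by blast+
  have hS: "h y = 0" if "y \<notin> S" for y using that unfolding S_def by (rule not_in_supp)
  define H where "H y = (if y \<in> V0 then grad h y else 0)" for y
  note hg = C1_on_grad[OF Cinf_c_C1[OF hc V0]]
  have h: "has_cont_grad h H"
    unfolding H_def[abs_def]
    by (rule has_cont_grad_extend[OF V0 hg compact_imp_closed[OF S(1)] S(2) hS])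
  \<comment> \<open>Two nested cutoffs. \<open>c\<close>, equal to 1 on the support of
    \<open>h\<close>, confines the regularised parts of \<open>h\<close>. \<open>k\<close>, equal to
    1 near the support of \<open>c\<close>, turns \<open>\<phi>\<close> into a C^1 function on the
    whole space with bounded gradient, unchanged where those parts live.\<close>
  obtain c Gc W1 where c: "has_cont_grad c Gc" "\<And>y. 0 \<le> c y" and W1: "open W1" "S \<subseteq> W1" "\<And>y. y \<in> W1 \<Longrightarrow> c y = 1"
    and cs: "compact (supp c)" "supp c \<subseteq> V0"
  proof (rule cutoff_exists[OF S(1) V0 S(2)], goal_cases)
    case (1 c G W)
    from 1(2-8) show ?case by (rule 1(1))
  qed
  obtain k Gk W2 where k: "has_cont_grad k Gk" "\<And>y. 0 \<le> k y" and W2: "open W2" "supp c \<subseteq> W2" "\<And>y. y \<in> W2 \<Longrightarrow> k y = 1"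
    and ks: "compact (supp k)" "supp k \<subseteq> V0"
  proof (rule cutoff_exists[OF cs(1) V0 cs(2)], goal_cases)
    case (1 k G W)
    from 1(2-8) show ?case by (rule 1(1))
  qed
  note \<phi>g = C1_on_grad[OF \<phi>C1]
  define f where "f y = k y * \<phi> y" for y
  define P where "P y = (if y \<in> V0 then k y *\<^sub>R grad \<phi> y + \<phi> y *\<^sub>R Gk y else 0)" for y
  have \<phi>c: "continuous_on V0 \<phi>"
    using \<phi>g(1) has_derivative_continuous by (blast intro: continuous_at_imp_continuous_on)
  have f: "has_cont_grad f P"
    unfolding P_def[abs_def]
  proof (rule has_cont_grad_extend[OF V0 _ _ compact_imp_closed[OF ks(1)] ks(2)])
    show "(f has_derivative (\<lambda>v. (k y *\<^sub>R grad \<phi> y + \<phi> y *\<^sub>R Gk y) \<bullet> v)) (at y)" if "y \<in> V0" for y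
    proof -
      have "(k has_derivative (\<lambda>v. Gk y \<bullet> v)) (at y)" using k(1) by (simp add: has_cont_grad_def)
      from has_derivative_mult[OF this \<phi>g(1)[OF that]] show ?thesis
        unfolding f_def[abs_def] by (simp add: inner_add_left mult.commute)
    qed
    show "continuous_on V0 (\<lambda>y. k y *\<^sub>R grad \<phi> y + \<phi> y *\<^sub>R Gk y)"
    proof -
      have "continuous_on V0 k" "continuous_on V0 Gk"
        using has_cont_grad_continuous[OF k(1)] k(1) continuous_on_subset by (auto simp: has_cont_grad_def)
      then show ?thesis using \<phi>c \<phi>g(2) by (intro continuous_on_add continuous_on_scaleR)
    qed
    show "f y = 0" if "y \<notin> supp k" for y using not_in_supp[OF that] by (simp add: f_def)
  qed
  define W where "W = W2 \<inter> V0"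
  have W: "open W" unfolding W_def using W2(1) V0 by (rule open_Int)
  have fW: "f y = \<phi> y" if "y \<in> W" for y using W2(3) that by (simp add: f_def W_def)
  have PW: "P y = grad \<phi> y" if y: "y \<in> W" for y
  proof -
    have "(f has_derivative (\<lambda>v. grad \<phi> y \<bullet> v)) (at y)"
      by (rule has_derivative_transform_within_open[OF \<phi>g(1) W y]) (use y fW in \<open>simp_all add: W_def\<close>)
    moreover have "(f has_derivative (\<lambda>v. P y \<bullet> v)) (at y)" using f by (simp add: has_cont_grad_def)
    ultimately have "(\<lambda>v. grad \<phi> y \<bullet> v) = (\<lambda>v. P y \<bullet> v)" by (rule has_derivative_unique)
    from fun_cong[OF this, of "P y - grad \<phi> y"] have "(P y - grad \<phi> y) \<bullet> (P y - grad \<phi> y) = 0"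
      by (simp only: inner_diff_left)
    then show ?thesis by simp
  qed
  have scW: "supp c \<subseteq> W" using W2(2) cs(2) by (simp only: W_def Int_subset_iff)
  have Pc: "continuous_on UNIV P" using f by (simp add: has_cont_grad_def)
  obtain L where L: "\<And>y. norm (P y) \<le> L"
  proof (rule bounded_off_compact[OF Pc ks(1)])
    show "P y = 0" if "y \<notin> supp k" for y
    proof (rule has_cont_grad_off_supp[OF f])
      have "supp f \<subseteq> supp k" by (rule closure_mono) (auto simp: f_def)
      then show "y \<notin> supp f" using that by blast
    qed
  qed blast
  let ?w = "\<lambda>y. sqrt (1 + (norm (P y))\<^sup>2)"
  have w0: "0 < ?w y" for y by (simp add: add_pos_nonneg)
  have nor: "AE y in lborel. y \<in> W \<longrightarrow> mt_outer_normal E (Q (y, f y)) (Q ((1 / ?w y) *\<^sub>R (P y, -1)))"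
    using assms(9) unfolding AE_completion_iff
  proof eventually_elim
    case (elim y)
    then show ?case using fW[of y] PW[of y] by (auto simp: W_def)
  qed
  let ?R = "\<lambda>z::'a \<times> real. (fst z, - snd z)"
  \<comment> \<open>In the reflected coordinates the complement lies above the graph of - f, and (-
    P, -1) is sent to the negative of the image of (P, -1) under \<open>Q\<close>, which is the
    outer normal of the complement.\<close>
  define Q' where "Q' = Q \<circ> ?R"
  have Q': "orthogonal_transformation Q'"
    unfolding Q'_def by (rule orthogonal_transformation_compose[OF Q orthogonal_transformation_flip])
  have nf: "has_cont_grad (\<lambda>y. - f y) (\<lambda>y. - P y)" using has_cont_grad_affine[OF f, of 0 "-1"] by simp
  have nor': "AE y in lborel. y \<in> W \<longrightarrow>
      mt_outer_normal (- E) (Q' (y, - f y)) (Q' ((1 / sqrt (1 + (norm (- P y))\<^sup>2)) *\<^sub>R (- P y, -1)))"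
    using nor
  proof eventually_elim
    case (elim y)
    have "Q' ((1 / ?w y) *\<^sub>R (- P y, -1)) = Q (- ((1 / ?w y) *\<^sub>R (P y, -1)))" by (simp add: Q'_def)
    also have "\<dots> = - Q ((1 / ?w y) *\<^sub>R (P y, -1))"
      by (rule linear_neg[OF orthogonal_transformation_linear[OF Q]])
    finally have "Q' ((1 / ?w y) *\<^sub>R (- P y, -1)) = - Q ((1 / ?w y) *\<^sub>R (P y, -1))" .
    moreover have "Q' (y, - f y) = Q (y, f y)" by (simp add: Q'_def)
    ultimately show ?case using elim mt_outer_normal_Compl by (simp only: norm_minus_cancel) blast
  qed
  have nL: "norm (- P y) \<le> L" for y by (simp add: L)
  have nE: "- E \<in> sets lebesgue" using mc(1) by (metis Compl_in_sets_lebesgue)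
  let ?l = "\<lambda>G. LINT y|lborel. G y \<bullet> P y / ?w y"
  \<comment> \<open>\<open>E\<close> bounds the variation from below and \<open>- E\<close> from
    above: passing from f to - f changes the sign of P but not the square root.\<close>
  have both: "\<bar>?l q\<bar> \<le> C * (LINT y|lborel. g y)"
    if g: "has_cont_grad g q" "\<And>y. 0 \<le> g y" "{y. g y \<noteq> 0} \<subseteq> {y. c y \<noteq> 0}" "0 \<le> M" "\<And>y. (norm (q y))\<^sup>2 \<le> M * g y" for g q M
  proof -
    have sg: "compact (supp g)" by (rule compact_supp_subset[OF cs(1) g(3)])
    have sW: "supp g \<subseteq> W" using closure_mono[OF g(3)] scW by (rule subset_trans)
    have "0 \<le> ?l q + C * (LINT y|lborel. g y)"
      by (rule perimeter_bound_first_variation[OF mc(2,1) C0 Q f L W nor g(1,2) sg sW g(4,5)])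
    moreover have "0 \<le> (LINT y|lborel. q y \<bullet> (- P y) / sqrt (1 + (norm (- P y))\<^sup>2)) + C * (LINT y|lborel. g y)"
      by (rule perimeter_bound_first_variation[OF mc(3) nE C0 Q' nf nL W nor' g(1,2) sg sW g(4,5)])
    then have "0 \<le> - ?l q + C * (LINT y|lborel. g y)" by simp
    ultimately show ?thesis by linarith
  qed
  have icz: "integrable lborel u" if u: "continuous_on UNIV u" "\<And>y. c y = 0 \<Longrightarrow> u y = 0" for u :: "'a \<Rightarrow> real"
  proof (rule integrable_continuous_support[OF u(1) compact_imp_bounded[OF cs(1)]])
    fix y assume "y \<notin> supp c"
    then have "c y = 0" by (rule not_in_supp)
    then show "u y = 0" by (rule u(2))
  qed
  have c2: "integrable lborel (\<lambda>y. (c y)\<^sup>2)"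
    by (rule icz) (simp_all add: continuous_on_power has_cont_grad_continuous[OF c(1)])
  have habs: "integrable lborel (\<lambda>y. \<bar>h y\<bar>)"
    by (rule integrable_continuous_support[OF _ compact_imp_bounded[OF S(1)]])
      (simp_all add: hS continuous_on_rabs has_cont_grad_continuous[OF h])
  have il: "integrable lborel (\<lambda>y. G y \<bullet> P y / ?w y)"
    if G: "continuous_on UNIV G" "\<And>y. y \<notin> supp c \<Longrightarrow> G y = 0" for G
  proof (rule integrable_continuous_support[OF _ compact_imp_bounded[OF cs(1)]])
    show "continuous_on UNIV (\<lambda>y. G y \<bullet> P y / ?w y)"
      by (intro continuous_intros G(1) Pc) (use w0 in \<open>auto simp: less_le\<close>)
    show "G y \<bullet> P y / ?w y = 0" if "y \<notin> supp c" for y by (simp only: G(2)[OF that] inner_zero_left div_0)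
  qed
  have chh: "(c y)\<^sup>2 * h y = h y" for y
    using W1(2,3) hS[of y] by (cases "y \<in> S") auto
  \<comment> \<open>The factor c^2 is indispensable for compact support, since the regularised parts
    equal s/2 where \<open>h\<close> vanishes. As c = 1 on the support of \<open>h\<close>, the
    difference of the two parts is still \<open>h\<close>, and their sum c^2 sqrt(h^2 + s^2) is at
    most |h| + s c^2.\<close>
  have small: "0 \<le> (C * (LINT y|lborel. \<bar>h y\<bar>) - \<bar>?l H\<bar>) + s * (C * (LINT y|lborel. (c y)\<^sup>2))" if s: "0 < s" for s
  proof -
    let ?g1 = "\<lambda>y. (c y)\<^sup>2 * ((sqrt ((h y)\<^sup>2 + s\<^sup>2) + h y) / 2)"
    let ?g2 = "\<lambda>y. (c y)\<^sup>2 * ((sqrt ((- h y)\<^sup>2 + s\<^sup>2) + - h y) / 2)"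
    have nh: "has_cont_grad (\<lambda>y. - h y) (\<lambda>y. - H y)" using has_cont_grad_affine[OF h, of 0 "-1"] by simp
    obtain q1 M1 where g1: "has_cont_grad ?g1 q1" "0 \<le> M1" "\<And>y. (norm (q1 y))\<^sup>2 \<le> M1 * ?g1 y" "\<And>y. 0 \<le> ?g1 y"
      by (rule signed_decomposition[OF h c cs(1) s]) blast
    obtain q2 M2 where g2: "has_cont_grad ?g2 q2" "0 \<le> M2" "\<And>y. (norm (q2 y))\<^sup>2 \<le> M2 * ?g2 y" "\<And>y. 0 \<le> ?g2 y"
      by (rule signed_decomposition[OF nh c cs(1) s]) blast
    have sub: "{y. ?g1 y \<noteq> 0} \<subseteq> {y. c y \<noteq> 0}" "{y. ?g2 y \<noteq> 0} \<subseteq> {y. c y \<noteq> 0}" by auto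
    have b1: "\<bar>?l q1\<bar> \<le> C * (LINT y|lborel. ?g1 y)" by (rule both[OF g1(1,4) sub(1) g1(2,3)])
    have b2: "\<bar>?l q2\<bar> \<le> C * (LINT y|lborel. ?g2 y)" by (rule both[OF g2(1,4) sub(2) g2(2,3)])
    have "has_cont_grad (\<lambda>y. ?g1 y + (0 + (-1) * ?g2 y)) (\<lambda>y. q1 y + (-1) *\<^sub>R q2 y)"
      by (rule has_cont_grad_add[OF g1(1) has_cont_grad_affine[OF g2(1)]])
    moreover have "(\<lambda>y. ?g1 y + (0 + (-1) * ?g2 y)) = h"
    proof
      fix y
      have "?g1 y + (0 + (-1) * ?g2 y) = (c y)\<^sup>2 * h y" by (simp add: field_simps)
      then show "?g1 y + (0 + (-1) * ?g2 y) = h y" by (simp only: chh)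
    qed
    ultimately have "has_cont_grad h (\<lambda>y. q1 y + (-1) *\<^sub>R q2 y)" by simp
    from has_cont_grad_unique[OF h this] have Hq: "H y = q1 y - q2 y" for y by simp
    have z: "q1 y = 0" "q2 y = 0" if "y \<notin> supp c" for y
      using has_cont_grad_off_supp[OF g1(1), of y] has_cont_grad_off_supp[OF g2(1), of y]
        closure_mono[OF sub(1)] closure_mono[OF sub(2)] that by blast+
    have qc: "continuous_on UNIV q1" "continuous_on UNIV q2" using g1(1) g2(1) by (simp_all only: has_cont_grad_def)
    have gi: "integrable lborel ?g1" "integrable lborel ?g2"
      by (rule icz[OF has_cont_grad_continuous[OF g1(1)]], simp, rule icz[OF has_cont_grad_continuous[OF g2(1)]], simp)
    have "?l H = (LINT y|lborel. q1 y \<bullet> P y / ?w y - q2 y \<bullet> P y / ?w y)"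
      by (simp only: Hq inner_diff_left diff_divide_distrib)
    also have "\<dots> = ?l q1 - ?l q2"
      by (rule Bochner_Integration.integral_diff[OF il[OF qc(1) z(1)] il[OF qc(2) z(2)]])
    finally have "\<bar>?l H\<bar> \<le> C * ((LINT y|lborel. ?g1 y) + (LINT y|lborel. ?g2 y))"
      using b1 b2 by (simp add: distrib_left)
    also have "(LINT y|lborel. ?g1 y) + (LINT y|lborel. ?g2 y) = (LINT y|lborel. ?g1 y + ?g2 y)"
      using gi by simp
    also have "C * (LINT y|lborel. ?g1 y + ?g2 y) \<le> C * (LINT y|lborel. \<bar>h y\<bar> + s * (c y)\<^sup>2)"
    proof (rule mult_left_mono[OF integral_mono C0])
      show "integrable lborel (\<lambda>y. ?g1 y + ?g2 y)" using gi by (rule Bochner_Integration.integrable_add)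
      show "integrable lborel (\<lambda>y. \<bar>h y\<bar> + s * (c y)\<^sup>2)" using habs c2 by simp
      show "?g1 y + ?g2 y \<le> \<bar>h y\<bar> + s * (c y)\<^sup>2" for y
      proof -
        have "?g1 y + ?g2 y = (c y)\<^sup>2 * sqrt ((h y)\<^sup>2 + s\<^sup>2)" by (simp add: field_simps)
        also have "\<dots> \<le> (c y)\<^sup>2 * (\<bar>h y\<bar> + s)"
          using sqrt_sum_squares_le_sum_abs[of "h y" s] s by (intro mult_left_mono) auto
        also have "\<dots> = \<bar>(c y)\<^sup>2 * h y\<bar> + s * (c y)\<^sup>2" by (simp add: abs_mult algebra_simps)
        finally show ?thesis by (simp only: chh)
      qed
    qed
    also have "\<dots> = C * (LINT y|lborel. \<bar>h y\<bar>) + s * (C * (LINT y|lborel. (c y)\<^sup>2))"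
      using habs c2 by (simp add: algebra_simps)
    finally show ?thesis by simp
  qed
  have main: "\<bar>?l H\<bar> \<le> C * (LINT y|lborel. \<bar>h y\<bar>)"
    using nonneg_of_le_small[OF small] by simp
  have Sc: "S \<subseteq> supp c"
  proof
    fix y assume "y \<in> S"
    then have "y \<in> {y. c y \<noteq> 0}" using W1(2,3) by auto
    then show "y \<in> supp c" by (rule subsetD[OF closure_subset])
  qed
  then have SW: "S \<subseteq> W" using scW by (rule subset_trans)
  have HS: "H y = 0" if "y \<notin> S" for y
    by (rule has_cont_grad_off_supp[OF h]) (use that in \<open>simp only: S_def not_False_eq_True\<close>)
  have i1: "indicator V0 y *\<^sub>R (grad h y \<bullet> grad \<phi> y / sqrt (1 + (norm (grad \<phi> y))\<^sup>2)) = H y \<bullet> P y / ?w y" for y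
  proof (cases "y \<in> S")
    case True
    then have "y \<in> W" using SW by blast
    then show ?thesis using PW[of y] by (simp add: W_def H_def)
  next
    case False
    then show ?thesis using HS[of y] by (cases "y \<in> V0") (simp_all add: H_def)
  qed
  have i2: "indicator V0 y *\<^sub>R \<bar>h y\<bar> = \<bar>h y\<bar>" for y
    using hS[of y] S(2) by (cases "y \<in> V0") auto
  have m1: "(\<lambda>y. H y \<bullet> P y / ?w y) \<in> borel_measurable lborel"
  proof (rule borel_measurable_integrable[OF il])
    show "continuous_on UNIV H" using h by (simp only: has_cont_grad_def)
    show "H y = 0" if "y \<notin> supp c" for y using HS[of y] Sc that by blast
  qed
  show "\<bar>LINT y:V0|lebesgue. grad h y \<bullet> grad \<phi> y / sqrt (1 + (norm (grad \<phi> y))\<^sup>2)\<bar>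
      \<le> lam * lp_norm p K * (LINT y:V0|lebesgue. \<bar>h y\<bar>)"
    unfolding set_lebesgue_integral_def i1 i2 C_def[symmetric]
    using main m1 habs by (simp only: integral_completion borel_measurable_integrable)
qed

end
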